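(* Let $O$ be a Haar-distributed $N\times N$ orthogonal matrix. Let $\varphi\in S_n$, let $\varepsilon:[n]\to\{1,-1\}$, let $\delta_\varepsilon:k\mapsto\varepsilon(|k|)k$ on $\pm[n]$, and let $X_1,\ldots,X_n\in M_{N\times N}(\mathbb{C})$ be random matrices independent from $O$ (with the expectations below existing). Then $$\mathbb{E}\left[\mathrm{tr}_{\varphi}\left(O^{\varepsilon(1)}X_1,\ldots,O^{\varepsilon(n)}X_n\right)\right]$$ $$=\sum_{(\pi_+,\pi_-)\in\mathcal{P}_2(n)^2}N^{\chi(\varphi,\delta_\varepsilon\pi_-\delta\pi_+\delta_\varepsilon)-2\#(\varphi)}\,\mathrm{wg}(\pi_+,\pi_-)\,\mathbb{E}\left[\mathrm{tr}_{K(\varphi,\delta_\varepsilon\pi_-\delta\pi_+\delta_\varepsilon)^{-1}/2}(X_1,\ldots,X_n)\right]$$ $$=\sum_{\alpha\in PM_{\mathrm{alt}}(\pm[n])}N^{\chi(\varphi,\delta_\varepsilon\alpha\delta_\varepsilon)-2\#(\varphi)}\,\mathrm{wg}(\lambda(\alpha))\,\mathbb{E}\left[\mathrm{tr}_{K(\varphi,\delta_\varepsilon\alpha\delta_\varepsilon)^{-1}/2}(X_1,\ldots,X_n)\right].$$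
   Context: Sets and permutations. $[n]=\{1,\ldots,n\}$; for $I\subseteq\mathbb{Z}$, $-I=\{-k:k\in I\}$ and $\pm I=I\cup(-I)$; $\delta:k\mapsto -k$. $S(I)$ is the set of permutations of $I$, $S_n=S([n])$. A permutation of a set is extended to larger sets by acting trivially on the other elements; products are composed from right to left. $\#(\pi)$ is the number of cycles of a permutation $\pi$ on its domain (fixed points included), or the number of blocks of a partition $\pi$. $\mathcal{P}_2(n)$ is the set of pairings of $[n]$ (partitions all of whose blocks have two elements), each identified with the permutation exchanging the two elements of each block; it is empty for $n$ odd. $\pi_+\vee\pi_-$ is the join in the lattice of partitions of $[n]$. Premaps. For $I$ a finite set of integers with $I\cap(-I)=\emptyset$, a premap is $\pi\in S(\pm I)$ with $\delta\pi\delta=\pi^{-1}$ and no cycle containing both $k$ and $-k$ for any $k\in I$; $PM(\pm I)$ is the set of premaps. $PM_{\mathrm{alt}}(\pm I)$ is the set of premaps $\pi$ which are alternating, i.e. $\mathrm{sgn}(\pi(k))=-\mathrm{sgn}(k)$ for all $k$. A cycle of a premap is particular if its element $k$ with smallest $|k|$ is positive; $\pi/2$ denotes the set of elements in particular cycles and also the permutation $\pi$ restricted to this set. For $\varphi\in S(I)$, $\varphi_+:=\varphi$, $\varphi_-:=\delta\varphi\delta$, and for $\alpha\in PM(\pm I)$ $$K(\varphi,\alpha)=\varphi_+^{-1}\alpha^{-1}\varphi_-,\qquad \chi(\varphi,\alpha)=\#(\varphi_+\varphi_-^{-1})/2+\#(\alpha)/2+\#(K(\varphi,\alpha))/2-|I|,$$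 where all permutations are regarded as permutations of $\pm I$. $K(\varphi,\alpha)$ and its inverse are premaps. Traces. $\mathrm{Tr}$ is the usual trace, $\mathrm{tr}=\frac1N\mathrm{Tr}$. $X_{-k}:=X_k^T$ (transpose), and $O^{-1}=O^T$. For a permutation $\pi=(c_{1,1},\ldots,c_{1,n_1})\cdots(c_{r,1},\ldots,c_{r,n_r})$ of a subset of $\pm[n]$, $\mathrm{tr}_\pi(X_1,\ldots,X_n):=\prod_{k=1}^r\mathrm{tr}(X_{c_{k,1}}\cdots X_{c_{k,n_k}})$. Weingarten function. $[\mathrm{Wg}(\pi_+,\pi_-)]_{\pi_+,\pi_-\in\mathcal{P}_2(n)}$ is the pseudoinverse of the Gram matrix $G(\pi_+,\pi_-)=N^{\#(\pi_+\vee\pi_-)}$, and $\mathrm{wg}(\pi_+,\pi_-):=N^{n-\#(\pi_+\vee\pi_-)}\mathrm{Wg}(\pi_+,\pi_-)$. These depend only on the block sizes $n_1,\ldots,n_r$ (all even) of $\pi_+\vee\pi_-$, so they are also indexed by the Young diagram (unordered list of positive integers) with rows of length $n_1/2,\ldots,n_r/2$. For $\alpha\in PM_{\mathrm{alt}}(\pm[n])$, all cycles of $\alpha$ have even length, and $\lambda(\alpha)$ is the Young diagram whose row lengths are half the lengths of the cycles of $\alpha/2$. *)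

theory Defs
  imports
    "HOL-Probability.Probability"
    "HOL-Combinatorics.Combinatorics"
begin

section \<open>Permutations of sets of integers\<close>

text \<open>A permutation of \<open>A\<close> is a function with \<open>\<pi> permutes A\<close>, hence the identity outside \<open>A\<close>;
  products of permutations are function compositions.\<close>

abbreviation intv :: "nat \<Rightarrow> int set" where
  "intv n \<equiv> {1..int n}"

definition pm :: "int set \<Rightarrow> int set" where
  "pm I = I \<union> uminus ` I"

definition delta :: "int set \<Rightarrow> int \<Rightarrow> int" where
  "delta I k = (if k \<in> pm I then - k else k)"

definition delta_eps :: "int set \<Rightarrow> (int \<Rightarrow> int) \<Rightarrow> int \<Rightarrow> int" where
  "delta_eps I \<epsilon> k = (if k \<in> pm I then \<epsilon> \<bar>k\<bar> * k else k)"

text \<open>Cycles as sets; fixed points in \<open>A\<close> give singletons.\<close>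

definition cycles_on :: "int set \<Rightarrow> (int \<Rightarrow> int) \<Rightarrow> int set set" where
  "cycles_on A \<pi> = orbit \<pi> ` A"

definition num_cycles :: "int set \<Rightarrow> (int \<Rightarrow> int) \<Rightarrow> nat" where
  "num_cycles A \<pi> = card (cycles_on A \<pi>)"


section \<open>Premaps\<close>

text \<open>The set \<open>I\<close> is meant to be finite and disjoint from \<open>- I\<close>.\<close>

definition premaps :: "int set \<Rightarrow> (int \<Rightarrow> int) set" where
  "premaps I = {\<pi>. \<pi> permutes pm I \<and> delta I \<circ> \<pi> \<circ> delta I = inv \<pi> \<and>
                   (\<forall>k\<in>I. \<not> (\<exists>c\<in>cycles_on (pm I) \<pi>. k \<in> c \<and> - k \<in> c))}"

definition alt_premaps :: "int set \<Rightarrow> (int \<Rightarrow> int) set" where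
  "alt_premaps I = {\<pi> \<in> premaps I. \<forall>k\<in>pm I. sgn (\<pi> k) = - sgn k}"

text \<open>In a cycle of a premap the element of smallest absolute value is unique.\<close>

definition particular :: "int set \<Rightarrow> bool" where
  "particular c \<longleftrightarrow> (\<exists>k\<in>c. 0 < k \<and> (\<forall>j\<in>c. \<bar>k\<bar> \<le> \<bar>j\<bar>))"

definition half_set :: "int set \<Rightarrow> (int \<Rightarrow> int) \<Rightarrow> int set" where
  "half_set I \<pi> = \<Union> {c \<in> cycles_on (pm I) \<pi>. particular c}"

definition half_perm :: "int set \<Rightarrow> (int \<Rightarrow> int) \<Rightarrow> int \<Rightarrow> int" where
  "half_perm I \<pi> = perm_restrict \<pi> (half_set I \<pi>)"

definition minus_perm :: "int set \<Rightarrow> (int \<Rightarrow> int) \<Rightarrow> int \<Rightarrow> int" where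
  "minus_perm I \<phi> = delta I \<circ> \<phi> \<circ> delta I"

definition K_map :: "int set \<Rightarrow> (int \<Rightarrow> int) \<Rightarrow> (int \<Rightarrow> int) \<Rightarrow> int \<Rightarrow> int" where
  "K_map I \<phi> \<alpha> = inv \<phi> \<circ> inv \<alpha> \<circ> minus_perm I \<phi>"

definition chi :: "int set \<Rightarrow> (int \<Rightarrow> int) \<Rightarrow> (int \<Rightarrow> int) \<Rightarrow> real" where
  "chi I \<phi> \<alpha> =
     real (num_cycles (pm I) (\<phi> \<circ> inv (minus_perm I \<phi>))) / 2
     + real (num_cycles (pm I) \<alpha>) / 2
     + real (num_cycles (pm I) (K_map I \<phi> \<alpha>)) / 2
     - real (card I)"


section \<open>Pairings\<close>

definition pairings :: "nat \<Rightarrow> int set set set" where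
  "pairings n = {P. partition_on (intv n) P \<and> (\<forall>B\<in>P. card B = 2)}"

definition pairing_perm :: "int set set \<Rightarrow> int \<Rightarrow> int" where
  "pairing_perm P k = (if k \<in> \<Union> P then (THE j. {k, j} \<in> P) else k)"

text \<open>Least upper bound for the refinement order on the partitions of \<open>A\<close>.\<close>

definition partition_join :: "'a set \<Rightarrow> 'a set set \<Rightarrow> 'a set set \<Rightarrow> 'a set set" where
  "partition_join A P Q =
     (THE R. refines A P R \<and> refines A Q R \<and>
             (\<forall>S. refines A P S \<and> refines A Q S \<longrightarrow> refines A R S))"

definition pair_premap :: "nat \<Rightarrow> int set set \<Rightarrow> int set set \<Rightarrow> int \<Rightarrow> int" where
  "pair_premap n \<pi>\<^sub>p \<pi>\<^sub>m = pairing_perm \<pi>\<^sub>m \<circ> delta (intv n) \<circ> pairing_perm \<pi>\<^sub>p"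

definition twist :: "nat \<Rightarrow> (int \<Rightarrow> int) \<Rightarrow> (int \<Rightarrow> int) \<Rightarrow> int \<Rightarrow> int" where
  "twist n \<epsilon> \<alpha> = delta_eps (intv n) \<epsilon> \<circ> \<alpha> \<circ> delta_eps (intv n) \<epsilon>"


section \<open>Weingarten function\<close>

text \<open>Matrices with rows and columns indexed by a finite set \<open>J\<close> are functions
  \<open>'i \<Rightarrow> 'i \<Rightarrow> real\<close> vanishing outside \<open>J \<times> J\<close>. The predicate consists of the four Moore-Penrose
  conditions; for real matrices the adjoint is the transpose.\<close>

definition mmult_on :: "'i set \<Rightarrow> ('i \<Rightarrow> 'i \<Rightarrow> real) \<Rightarrow> ('i \<Rightarrow> 'i \<Rightarrow> real) \<Rightarrow> 'i \<Rightarrow> 'i \<Rightarrow> real" where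
  "mmult_on J A B i j = (\<Sum>k\<in>J. A i k * B k j)"

definition is_pseudoinverse_on ::
    "'i set \<Rightarrow> ('i \<Rightarrow> 'i \<Rightarrow> real) \<Rightarrow> ('i \<Rightarrow> 'i \<Rightarrow> real) \<Rightarrow> bool" where
  "is_pseudoinverse_on J A B \<longleftrightarrow>
     (\<forall>i\<in>J. \<forall>j\<in>J. mmult_on J (mmult_on J A B) A i j = A i j) \<and>
     (\<forall>i\<in>J. \<forall>j\<in>J. mmult_on J (mmult_on J B A) B i j = B i j) \<and>
     (\<forall>i\<in>J. \<forall>j\<in>J. mmult_on J A B i j = mmult_on J A B j i) \<and>
     (\<forall>i\<in>J. \<forall>j\<in>J. mmult_on J B A i j = mmult_on J B A j i)"

definition pseudoinverse_on :: "'i set \<Rightarrow> ('i \<Rightarrow> 'i \<Rightarrow> real) \<Rightarrow> 'i \<Rightarrow> 'i \<Rightarrow> real" where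
  "pseudoinverse_on J A =
     (THE B. is_pseudoinverse_on J A B \<and> (\<forall>i j. i \<notin> J \<or> j \<notin> J \<longrightarrow> B i j = 0))"

definition gram :: "nat \<Rightarrow> nat \<Rightarrow> int set set \<Rightarrow> int set set \<Rightarrow> real" where
  "gram N n \<pi>\<^sub>p \<pi>\<^sub>m = real N ^ card (partition_join (intv n) \<pi>\<^sub>p \<pi>\<^sub>m)"

definition Wg :: "nat \<Rightarrow> nat \<Rightarrow> int set set \<Rightarrow> int set set \<Rightarrow> real" where
  "Wg N n = pseudoinverse_on (pairings n) (gram N n)"

definition wg :: "nat \<Rightarrow> nat \<Rightarrow> int set set \<Rightarrow> int set set \<Rightarrow> real" where
  "wg N n \<pi>\<^sub>p \<pi>\<^sub>m =
     real N powi (int n - int (card (partition_join (intv n) \<pi>\<^sub>p \<pi>\<^sub>m))) * Wg N n \<pi>\<^sub>p \<pi>\<^sub>m"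

text \<open>Young diagrams are multisets of row lengths. A diagram with \<open>m\<close> boxes indexes the common
  value of \<open>wg\<close> at the pairs of pairings of \<open>[2 m]\<close> having that diagram.\<close>

definition half_diagram :: "int set set \<Rightarrow> nat multiset" where
  "half_diagram C = image_mset (\<lambda>c. card c div 2) (mset_set C)"

definition wg_diagram :: "nat \<Rightarrow> nat multiset \<Rightarrow> real" where
  "wg_diagram N Y =
     (let n = 2 * sum_mset Y in
      THE w. \<exists>\<pi>\<^sub>p\<in>pairings n. \<exists>\<pi>\<^sub>m\<in>pairings n.
        half_diagram (partition_join (intv n) \<pi>\<^sub>p \<pi>\<^sub>m) = Y \<and> w = wg N n \<pi>\<^sub>p \<pi>\<^sub>m)"

definition young :: "int set \<Rightarrow> (int \<Rightarrow> int) \<Rightarrow> nat multiset" where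
  "young I \<alpha> = half_diagram (cycles_on (half_set I \<alpha>) (half_perm I \<alpha>))"


section \<open>Traces along permutations\<close>

definition ntr :: "complex^'d^'d \<Rightarrow> complex" where
  "ntr A = trace A / of_nat CARD('d)"

definition signed_mat :: "(int \<Rightarrow> complex^'d^'d) \<Rightarrow> int \<Rightarrow> complex^'d^'d" where
  "signed_mat X k = (if 0 < k then X k else transpose (X (- k)))"

definition mat_prod_list :: "(complex^'d^'d) list \<Rightarrow> complex^'d^'d" where
  "mat_prod_list As = foldr (**) As (mat 1)"

text \<open>\<open>support \<pi> k = [k, \<pi> k, \<pi> (\<pi> k), \<dots>]\<close> lists a cycle once, starting from \<open>k\<close>. The trace does
  not depend on the starting point of the cycle, which is taken to be its least element.\<close>

definition tr_perm :: "int set \<Rightarrow> (int \<Rightarrow> int) \<Rightarrow> (int \<Rightarrow> complex^'d^'d) \<Rightarrow> complex" where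
  "tr_perm A \<pi> X =
     (\<Prod>c\<in>cycles_on A \<pi>. ntr (mat_prod_list (map (signed_mat X) (support \<pi> (Min c)))))"

definition tr_half :: "int set \<Rightarrow> (int \<Rightarrow> int) \<Rightarrow> (int \<Rightarrow> complex^'d^'d) \<Rightarrow> complex" where
  "tr_half I \<pi> X = tr_perm (half_set I \<pi>) (half_perm I \<pi>) X"


section \<open>Random matrices\<close>

text \<open>The Haar probability measure of the orthogonal group, as a measure on all real matrices.\<close>

definition haar_orthogonal_measure :: "(real^'d^'d) measure \<Rightarrow> bool" where
  "haar_orthogonal_measure \<mu> \<longleftrightarrow>
     prob_space \<mu> \<and> sets \<mu> = sets borel \<and> (AE A in \<mu>. orthogonal_matrix A) \<and>
     (\<forall>Q. orthogonal_matrix Q \<longrightarrow> distr \<mu> borel (\<lambda>A. Q ** A) = \<mu>)"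

text \<open>The power \<open>Q\<^sup>e\<close>, \<open>e = 1\<close> or \<open>e = - 1\<close>, of an orthogonal matrix, as a complex matrix.\<close>

definition orth_power :: "real^'d^'d \<Rightarrow> int \<Rightarrow> complex^'d^'d" where
  "orth_power Q e = map_matrix complex_of_real (if e = 1 then Q else transpose Q)"

text \<open>Independence of two random variables with values in different types (\<open>indep_var\<close> requires
  the types to agree): the generated \<open>\<sigma>\<close>-algebras are independent.\<close>

definition indep_rv ::
    "'w measure \<Rightarrow> 'a measure \<Rightarrow> ('w \<Rightarrow> 'a) \<Rightarrow> 'b measure \<Rightarrow> ('w \<Rightarrow> 'b) \<Rightarrow> bool" where
  "indep_rv M S U T V \<longleftrightarrow> U \<in> measurable M S \<and> V \<in> measurable M T \<and>
     prob_space.indep_set M (sets (vimage_algebra (space M) U S))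
                            (sets (vimage_algebra (space M) V T))"

end

theory Submission
  imports Defs
begin

text \<open>
  The moments of a Haar orthogonal matrix form the orthogonal projection onto the tensors that are
  invariant under the orthogonal group, so the Weingarten formula amounts to the statement that
  pairings span these tensors. To see this, let \<open>w\<close> be an invariant tensor orthogonal to all pairings
  and consider the form \<open>f(G) = \<langle>w, G\<^bsup>\<otimes>n\<^esup> w\<rangle>\<close> on matrices. By the singular value decomposition and the
  invariance of \<open>w\<close>, \<open>f\<close> is nonnegative; by Wick's formula its mean over a Gaussian matrix is a
  combination of the inner products of \<open>w\<close> with pairings, hence zero. So \<open>f\<close> vanishes, and at the
  identity this says \<open>w = 0\<close>.

  Expanding the traces into sums over index functions \<open>z\<close> on \<open>\<plusminus>[n]\<close>, a pair of pairings forces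
  \<open>z \<circ> \<delta> \<circ> \<alpha> = z\<close> with \<open>\<alpha> = \<delta>\<^sub>\<epsilon> \<pi>\<^sub>- \<delta> \<pi>\<^sub>+ \<delta>\<^sub>\<epsilon>\<close>, and the remaining sum is the product of traces along
  the cycles of \<open>K(\<phi>, \<alpha>)\<^sup>-\<^sup>1\<close>. Entries of the \<open>X\<^sub>k\<close> need not be integrable, so the expectation over
  the orthogonal matrix is taken first, for fixed values of the \<open>X\<^sub>k\<close>. The second sum arises from the
  bijection \<open>(\<pi>\<^sub>+, \<pi>\<^sub>-) \<mapsto> \<pi>\<^sub>- \<delta> \<pi>\<^sub>+\<close>, and \<open>wg\<close> depends only on the diagram because two pairs of
  pairings with the same diagram differ by a permutation of \<open>[n]\<close>.
\<close>

section \<open>The Moore-Penrose inverse of a symmetric matrix\<close>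

text \<open>For N small compared with n the pairing tensors are linearly dependent, their Gram
  matrix \<open>G\<close> is singular, and \<open>Wg\<close> is only its Moore-Penrose inverse
  \<open>W\<close>. It enters through one property: \<open>G W\<close> fixes every vector that
  consists of one coordinate of all pairing tensors.

  In \<open>haar_moment\<close> the column indices \<open>j\<close> stay fixed. As a function of the
  row indices the moment is invariant by left invariance, and its inner product with the tensor of a
  pairing \<open>R\<close> is \<open>of_bool (const_on R j)\<close>, since the matrix is almost
  surely orthogonal. By the property of \<open>G W\<close> the claimed right-hand side has the same
  inner products, so the two differ by an invariant tensor orthogonal to all pairings.

  An index function \<open>z\<close> on signed elements puts the row index of the k-th orthogonal
  factor at \<open>k\<close> and its column index at \<open>- k\<close>. A transpose is then a
  change of sign, which is why conjugation by \<open>delta_eps\<close> encodes the exponents.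

  The inverse and \<open>wg_diagram\<close> are defined by definite descriptions, so existence and
  uniqueness have to be proved; uniqueness also makes \<open>Wg\<close> invariant under relabelling
  of [n].\<close>

lemma nontrivial_relation:
  fixes a :: "'k \<Rightarrow> 'j \<Rightarrow> real"
  assumes "finite J" "finite K" "card J < card K"
  shows "\<exists>c. (\<exists>k\<in>K. c k \<noteq> 0) \<and> (\<forall>j\<in>J. (\<Sum>k\<in>K. c k * a k j) = 0)"
  using assms
proof (induction J arbitrary: K a rule: finite_induct)
  case empty
  then obtain k where "k \<in> K" by fastforce
  then show ?case by (intro exI[of _ "\<lambda>_. 1"]) auto
next
  case (insert j0 J)
  show ?case
  proof (cases "\<forall>k\<in>K. a k j0 = 0")
    case True
    obtain c where "\<exists>k\<in>K. c k \<noteq> 0" "\<forall>j\<in>J. (\<Sum>k\<in>K. c k * a k j) = 0"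
      using insert.IH[of K a] insert.prems insert.hyps by auto
    then show ?thesis using True by (intro exI[of _ c]) auto
  next
    case False
    then obtain k0 where k0: "k0 \<in> K" "a k0 j0 \<noteq> 0" by auto
    define K' where "K' = K - {k0}"
    have K': "finite K'" "K = insert k0 K'" "k0 \<notin> K'" "card J < card K'"
      using insert.prems insert.hyps k0 by (auto simp: K'_def)
    \<comment> \<open>Elimination with pivot \<open>a k0 j0\<close>: \<open>a'\<close> vanishes at
      \<open>j0\<close>, and \<open>s\<close> is the coefficient of \<open>k0\<close> that restores
      the equation at \<open>j0\<close> for the original vectors.\<close>
    define a' where "a' k j = a k j - a k j0 / a k0 j0 * a k0 j" for k j
    obtain c where c: "\<exists>k\<in>K'. c k \<noteq> 0" "\<forall>j\<in>J. (\<Sum>k\<in>K'. c k * a' k j) = 0"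
      using insert.IH[of K' a'] K' by auto
    define s where "s = - (\<Sum>k\<in>K'. c k * a k j0) / a k0 j0"
    define d where "d = c(k0 := s)"
    have sum: "(\<Sum>k\<in>K. d k * a k j) = s * a k0 j + (\<Sum>k\<in>K'. c k * a k j)" for j
      using K' by (auto simp: d_def intro!: sum.cong)
    have "(\<Sum>k\<in>K. d k * a k j) = 0" if "j \<in> insert j0 J" for j
    proof (cases "j = j0")
      case True
      then show ?thesis using k0 unfolding sum by (simp add: s_def)
    next
      case False
      then have "(\<Sum>k\<in>K'. c k * a' k j) = 0" using c that by auto
      moreover have "(\<Sum>k\<in>K'. c k * a' k j) = (\<Sum>k\<in>K'. c k * a k j) + s * a k0 j"
        by (simp add: a'_def s_def algebra_simps sum_subtractf sum_distrib_left sum_divide_distrib)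
      ultimately show ?thesis unfolding sum by simp
    qed
    moreover have "\<exists>k\<in>K. d k \<noteq> 0" using c K' by (auto simp: d_def)
    ultimately show ?thesis by blast
  qed
qed

lemma mmult_on_assoc: "mmult_on J (mmult_on J A B) C = mmult_on J A (mmult_on J B C)"
  unfolding mmult_on_def
  by (intro ext, simp add: sum_distrib_left sum_distrib_right mult.assoc) (rule sum.swap)

text \<open>The Moore-Penrose conditions see only the entries in \<open>J\<close>; vanishing outside
  makes the inverse unique as a function and turns the entrywise conditions into equations between
  functions.\<close>

definition supported_on :: "'i set \<Rightarrow> ('i \<Rightarrow> 'i \<Rightarrow> real) \<Rightarrow> bool" where
  "supported_on J A \<longleftrightarrow> (\<forall>i j. i \<notin> J \<or> j \<notin> J \<longrightarrow> A i j = 0)"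

definition transposed :: "('i \<Rightarrow> 'i \<Rightarrow> real) \<Rightarrow> 'i \<Rightarrow> 'i \<Rightarrow> real" where
  "transposed A i j = A j i"

lemma supported_on_zero [simp]: "supported_on J (\<lambda>_ _. 0)"
  by (simp add: supported_on_def)

lemma transposed_mmult_on: "transposed (mmult_on J A B) = mmult_on J (transposed B) (transposed A)"
  by (simp add: fun_eq_iff transposed_def mmult_on_def mult.commute)

lemma supported_on_mmult_on: "supported_on J A \<Longrightarrow> supported_on J B \<Longrightarrow> supported_on J (mmult_on J A B)"
  by (auto simp: supported_on_def mmult_on_def)

lemma supported_on_eqI:
  assumes "supported_on J A" "supported_on J B" "\<And>i j. i \<in> J \<Longrightarrow> j \<in> J \<Longrightarrow> A i j = B i j"
  shows "A = B"
  using assms by (auto simp: fun_eq_iff supported_on_def) metis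

lemma is_pseudoinverse_on_supported:
  assumes "supported_on J A" "supported_on J B"
  shows "is_pseudoinverse_on J A B \<longleftrightarrow>
    mmult_on J (mmult_on J A B) A = A \<and> mmult_on J (mmult_on J B A) B = B \<and>
    transposed (mmult_on J A B) = mmult_on J A B \<and> transposed (mmult_on J B A) = mmult_on J B A"
proof -
  have eq: "(\<forall>i\<in>J. \<forall>j\<in>J. C i j = D i j) \<longleftrightarrow> C = D" if "supported_on J C" "supported_on J D" for C D
    using supported_on_eqI[OF that] by auto
  have sym: "(\<forall>i\<in>J. \<forall>j\<in>J. C i j = C j i) \<longleftrightarrow> transposed C = C" if "supported_on J C" for C
    using eq[of C "transposed C"] that
    by (auto simp: transposed_def supported_on_def fun_eq_iff)
  show ?thesis
    unfolding is_pseudoinverse_on_def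
    using assms by (simp add: eq sym supported_on_mmult_on)
qed

text \<open>Penrose's argument: \<open>A B = (A C) (A B)\<close>, and by symmetry of both products
  this is the transpose of \<open>(A B) (A C) = A C\<close>, so \<open>A B = A C\<close>; likewise
  \<open>B A = C A\<close>. Then \<open>B = B A B = C A B = C A C = C\<close>.\<close>

lemma is_pseudoinverse_on_unique:
  assumes A: "supported_on J A" and B: "supported_on J B" "is_pseudoinverse_on J A B"
    and C: "supported_on J C" "is_pseudoinverse_on J A C"
  shows "B = C"
proof -
  let ?m = "mmult_on J" let ?t = transposed
  have b: "?m (?m A B) A = A" "?m (?m B A) B = B" "?t (?m A B) = ?m A B" "?t (?m B A) = ?m B A"
    using B is_pseudoinverse_on_supported[OF A B(1)] by auto
  have c: "?m (?m A C) A = A" "?m (?m C A) C = C" "?t (?m A C) = ?m A C" "?t (?m C A) = ?m C A"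
    using C is_pseudoinverse_on_supported[OF A C(1)] by auto
  have "?m A B = ?m (?m A C) (?m A B)" by (metis c(1) mmult_on_assoc)
  also have "\<dots> = ?t (?m (?m A B) (?m A C))" by (simp add: transposed_mmult_on[of J "?m A B"] b c)
  also have "?m (?m A B) (?m A C) = ?m A C" by (metis b(1) mmult_on_assoc)
  finally have AB: "?m A B = ?m A C" by (simp add: c)
  have "?m B A = ?m (?m B A) (?m C A)" by (metis c(1) mmult_on_assoc)
  also have "\<dots> = ?t (?m (?m C A) (?m B A))" by (simp add: transposed_mmult_on[of J "?m C A"] b c)
  also have "?m (?m C A) (?m B A) = ?m C A" by (metis b(1) mmult_on_assoc)
  finally have BA: "?m B A = ?m C A" by (simp add: c)
  show ?thesis by (metis AB BA b(2) c(2) mmult_on_assoc)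
qed

text \<open>The hypothesis gives \<open>(G Y)^T (G Y) = Y^T (G (G Y)) = 0\<close>, and the diagonal
  entries of this product are sums of squares.\<close>

lemma mmult_on_cancel_symmetric:
  assumes J: "finite J" and sym: "transposed G = G" and G: "supported_on J G" and Y: "supported_on J Y"
    and eq: "mmult_on J G (mmult_on J G Y) = (\<lambda>_ _. 0)"
  shows "mmult_on J G Y = (\<lambda>_ _. 0)"
proof (rule supported_on_eqI[of J])
  fix i j assume ij: "i \<in> J" "j \<in> J"
  have "mmult_on J (transposed (mmult_on J G Y)) (mmult_on J G Y)
      = mmult_on J (transposed Y) (mmult_on J G (mmult_on J G Y))"
    by (simp add: transposed_mmult_on sym mmult_on_assoc)
  also have "\<dots> = (\<lambda>_ _. 0)" unfolding eq by (simp add: mmult_on_def fun_eq_iff)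
  finally have "(\<Sum>k\<in>J. mmult_on J G Y k j * mmult_on J G Y k j) = 0"
    by (auto simp: fun_eq_iff mmult_on_def[of J "transposed _"] transposed_def)
  then show "mmult_on J G Y i j = 0"
    using ij J by (subst (asm) sum_nonneg_eq_0_iff) auto
qed (auto simp: G Y supported_on_mmult_on)

text \<open>The powers of \<open>G\<close> satisfy a nontrivial linear relation. Symmetry allows
  cancelling powers of \<open>G\<close> until the lowest term is \<open>G\<close> itself, which
  gives \<open>G = G (G R)\<close> with \<open>R\<close> a polynomial in \<open>G\<close>. As
  \<open>R\<close> is symmetric and commutes with \<open>G\<close>, \<open>R (G R)\<close> is the
  pseudoinverse.\<close>

lemma symmetric_pseudoinverse_exists:
  assumes J: "finite J" and sym: "transposed G = G" and G: "supported_on J G"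
  shows "\<exists>B. supported_on J B \<and> is_pseudoinverse_on J G B"
proof -
  let ?m = "mmult_on J" let ?t = transposed
  define one where "one i j = (if i = j then if i \<in> J then 1 else 0 else 0 :: real)" for i j :: 'a
  define P where "P k = (?m G ^^ k) one" for k
  have P_Suc: "?m G (P k) = P (Suc k)" for k by (simp add: P_def)
  have suppP: "supported_on J (P k)" for k
  proof (induction k)
    case 0 show ?case by (auto simp: P_def one_def supported_on_def)
  next
    case (Suc k) then show ?case using supported_on_mmult_on[OF G] by (simp add: P_Suc[symmetric])
  qed
  have P1: "?m (P 0) G = G" "?m G (P 0) = G"
    using G J by (auto simp: fun_eq_iff P_def one_def mmult_on_def supported_on_def
        if_distrib[of "\<lambda>x. x * _"] if_distrib[of "\<lambda>x. _ * x"] sum.delta sum.delta' cong: if_cong)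
  have commP: "?m (P k) G = P (Suc k)" for k
  proof (induction k)
    case 0 show ?case using P1 P_Suc by metis
  next
    case (Suc k) then show ?case by (metis P_Suc mmult_on_assoc)
  qed
  have symP: "?t (P k) = P k" for k
  proof (induction k)
    case 0 show ?case by (auto simp: P_def one_def transposed_def fun_eq_iff)
  next
    case (Suc k) then show ?case
      by (metis P_Suc commP sym transposed_mmult_on)
  qed
  \<comment> \<open>\<open>{..m}\<close> has one element more than the matrix has entries, so the
    powers \<open>P 0\<close> to \<open>P m\<close> are dependent.\<close>
  define m where "m = card (J \<times> J)"
  obtain c where c: "\<exists>k\<in>{..m}. c k \<noteq> 0" "\<forall>p\<in>J\<times>J. (\<Sum>k\<in>{..m}. c k * P k (fst p) (snd p)) = 0"
    using nontrivial_relation[of "J \<times> J" "{..m}" "\<lambda>k p. P k (fst p) (snd p)"] J by (auto simp: m_def)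
  define s where "s = (LEAST k. k \<le> m \<and> c k \<noteq> 0)"
  have s: "s \<le> m" "c s \<noteq> 0" using LeastI_ex[of "\<lambda>k. k \<le> m \<and> c k \<noteq> 0"] c(1) by (auto simp: s_def)
  have s_min: "c k = 0" if "k < s" for k
    using that s not_less_Least[of k "\<lambda>k. k \<le> m \<and> c k \<noteq> 0"] by (auto simp: s_def)
  \<comment> \<open>\<open>L t\<close> is the relation with every exponent lowered by
    \<open>t\<close>, exact for \<open>t \<le> s\<close>. Since \<open>G (L (Suc t)) = L t\<close>
    for \<open>t < s\<close>, the cancellation lemma carries \<open>G (L t) = 0\<close> from
    \<open>t = 0\<close> to \<open>t = s\<close>.\<close>
  define L where "L t = (\<lambda>i j. \<Sum>k\<in>{s..m}. c k * P (k - t) i j)" for t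
  have GL: "?m G (\<lambda>i j. \<Sum>k\<in>S. d k * P (g k) i j) = (\<lambda>i j. \<Sum>k\<in>S. d k * P (Suc (g k)) i j)"
    for S :: "nat set" and d g
    unfolding P_Suc[symmetric] mmult_on_def
    by (intro ext, simp add: sum_distrib_left mult_ac) (rule sum.swap)
  have LG: "?m (\<lambda>i j. \<Sum>k\<in>S. d k * P (g k) i j) G = (\<lambda>i j. \<Sum>k\<in>S. d k * P (Suc (g k)) i j)"
    for S :: "nat set" and d g
    unfolding commP[symmetric] mmult_on_def
    by (intro ext, simp add: sum_distrib_left sum_distrib_right mult_ac) (rule sum.swap)
  have suppS: "supported_on J (\<lambda>i j. \<Sum>k\<in>S. d k * P (g k) i j)" for S :: "nat set" and d g
    using suppP by (auto simp: supported_on_def)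
  have L0: "L 0 = (\<lambda>_ _. 0)"
  proof (rule supported_on_eqI[of J])
    fix i j assume ij: "i \<in> J" "j \<in> J"
    have "(\<Sum>k\<in>{s..m}. c k * P k i j) = (\<Sum>k\<in>{..m}. c k * P k i j)"
      using s_min by (intro sum.mono_neutral_left) (auto simp: not_le)
    then show "L 0 i j = 0" using c(2) ij by (auto simp: L_def)
  qed (auto simp: L_def suppS)
  have "t \<le> s \<Longrightarrow> ?m G (L t) = (\<lambda>_ _. 0)" for t
  proof (induction t)
    case 0 show ?case by (simp add: L0) (simp add: mmult_on_def)
  next
    case (Suc t)
    have "?m G (L (Suc t)) = L t"
      unfolding L_def GL using Suc by (intro ext sum.cong) (auto simp: Suc_diff_Suc)
    then show ?case
      using mmult_on_cancel_symmetric[OF J sym G, of "L (Suc t)"] suppS Suc by (auto simp: L_def)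
  qed
  then have "?m G (L s) = (\<lambda>_ _. 0)" by simp
  then have rel: "(\<Sum>k\<in>{s..m}. c k * P (Suc (k - s)) i j) = 0" for i j
    unfolding L_def GL by meson
  define R where "R = (\<lambda>i j. \<Sum>k\<in>{Suc s..m}. (- c k / c s) * P (k - Suc s) i j)"
  have "?m G (?m G R) i j = G i j" for i j
  proof -
    have "?m G (?m G R) i j = (\<Sum>k\<in>{Suc s..m}. (- c k / c s) * P (Suc (k - s)) i j)"
      unfolding R_def GL by (intro sum.cong) (auto simp: Suc_diff_Suc)
    also have "\<dots> = - (\<Sum>k\<in>{Suc s..m}. c k * P (Suc (k - s)) i j) / c s"
      by (simp add: sum_negf sum_divide_distrib)
    also have "(\<Sum>k\<in>{Suc s..m}. c k * P (Suc (k - s)) i j) = - c s * P 1 i j"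
      using rel[of i j] s by (subst (asm) sum.atLeast_Suc_atMost) auto
    finally show ?thesis using s P1 P_Suc[of 0] by auto
  qed
  then have GGR: "?m G (?m G R) = G" by blast
  have comm: "?m R G = ?m G R" unfolding R_def GL LG ..
  have symR: "?t R = R" using symP by (auto simp: R_def transposed_def fun_eq_iff)
  have suppR: "supported_on J R" unfolding R_def by (rule suppS)
  have GRG: "?m G (?m R G) = G" by (simp add: comm GGR)
  define B where "B = ?m R (?m G R)"
  have suppB: "supported_on J B" by (simp add: B_def suppR G supported_on_mmult_on)
  have GB: "?m G B = ?m G R" unfolding B_def by (metis GRG mmult_on_assoc)
  have BG: "?m B G = ?m R G" unfolding B_def by (metis GRG mmult_on_assoc)
  have "is_pseudoinverse_on J G B"
    unfolding is_pseudoinverse_on_supported[OF G suppB] GB BG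
  proof (intro conjI)
    show "?m (?m G R) G = G" by (simp add: mmult_on_assoc GRG)
    show "?m (?m R G) B = B" unfolding mmult_on_assoc GB by (simp add: B_def)
    show "?t (?m G R) = ?m G R" by (simp add: transposed_mmult_on sym symR comm)
    show "?t (?m R G) = ?m R G" by (simp add: transposed_mmult_on sym symR comm)
  qed
  with suppB show ?thesis by blast
qed

text \<open>Justifies the definite description in \<open>pseudoinverse_on\<close>.
  \<open>gram\<close> is not cut off outside the pairings, so \<open>A\<close> is replaced by its
  truncation \<open>G\<close>, which leads to the same four conditions.\<close>

lemma pseudoinverse_on_symmetric:
  assumes J: "finite J" and sym: "\<And>i j. i \<in> J \<Longrightarrow> j \<in> J \<Longrightarrow> A i j = A j i"
  shows "is_pseudoinverse_on J A (pseudoinverse_on J A)" (is ?P)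
    and "supported_on J (pseudoinverse_on J A)" (is ?S)
    and "is_pseudoinverse_on J A B \<Longrightarrow> supported_on J B \<Longrightarrow> B = pseudoinverse_on J A"
proof -
  define G where "G i j = (if i \<in> J \<and> j \<in> J then A i j else 0)" for i j
  have G: "supported_on J G" "transposed G = G"
    using sym by (auto simp: G_def supported_on_def transposed_def fun_eq_iff)
  have iff: "is_pseudoinverse_on J A B \<longleftrightarrow> is_pseudoinverse_on J G B" for B
  proof -
    have l: "mmult_on J A C i j = mmult_on J G C i j" if "i \<in> J" for C i j
      using that by (auto simp: mmult_on_def G_def intro!: sum.cong)
    have r: "mmult_on J C A i j = mmult_on J C G i j" if "j \<in> J" for C i j
      using that by (auto simp: mmult_on_def G_def intro!: sum.cong)
    have lr: "mmult_on J (mmult_on J A B) G i j = mmult_on J (mmult_on J G B) G i j"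
      if "i \<in> J" "j \<in> J" for i j
      using that by (simp add: mmult_on_def[of J _ G] l)
    have m: "mmult_on J (mmult_on J B A) B i j = mmult_on J (mmult_on J B G) B i j" for i j
      by (simp add: mmult_on_def[of J _ B] r)
    have A: "A i j = G i j" if "i \<in> J" "j \<in> J" for i j using that by (simp add: G_def)
    show ?thesis
      unfolding is_pseudoinverse_on_def by (simp add: l r lr m A cong: ball_cong)
  qed
  obtain B0 where B0: "supported_on J B0" "is_pseudoinverse_on J A B0"
    using symmetric_pseudoinverse_exists[OF J G(2,1)] iff by auto
  have uniq: "B = B0" if "is_pseudoinverse_on J A B" "supported_on J B" for B
    using is_pseudoinverse_on_unique[OF G(1)] that B0 iff by auto
  have eq: "pseudoinverse_on J A = B0"
    unfolding pseudoinverse_on_def supported_on_def[symmetric]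
  proof (rule the_equality)
    show "is_pseudoinverse_on J A B0 \<and> supported_on J B0" using B0 by blast
    show "B = B0" if "is_pseudoinverse_on J A B \<and> supported_on J B" for B
      using that uniq by blast
  qed
  show ?P ?S unfolding eq by (fact B0)+
  show "B = pseudoinverse_on J A" if "is_pseudoinverse_on J A B" "supported_on J B"
    unfolding eq using that by (rule uniq)
qed

section \<open>Singular value decomposition\<close>

lemma compact_orthogonal_matrix: "compact {Q :: real^'d^'d. orthogonal_matrix Q}"
proof -
  have "{Q :: real^'d^'d. orthogonal_matrix Q}
      = {Q. \<forall>i j. (\<Sum>k\<in>UNIV. Q$k$i * Q$k$j) = (if i = j then 1 else 0)}"
    by (simp add: orthogonal_matrix matrix_matrix_mult_def transpose_def mat_def vec_eq_iff)
  then have "closed {Q :: real^'d^'d. orthogonal_matrix Q}"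
    by (simp add: closed_Collect_all closed_Collect_eq continuous_intros)
  moreover have "norm Q \<le> real CARD('d)" if "orthogonal_matrix Q" for Q :: "real^'d^'d"
  proof -
    have "norm (Q $ i) = 1" for i
      using that by (metis orthogonal_matrix_orthonormal_rows row_def vec_nth_inverse vec_lambda_eta)
    then have "L2_set (\<lambda>i. norm (Q$i)) UNIV \<le> real CARD('d)"
      by (intro order.trans[OF L2_set_le_sum]) auto
    then show ?thesis by (simp add: norm_vec_def)
  qed
  ultimately show ?thesis
    by (auto simp: compact_eq_bounded_closed bounded_iff)
qed

text \<open>The left-hand side vanishes at \<open>t = 0\<close>, so it has a maximum there, and its
  derivative at that point is \<open>b\<close>.\<close>

lemma trig_max_coeff_zero:
  fixes a b :: real
  assumes "\<And>t. a * (cos t - 1) + b * sin t \<le> 0"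
  shows "b = 0"
proof -
  have "((\<lambda>t. a * (cos t - 1) + b * sin t) has_real_derivative b) (at 0)"
    by (auto intro!: derivative_eq_intros)
  then show ?thesis
    by (rule DERIV_local_max[of _ _ _ 1]) (use assms in auto)
qed

text \<open>First-order optimality under the rotations in the plane of two coordinates.\<close>

lemma weighted_trace_max_offdiag:
  fixes D :: "real^'d^'d"
  assumes max: "\<And>R. orthogonal_matrix R \<Longrightarrow> (\<Sum>i\<in>UNIV. c i * (R ** D)$i$i) \<le> (\<Sum>i\<in>UNIV. c i * D$i$i)"
    and "p \<noteq> q"
  shows "c p * D$q$p = c q * D$p$q"
proof -
  have "(c p * D$p$p + c q * D$q$q) * (cos t - 1) + (c q * D$p$q - c p * D$q$p) * sin t \<le> 0" for t
  proof -
    define r :: "'d \<Rightarrow> real^'d" where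
      "r i = (if i = p then cos t *\<^sub>R axis p 1 - sin t *\<^sub>R axis q 1
              else if i = q then sin t *\<^sub>R axis p 1 + cos t *\<^sub>R axis q 1 else axis i 1)" for i
    define R where "R = (\<chi> i. r i)"
    have inner: "r i \<bullet> r j = (if i = j then 1 else 0)" for i j
      using \<open>p \<noteq> q\<close> by (auto simp: r_def inner_axis_axis inner_diff_left inner_diff_right inner_add_left
          inner_add_right power2_eq_square[symmetric])
    have row: "row i R = r i" for i by (simp add: R_def row_def)
    have orth: "orthogonal_matrix R"
      unfolding orthogonal_matrix_orthonormal_rows row
      using inner by (auto simp: norm_eq_1 orthogonal_def)
    have RD: "(R ** D)$i$j = r i \<bullet> column j D" for i j
      by (simp add: R_def matrix_matrix_mult_def inner_vec_def column_def)
    have ax: "axis i 1 \<bullet> column j D = D$i$j" for i j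
      by (simp add: inner_axis' column_def)
    have diag: "(R ** D)$i$i = D$i$i + (if i = p then (cos t - 1) * D$p$p - sin t * D$q$p else 0)
        + (if i = q then sin t * D$p$q + (cos t - 1) * D$q$q else 0)" for i
      using \<open>p \<noteq> q\<close> by (auto simp: RD r_def ax inner_diff_left inner_add_left algebra_simps)
    have "(\<Sum>i\<in>UNIV. c i * (R ** D)$i$i) = (\<Sum>i\<in>UNIV. c i * D$i$i)
        + (\<Sum>i\<in>UNIV. if i = p then c i * ((cos t - 1) * D$p$p - sin t * D$q$p) else 0)
        + (\<Sum>i\<in>UNIV. if i = q then c i * (sin t * D$p$q + (cos t - 1) * D$q$q) else 0)"
      unfolding diag sum.distrib[symmetric] by (intro sum.cong) (auto simp: algebra_simps)
    with max[OF orth] show ?thesis by (simp add: algebra_simps)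
  qed
  from trig_max_coeff_zero[OF this] show ?thesis by simp
qed

text \<open>The reflection in coordinate \<open>p\<close> lowers the weighted trace by
  \<open>2 * c p * D$p$p\<close>, which is nonnegative at a maximum.\<close>

lemma weighted_trace_max_diag:
  fixes D :: "real^'d^'d"
  assumes max: "\<And>R. orthogonal_matrix R \<Longrightarrow> (\<Sum>i\<in>UNIV. c i * (R ** D)$i$i) \<le> (\<Sum>i\<in>UNIV. c i * D$i$i)"
    and "0 < c p"
  shows "0 \<le> D$p$p"
proof -
  define r :: "'d \<Rightarrow> real^'d" where "r i = (if i = p then - axis p 1 else axis i 1)" for i
  define R where "R = (\<chi> i. r i)"
  have row: "row i R = r i" for i by (simp add: R_def row_def)
  have orth: "orthogonal_matrix R"
    unfolding orthogonal_matrix_orthonormal_rows row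
    by (auto simp: norm_eq_1 orthogonal_def r_def inner_axis_axis)
  have diag: "(R ** D)$i$i = D$i$i - (if i = p then 2 * D$p$p else 0)" for i
    by (simp add: R_def matrix_matrix_mult_def r_def axis_def if_distrib[of "\<lambda>x. x * _"]
        if_distrib[of uminus] if_distrib[of "\<lambda>x. x $ _"] sum.delta' cong: if_cong)
  have "(\<Sum>i\<in>UNIV. c i * (R ** D)$i$i)
      = (\<Sum>i\<in>UNIV. c i * D$i$i) - (\<Sum>i\<in>UNIV. if i = p then c i * (2 * D$p$p) else 0)"
    unfolding diag sum_subtractf[symmetric] by (intro sum.cong) (auto simp: algebra_simps)
  with max[OF orth] \<open>0 < c p\<close> show ?thesis by (simp add: zero_le_mult_iff)
qed

text \<open>\<open>Q1\<close> and \<open>Q2\<close> maximise a weighted trace over the pairs of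
  orthogonal matrices. Optimality from the left gives \<open>c p * D$q$p = c q * D$p$q\<close>, from
  the right \<open>c p * D$p$q = c q * D$q$p\<close>; distinct positive weights force both entries
  to vanish, whereas equal weights would only make \<open>D\<close> symmetric.\<close>

lemma singular_value_decomposition:
  fixes A :: "real^'d^'d"
  obtains Q1 Q2 :: "real^'d^'d" where "orthogonal_matrix Q1" "orthogonal_matrix Q2"
    "\<And>i j. i \<noteq> j \<Longrightarrow> (Q1 ** A ** Q2)$i$j = 0" "\<And>i. 0 \<le> (Q1 ** A ** Q2)$i$i"
proof -
  obtain h :: "'d \<Rightarrow> nat" where h: "inj h"
    using finite_imp_inj_to_nat_seg[of "UNIV :: 'd set"] by auto
  \<comment> \<open>The injection into the naturals makes the weights pairwise different, the shift
    by 1 makes them positive.\<close>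
  define c where "c i = 1 + real (h i)" for i
  have c: "0 < c i" "c i = c j \<longleftrightarrow> i = j" for i j using h by (auto simp: c_def inj_eq)
  define F where "F P = (\<Sum>i\<in>UNIV. c i * (fst P ** A ** snd P)$i$i)" for P :: "(real^'d^'d) \<times> (real^'d^'d)"
  let ?S = "{Q :: real^'d^'d. orthogonal_matrix Q}"
  have "compact (?S \<times> ?S)" by (intro compact_Times compact_orthogonal_matrix)
  moreover have "(mat 1, mat 1) \<in> ?S \<times> ?S" by (simp add: orthogonal_matrix_id)
  moreover have "continuous_on (?S \<times> ?S) F"
    unfolding F_def matrix_matrix_mult_def by (simp add: continuous_intros)
  ultimately obtain P where P: "P \<in> ?S \<times> ?S" "\<And>P'. P' \<in> ?S \<times> ?S \<Longrightarrow> F P' \<le> F P"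
    using continuous_attains_sup[of "?S \<times> ?S" F] by blast
  obtain Q1 Q2 where Q: "P = (Q1, Q2)" by (cases P)
  have orth: "orthogonal_matrix Q1" "orthogonal_matrix Q2" using P(1) Q by auto
  define D where "D = Q1 ** A ** Q2"
  have F: "F P = (\<Sum>i\<in>UNIV. c i * D$i$i)" by (simp add: F_def Q D_def)
  have max1: "(\<Sum>i\<in>UNIV. c i * (R ** D)$i$i) \<le> (\<Sum>i\<in>UNIV. c i * D$i$i)"
    if "orthogonal_matrix R" for R
    using P(2)[of "(R ** Q1, Q2)"] that orth
    by (simp add: F[symmetric] orthogonal_matrix_mul) (simp add: F_def D_def matrix_mul_assoc)
  \<comment> \<open>The transpose turns multiplication on the right into multiplication on the
    left.\<close>
  have max2: "(\<Sum>i\<in>UNIV. c i * (R ** transpose D)$i$i) \<le> (\<Sum>i\<in>UNIV. c i * transpose D$i$i)"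
    if "orthogonal_matrix R" for R
  proof -
    have "(R ** transpose D)$i$i = (D ** transpose R)$i$i" for i
      by (simp add: matrix_matrix_mult_def transpose_def mult.commute)
    moreover have "transpose D$i$i = D$i$i" for i by (simp add: transpose_def)
    ultimately show ?thesis
      using P(2)[of "(Q1, Q2 ** transpose R)"] that orth
      by (simp add: F[symmetric] orthogonal_matrix_mul) (simp add: F_def D_def matrix_mul_assoc)
  qed
  have "D$p$q = 0" if "p \<noteq> q" for p q
  proof -
    have 1: "c p * D$q$p = c q * D$p$q" using weighted_trace_max_offdiag[of c D, OF max1 that] .
    have 2: "c p * D$p$q = c q * D$q$p"
      using weighted_trace_max_offdiag[of c "transpose D", OF max2 that] by (simp add: transpose_def)
    have "(c p * c p) * D$p$q = (c q * c q) * D$p$q"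
      using 1 2 by (metis mult.assoc mult.left_commute)
    moreover have "c p * c p \<noteq> c q * c q"
      using c that by (metis abs_of_pos square_eq_iff add_pos_pos less_irrefl add.right_inverse)
    ultimately show ?thesis by simp
  qed
  moreover have "0 \<le> D$p$p" for p
    using weighted_trace_max_diag[of c D, OF max1] c(1) by blast
  ultimately show ?thesis using that[OF orth] unfolding D_def by blast
qed

section \<open>Sums over index functions\<close>

abbreviation indices :: "'k set \<Rightarrow> ('k \<Rightarrow> 'd) set" where
  "indices K \<equiv> K \<rightarrow>\<^sub>E UNIV"

text \<open>For a pairing \<open>P\<close>, \<open>of_bool (const_on P i)\<close> as a function of
  \<open>i\<close> is the tensor with one Kronecker delta for every block; these tensors will span
  the invariants.\<close>

definition const_on :: "'k set set \<Rightarrow> ('k \<Rightarrow> 'd) \<Rightarrow> bool" where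
  "const_on P i \<longleftrightarrow> (\<forall>B\<in>P. \<forall>k\<in>B. \<forall>l\<in>B. i k = i l)"

lemma const_on_empty [simp]: "const_on {} i"
  by (simp add: const_on_def)

lemma const_on_insert: "const_on (insert B P) i \<longleftrightarrow> (\<forall>k\<in>B. \<forall>l\<in>B. i k = i l) \<and> const_on P i"
  by (simp add: const_on_def)

lemma const_on_doubleton: "(\<forall>k\<in>{a, b}. \<forall>l\<in>{a, b}. i k = i l) \<longleftrightarrow> i a = i b"
proof
  assume "i a = i b"
  then show "\<forall>k\<in>{a, b}. \<forall>l\<in>{a, b}. i k = i l" by (intro ballI) (elim insertE emptyE; simp)
qed blast

lemma finite_indices [simp]: "finite K \<Longrightarrow> finite (indices K :: ('k \<Rightarrow> 'd::finite) set)"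
  by (simp add: finite_PiE)

lemma prod_sum_indices:
  fixes f :: "'k \<Rightarrow> 'd::finite \<Rightarrow> 'a::comm_semiring_1"
  assumes "finite K"
  shows "(\<Prod>k\<in>K. \<Sum>a\<in>UNIV. f k a) = (\<Sum>j\<in>indices K. \<Prod>k\<in>K. f k (j k))"
  using assms by (subst prod_sum_PiE) auto

text \<open>An index function that is constant on the blocks is a free choice of one index per
  block, so the sum factorises. \<open>blk\<close> and \<open>pt\<close> translate between elements
  and blocks.\<close>

lemma sum_const_on_partition:
  fixes q :: "'k \<Rightarrow> 'd::finite \<Rightarrow> 'a::comm_semiring_1"
  assumes K: "finite K" and P: "partition_on K P"
  shows "(\<Sum>j\<in>indices K. of_bool (const_on P j) * (\<Prod>k\<in>K. q k (j k)))
       = (\<Prod>B\<in>P. \<Sum>a\<in>UNIV. \<Prod>k\<in>B. q k a)"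
proof -
  have fP: "finite P" using finite_elements[OF K P] .
  have fB: "finite B" if "B \<in> P" for B
    using K P that by (auto simp: partition_on_def intro: finite_subset)
  have disj: "B = B'" if "B \<in> P" "B' \<in> P" "k \<in> B" "k \<in> B'" for B B' k
    using P that by (auto simp: partition_on_def disjoint_def)
  have sub: "k \<in> K" if "B \<in> P" "k \<in> B" for B k using P that by (auto simp: partition_on_def)
  have cov: "\<exists>B\<in>P. k \<in> B" if "k \<in> K" for k using P that by (auto simp: partition_on_def)
  define blk where "blk k = (THE B. B \<in> P \<and> k \<in> B)" for k
  have blk: "blk k = B" if "B \<in> P" "k \<in> B" for k B
    unfolding blk_def using that by (intro the_equality) (blast dest: disj)+
  define pt where "pt B = (SOME k. k \<in> B)" for B :: "'k set"
  have pt: "pt B \<in> B" if "B \<in> P" for B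
  proof -
    have "B \<noteq> {}" using that P by (auto simp: partition_on_def)
    then show ?thesis unfolding pt_def by (simp add: some_in_eq)
  qed
  have prodK: "(\<Prod>k\<in>K. g k) = (\<Prod>B\<in>P. \<Prod>k\<in>B. g k)" for g :: "'k \<Rightarrow> 'a"
  proof -
    have "K = \<Union> P" using P by (simp add: partition_on_def)
    then show ?thesis
      using prod.Union_disjoint[of P g] fB P by (auto simp: partition_on_def disjoint_def)
  qed
  have "(\<Sum>j\<in>indices K. of_bool (const_on P j) * (\<Prod>k\<in>K. q k (j k)))
      = (\<Sum>j\<in>{j\<in>indices K. const_on P j}. \<Prod>k\<in>K. q k (j k))"
    using K by (intro sum.mono_neutral_cong_right) auto
  also have "\<dots> = (\<Sum>g\<in>indices P. \<Prod>B\<in>P. \<Prod>k\<in>B. q k (g B))"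
  proof (rule sum.reindex_bij_witness[where i = "\<lambda>g. \<lambda>k\<in>K. g (blk k)" and j = "\<lambda>j. \<lambda>B\<in>P. j (pt B)"], goal_cases)
    case (1 j)
    show ?case
    proof
      fix k show "(\<lambda>k\<in>K. (\<lambda>B\<in>P. j (pt B)) (blk k)) k = j k"
      proof (cases "k \<in> K")
        case True
        then obtain B where "B \<in> P" "k \<in> B" using cov by blast
        moreover have "j (pt B) = j k"
          using 1 pt[OF \<open>B \<in> P\<close>] \<open>B \<in> P\<close> \<open>k \<in> B\<close> unfolding const_on_def by blast
        ultimately show ?thesis using True by (simp add: blk[of B k])
      next
        case False then show ?thesis using 1 by (auto simp: PiE_def extensional_def)
      qed
    qed
  next
    case (2 j) then show ?case by auto
  next
    case (3 g)
    show ?case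
    proof
      fix B show "(\<lambda>B\<in>P. (\<lambda>k\<in>K. g (blk k)) (pt B)) B = g B"
      proof (cases "B \<in> P")
        case True
        then show ?thesis using blk[OF True pt[OF True]] sub[OF True pt[OF True]] by simp
      next
        case False then show ?thesis using 3 by (auto simp: PiE_def extensional_def)
      qed
    qed
  next
    case (4 g)
    have "(\<lambda>k\<in>K. g (blk k)) k = g B" if "B \<in> P" "k \<in> B" for B k
      using blk[OF that] sub[OF that] by simp
    then show ?case by (auto simp: const_on_def simp del: restrict_apply)
  next
    case (5 j)
    have "j (pt B) = j k" if "B \<in> P" "k \<in> B" for B k
      using 5 pt[OF that(1)] that unfolding const_on_def by blast
    then show ?case unfolding prodK by (intro prod.cong refl) simp
  qed
  also have "\<dots> = (\<Prod>B\<in>P. \<Sum>a\<in>UNIV. \<Prod>k\<in>B. q k a)"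
    using prod_sum_indices[OF fP, of "\<lambda>B a. \<Prod>k\<in>B. q k a"] by simp
  finally show ?thesis .
qed

section \<open>Gaussian moments\<close>

definition pairings_on :: "'k set \<Rightarrow> 'k set set set" where
  "pairings_on K = {P. partition_on K P \<and> (\<forall>B\<in>P. card B = 2)}"

lemma finite_pairings_on: "finite K \<Longrightarrow> finite (pairings_on K)"
  by (rule finite_subset[of _ "Pow (Pow K)"]) (auto simp: pairings_on_def partition_on_def)

lemma pairings_on_empty [simp]: "pairings_on {} = {{}}"
  by (auto simp: pairings_on_def partition_on_def)

text \<open>Classification by the partner of \<open>k0\<close>, the source of the recursion in
  Wick's formula.\<close>

lemma pairings_on_remove:
  assumes "k0 \<in> K"
  shows "pairings_on K = (\<Union>l\<in>K - {k0}. insert {k0, l} ` pairings_on (K - {k0, l}))"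
proof (intro equalityI subsetI)
  fix P assume P: "P \<in> pairings_on K"
  then obtain B where B: "B \<in> P" "k0 \<in> B" using assms by (auto simp: pairings_on_def partition_on_def)
  moreover have "card B = 2" using P B by (auto simp: pairings_on_def)
  ultimately obtain l where l: "B = {k0, l}" "l \<noteq> k0" by (auto simp: card_2_iff)
  have "l \<in> K" using P B l by (auto simp: pairings_on_def partition_on_def)
  have "\<Union> (P - {B}) = \<Union> P - B"
    using P B(1) by (auto simp: pairings_on_def partition_on_def disjoint_def)
  then have "P - {B} \<in> pairings_on (K - {k0, l})"
    using P l by (auto simp: pairings_on_def partition_on_def disjoint_def)
  then have "P \<in> insert {k0, l} ` pairings_on (K - {k0, l})"
    using l B(1) by (intro image_eqI[of _ _ "P - {B}"]) auto
  then show "P \<in> (\<Union>l\<in>K - {k0}. insert {k0, l} ` pairings_on (K - {k0, l}))"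
    using \<open>l \<in> K\<close> l by blast
next
  fix P assume "P \<in> (\<Union>l\<in>K - {k0}. insert {k0, l} ` pairings_on (K - {k0, l}))"
  then obtain l P' where l: "l \<in> K" "l \<noteq> k0" "P' \<in> pairings_on (K - {k0, l})" "P = insert {k0, l} P'"
    by auto
  have "disjoint P'" "\<Union> P' = K - {k0, l}" "\<forall>B\<in>P'. card B = 2" "{} \<notin> P'"
    using l by (auto simp: pairings_on_def partition_on_def)
  then show "P \<in> pairings_on K"
    using l(1,2,4) assms by (auto simp: pairings_on_def partition_on_def disjoint_def; blast)
qed

lemma sum_pairings_on_remove:
  assumes K: "finite K" and k0: "k0 \<in> K"
  shows "(\<Sum>P\<in>pairings_on K. f P)
       = (\<Sum>l\<in>K - {k0}. \<Sum>P\<in>pairings_on (K - {k0, l}). f (insert {k0, l} P))"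
proof -
  have notin: "B \<notin> P" if "P \<in> pairings_on (K - {k0, l})" "k0 \<in> B" for P l B
    using that by (auto simp: pairings_on_def partition_on_def)
  have "(\<Sum>P\<in>pairings_on K. f P)
      = (\<Sum>l\<in>K - {k0}. sum f (insert {k0, l} ` pairings_on (K - {k0, l})))"
    unfolding pairings_on_remove[OF k0]
  proof (rule sum.UNION_disjoint)
    show "\<forall>i\<in>K - {k0}. \<forall>j\<in>K - {k0}. i \<noteq> j \<longrightarrow>
       insert {k0, i} ` pairings_on (K - {k0, i}) \<inter> insert {k0, j} ` pairings_on (K - {k0, j}) = {}"
    proof (intro ballI impI equals0I)
      fix i j P assume ij: "i \<in> K - {k0}" "j \<in> K - {k0}" "i \<noteq> j"
        and P: "P \<in> insert {k0, i} ` pairings_on (K - {k0, i}) \<inter> insert {k0, j} ` pairings_on (K - {k0, j})"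
      then obtain P' where "{k0, i} \<in> P" "P = insert {k0, j} P'" "P' \<in> pairings_on (K - {k0, j})"
        by auto
      then show False using ij notin[of P' j "{k0, i}"] by (auto simp: doubleton_eq_iff)
    qed
  qed (use K in \<open>auto simp: finite_pairings_on\<close>)
  also have "\<dots> = (\<Sum>l\<in>K - {k0}. \<Sum>P\<in>pairings_on (K - {k0, l}). f (insert {k0, l} P))"
  proof (rule sum.cong[OF refl])
    fix l
    have "inj_on (insert {k0, l}) (pairings_on (K - {k0, l}))"
      using notin[of _ l "{k0, l}"] by (intro inj_onI) (metis insert_ident insertI1)
    then show "sum f (insert {k0, l} ` pairings_on (K - {k0, l}))
        = (\<Sum>P\<in>pairings_on (K - {k0, l}). f (insert {k0, l} P))"
      by (simp add: sum.reindex)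
  qed
  finally show ?thesis .
qed

text \<open>The combinatorial half of Wick's formula, for any sequence with the recursion of the
  normal moments. If \<open>k0\<close> shares its value with \<open>card L\<close> other elements,
  the factor \<open>card L\<close> in the recursion counts the admissible partners of
  \<open>k0\<close>.\<close>

lemma wick_product:
  fixes mu :: "nat \<Rightarrow> real" and e :: "'k \<Rightarrow> 'v::finite"
  assumes mu: "mu 0 = 1" "mu 1 = 0" "\<And>m. mu (Suc (Suc m)) = real (Suc m) * mu m"
    and "finite K"
  shows "(\<Prod>v\<in>UNIV. mu (card {k\<in>K. e k = v})) = (\<Sum>P\<in>pairings_on K. of_bool (const_on P e))"
  using \<open>finite K\<close>
proof (induction K rule: finite_psubset_induct)
  case (psubset K)
  show ?case
  proof (cases "K = {}")
    case True then show ?thesis by (simp add: mu const_on_def)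
  next
    case False
    then obtain k0 where k0: "k0 \<in> K" by blast
    define L where "L = {l\<in>K - {k0}. e l = e k0}"
    define rest where "rest = (\<Prod>v\<in>UNIV - {e k0}. mu (card {k\<in>K. e k = v}))"
    have finL: "finite L" using psubset.hyps by (simp add: L_def)
    have "{k\<in>K. e k = e k0} = insert k0 L" using k0 by (auto simp: L_def)
    then have cK: "card {k\<in>K. e k = e k0} = Suc (card L)" using finL by (simp add: L_def)
    have IH: "(\<Sum>P\<in>pairings_on (K - {k0, l}). of_bool (const_on P e)) = mu (card L - 1) * rest"
      if l: "l \<in> L" for l
    proof -
      have "(\<Sum>P\<in>pairings_on (K - {k0, l}). of_bool (const_on P e))
          = (\<Prod>v\<in>UNIV. mu (card {k\<in>K - {k0, l}. e k = v}))"
        using k0 by (intro psubset.IH[symmetric]) auto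
      also have "\<dots> = mu (card {k\<in>K - {k0, l}. e k = e k0})
          * (\<Prod>v\<in>UNIV - {e k0}. mu (card {k\<in>K - {k0, l}. e k = v}))"
        by (subst prod.remove[of _ "e k0"]) auto
      also have "{k\<in>K - {k0, l}. e k = e k0} = L - {l}" by (auto simp: L_def)
      also have "card (L - {l}) = card L - 1" using l finL by simp
      also have "(\<Prod>v\<in>UNIV - {e k0}. mu (card {k\<in>K - {k0, l}. e k = v})) = rest"
        unfolding rest_def using l by (intro prod.cong refl arg_cong[of _ _ mu] arg_cong[of _ _ card]) (auto simp: L_def)
      finally show ?thesis .
    qed
    have ins: "const_on (insert {k0, l} P) e \<longleftrightarrow> e l = e k0 \<and> const_on P e" for l P
      by (auto simp: const_on_def)
    have "(\<Sum>P\<in>pairings_on K. of_bool (const_on P e))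
        = (\<Sum>l\<in>K - {k0}. if e l = e k0 then mu (card L - 1) * rest else 0)"
      unfolding sum_pairings_on_remove[OF psubset.hyps k0] ins
      using IH by (intro sum.cong refl) (auto simp: L_def)
    also have "\<dots> = real (card L) * (mu (card L - 1) * rest)"
      using psubset.hyps by (subst sum.inter_filter[symmetric]) (auto simp: L_def)
    also have "\<dots> = mu (Suc (card L)) * rest"
      using mu(2) by (cases "card L") (simp_all add: mu(3))
    also have "\<dots> = (\<Prod>v\<in>UNIV. mu (card {k\<in>K. e k = v}))"
      unfolding rest_def cK[symmetric] by (subst prod.remove[of UNIV "e k0"]) auto
    finally show ?thesis by simp
  qed
qed

section \<open>Moments of independent standard normal variables\<close>

definition std_gauss :: "real measure" where
  "std_gauss = density lborel (\<lambda>x. ennreal (std_normal_density x))"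

lemma prob_space_std_gauss: "prob_space std_gauss"
  unfolding std_gauss_def by (rule prob_space_normal_density) simp

lemma sets_std_gauss [measurable_cong, simp]: "sets std_gauss = sets borel"
  by (simp add: std_gauss_def)

lemma space_std_gauss [simp]: "space std_gauss = UNIV"
  by (simp add: std_gauss_def)

lemma integrable_std_gauss_power: "integrable std_gauss (\<lambda>x. x ^ m)"
  unfolding std_gauss_def using integrable_std_normal_moment[of m]
  by (subst integrable_density) auto

definition gauss_moment :: "nat \<Rightarrow> real" where
  "gauss_moment m = (\<integral>x. x ^ m \<partial>std_gauss)"

lemma gauss_moment_density: "gauss_moment m = (\<integral>x. std_normal_density x * x ^ m \<partial>lborel)"
  unfolding gauss_moment_def std_gauss_def by (subst integral_density) auto

lemma gauss_moment_rec:
  "gauss_moment 0 = 1" "gauss_moment 1 = 0"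
  "gauss_moment (Suc (Suc m)) = real (Suc m) * gauss_moment m"
proof -
  have even: "gauss_moment (2 * k) = fact (2 * k) / (2 ^ k * fact k)" for k
    unfolding gauss_moment_density by (rule integral_std_normal_moment_even)
  have odd: "gauss_moment (2 * k + 1) = 0" for k
    unfolding gauss_moment_density by (rule integral_std_normal_moment_odd)
  show "gauss_moment 0 = 1" using even[of 0] by simp
  show "gauss_moment 1 = 0" using odd[of 0] by simp
  show "gauss_moment (Suc (Suc m)) = real (Suc m) * gauss_moment m"
  proof (cases "even m")
    case True
    then obtain k where m: "m = 2 * k" by (elim evenE)
    have "gauss_moment (Suc (Suc m)) = fact (2 * Suc k) / (2 ^ Suc k * fact (Suc k))"
      using even[of "Suc k"] m by simp
    also have "\<dots> = real (Suc m) * (fact (2 * k) / (2 ^ k * fact k))"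
      by (simp add: m divide_simps)
    finally show ?thesis by (simp add: even m)
  next
    case False
    then obtain k where m: "m = 2 * k + 1" by (elim oddE)
    then show ?thesis using odd[of k] odd[of "Suc k"] by simp
  qed
qed

abbreviation gauss_family :: "('v \<Rightarrow> real) measure" where
  "gauss_family \<equiv> PiM UNIV (\<lambda>_. std_gauss)"

lemma prod_group_power:
  fixes g :: "'v::finite \<Rightarrow> 'a::comm_monoid_mult"
  assumes "finite K"
  shows "(\<Prod>k\<in>K. g (e k)) = (\<Prod>v\<in>UNIV. g v ^ card {k\<in>K. e k = v})"
proof -
  have "(\<Prod>v\<in>UNIV. g v ^ card {k\<in>K. e k = v}) = (\<Prod>v\<in>UNIV. \<Prod>k\<in>{k\<in>K. e k = v}. g (e k))"
    by (intro prod.cong refl) simp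
  also have "\<dots> = (\<Prod>k\<in>K. g (e k))"
    using assms by (intro prod.group) auto
  finally show ?thesis ..
qed

text \<open>Repeated variables are collected into powers, so that the integral over the product
  measure becomes a product of one-dimensional moments.\<close>

lemma wick:
  fixes e :: "'k \<Rightarrow> 'v::finite"
  assumes "finite K"
  shows "integrable gauss_family (\<lambda>g. \<Prod>k\<in>K. g (e k))"
    and "(\<integral>g. (\<Prod>k\<in>K. g (e k)) \<partial>gauss_family) = (\<Sum>P\<in>pairings_on K. of_bool (const_on P e))"
proof -
  interpret prob_space std_gauss by (rule prob_space_std_gauss)
  interpret product_sigma_finite "\<lambda>_::'v. std_gauss" by standard
  show "integrable gauss_family (\<lambda>g. \<Prod>k\<in>K. g (e k))"
    unfolding prod_group_power[OF assms] by (intro product_integrable_prod integrable_std_gauss_power) simp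
  have "(\<integral>g. (\<Prod>k\<in>K. g (e k)) \<partial>gauss_family) = (\<Prod>v\<in>UNIV. gauss_moment (card {k\<in>K. e k = v}))"
    unfolding prod_group_power[OF assms] gauss_moment_def
    by (intro product_integral_prod integrable_std_gauss_power) simp
  also have "\<dots> = (\<Sum>P\<in>pairings_on K. of_bool (const_on P e))"
    by (intro wick_product gauss_moment_rec assms)
  finally show "(\<integral>g. (\<Prod>k\<in>K. g (e k)) \<partial>gauss_family) = (\<Sum>P\<in>pairings_on K. of_bool (const_on P e))" .
qed

section \<open>Invariant tensors of the orthogonal group\<close>

text \<open>The tensor power of \<open>A\<close> over the positions \<open>K\<close>, applied to
  \<open>w\<close> in coordinates.\<close>

definition tensor_act :: "'k set \<Rightarrow> real^'d^'d \<Rightarrow> (('k \<Rightarrow> 'd) \<Rightarrow> real) \<Rightarrow> ('k \<Rightarrow> 'd) \<Rightarrow> real" where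
  "tensor_act K A w i = (\<Sum>j\<in>indices K. (\<Prod>k\<in>K. A$(i k)$(j k)) * w j)"

definition tensor_inner :: "'k set \<Rightarrow> (('k \<Rightarrow> 'd::finite) \<Rightarrow> real) \<Rightarrow> (('k \<Rightarrow> 'd) \<Rightarrow> real) \<Rightarrow> real" where
  "tensor_inner K u v = (\<Sum>i\<in>indices K. u i * v i)"

lemma tensor_act_mult:
  assumes "finite K"
  shows "tensor_act K (A ** B) w i = tensor_act K A (tensor_act K B w) i"
proof -
  have "(\<Prod>k\<in>K. (A ** B)$(i k)$(j k)) = (\<Sum>l\<in>indices K. (\<Prod>k\<in>K. A$(i k)$(l k)) * (\<Prod>k\<in>K. B$(l k)$(j k)))" for j
    unfolding prod.distrib[symmetric]
    by (simp add: matrix_matrix_mult_def prod_sum_indices[OF assms])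
  then show ?thesis
    unfolding tensor_act_def
    by (simp add: sum_distrib_left sum_distrib_right mult.assoc) (rule sum.swap)
qed

lemma tensor_inner_act:
  "tensor_inner K u (tensor_act K A v) = tensor_inner K (tensor_act K (transpose A) u) v"
proof -
  have "tensor_inner K u (tensor_act K A v)
      = (\<Sum>i\<in>indices K. \<Sum>j\<in>indices K. u i * (\<Prod>k\<in>K. A$(i k)$(j k)) * v j)"
    by (simp add: tensor_inner_def tensor_act_def sum_distrib_left mult.assoc)
  also have "\<dots> = (\<Sum>j\<in>indices K. \<Sum>i\<in>indices K. u i * (\<Prod>k\<in>K. A$(i k)$(j k)) * v j)"
    by (rule sum.swap)
  also have "\<dots> = tensor_inner K (tensor_act K (transpose A) u) v"
    by (simp add: tensor_inner_def tensor_act_def sum_distrib_left sum_distrib_right transpose_def mult_ac)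
  finally show ?thesis .
qed

lemma tensor_inner_cong:
  "(\<And>i. i \<in> indices K \<Longrightarrow> u i = u' i) \<Longrightarrow> (\<And>i. i \<in> indices K \<Longrightarrow> v i = v' i) \<Longrightarrow>
    tensor_inner K u v = tensor_inner K u' v'"
  by (simp add: tensor_inner_def)

lemma tensor_act_cong:
  "(\<And>i. i \<in> indices K \<Longrightarrow> v i = v' i) \<Longrightarrow> tensor_act K A v i = tensor_act K A v' i"
  by (simp add: tensor_act_def)

lemma tensor_act_diagonal:
  assumes "finite K" and i: "i \<in> indices K" and D: "\<And>a b. a \<noteq> b \<Longrightarrow> D$a$b = 0"
  shows "tensor_act K D w i = (\<Prod>k\<in>K. D$(i k)$(i k)) * w i"
proof -
  have "(\<Prod>k\<in>K. D$(i k)$(j k)) = 0" if "j \<in> indices K" "j \<noteq> i" for j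
  proof -
    have "\<exists>k\<in>K. i k \<noteq> j k"
    proof (rule ccontr)
      assume "\<not> (\<exists>k\<in>K. i k \<noteq> j k)"
      then have "j = i" using PiE_ext[OF that(1) i] by metis
      with that show False by simp
    qed
    then obtain k where "k \<in> K" "i k \<noteq> j k" by blast
    then show ?thesis using D \<open>finite K\<close> by (auto intro!: prod_zero)
  qed
  then have "tensor_act K D w i = (\<Sum>j\<in>indices K. if j = i then (\<Prod>k\<in>K. D$(i k)$(i k)) * w i else 0)"
    unfolding tensor_act_def by (intro sum.cong) auto
  then show ?thesis using i \<open>finite K\<close> by (simp add: sum.delta')
qed

text \<open>Invariance of \<open>w\<close> absorbs the two orthogonal factors of the decomposition,
  one on each side of the inner product. What remains is a tensor power of a diagonal matrix, itself
  diagonal with nonnegative entries.\<close>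

lemma invariant_tensor_form_nonneg:
  fixes w :: "('k \<Rightarrow> 'd::finite) \<Rightarrow> real" and A :: "real^'d^'d"
  assumes K: "finite K"
    and inv: "\<And>Q i. orthogonal_matrix Q \<Longrightarrow> i \<in> indices K \<Longrightarrow> tensor_act K Q w i = w i"
  shows "0 \<le> tensor_inner K w (tensor_act K A w)"
proof -
  obtain Q1 Q2 :: "real^'d^'d" where Q: "orthogonal_matrix Q1" "orthogonal_matrix Q2"
    and D: "\<And>i j. i \<noteq> j \<Longrightarrow> (Q1 ** A ** Q2)$i$j = 0" "\<And>i. 0 \<le> (Q1 ** A ** Q2)$i$i"
    using singular_value_decomposition by blast
  let ?D = "Q1 ** A ** Q2"
  have "tensor_inner K w (tensor_act K ?D w)
      = tensor_inner K w (tensor_act K Q1 (tensor_act K A (tensor_act K Q2 w)))"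
    by (simp add: tensor_act_mult[OF K] matrix_mul_assoc[symmetric] cong: tensor_inner_cong)
       (simp add: tensor_act_mult[OF K, abs_def])
  also have "\<dots> = tensor_inner K (tensor_act K (transpose Q1) w) (tensor_act K A (tensor_act K Q2 w))"
    by (rule tensor_inner_act)
  also have "\<dots> = tensor_inner K w (tensor_act K A w)"
    using inv Q by (intro tensor_inner_cong tensor_act_cong) auto
  finally have "tensor_inner K w (tensor_act K A w)
      = (\<Sum>i\<in>indices K. w i * ((\<Prod>k\<in>K. ?D$(i k)$(i k)) * w i))"
    unfolding tensor_inner_def using tensor_act_diagonal[OF K _ D(1)] by (simp cong: sum.cong)
  also have "0 \<le> \<dots>"
  proof (rule sum_nonneg)
    fix i
    have "0 \<le> (\<Prod>k\<in>K. ?D$(i k)$(i k)) * (w i * w i)" using D(2) by (simp add: prod_nonneg)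
    then show "0 \<le> w i * ((\<Prod>k\<in>K. ?D$(i k)$(i k)) * w i)" by (simp add: mult.left_commute)
  qed
  finally show ?thesis .
qed

text \<open>The normal density is positive everywhere. This is what turns almost sure vanishing of a
  continuous function into vanishing at a given point.\<close>

lemma gauss_family_box_pos:
  fixes c :: "'v::finite \<Rightarrow> real"
  assumes "0 < e"
  shows "0 < emeasure gauss_family (PiE UNIV (\<lambda>v. {c v - e<..<c v + e}))"
proof -
  interpret prob_space std_gauss by (rule prob_space_std_gauss)
  interpret product_sigma_finite "\<lambda>_::'v. std_gauss" by standard
  have pos: "\<not> std_normal_density x \<le> 0" for x
    using normal_density_pos[of 1 0 x] by linarith
  have "emeasure std_gauss {a - e<..<a + e} \<noteq> 0" for a
  proof
    assume "emeasure std_gauss {a - e<..<a + e} = 0"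
    then have "{a - e<..<a + e} \<in> null_sets (density lborel (\<lambda>x. ennreal (std_normal_density x)))"
      by (simp add: null_sets_def std_gauss_def)
    then have "AE x in lborel. x \<in> {a - e<..<a + e} \<longrightarrow> ennreal (std_normal_density x) = 0"
      by (subst (asm) null_sets_density_iff) auto
    then have "AE x in lborel. x \<notin> {a - e<..<a + e}"
      by eventually_elim (auto simp: ennreal_eq_0_iff pos)
    then have "emeasure lborel {a - e<..<a + e} = 0"
      by (subst (asm) AE_iff_measurable[of "{a - e<..<a + e}"]) auto
    then show False using \<open>0 < e\<close> by simp
  qed
  then show ?thesis
    by (subst emeasure_PiM) (auto simp: zero_less_iff_neq_zero prod_zero_iff)
qed

theorem invariant_tensor_orthogonal_to_pairings:
  fixes w :: "('k \<Rightarrow> 'd::finite) \<Rightarrow> real"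
  assumes K: "finite K"
    and inv: "\<And>Q i. orthogonal_matrix Q \<Longrightarrow> i \<in> indices K \<Longrightarrow> tensor_act K Q w i = w i"
    and orth: "\<And>P. P \<in> pairings_on K \<Longrightarrow> tensor_inner K w (\<lambda>i. of_bool (const_on P i)) = 0"
    and i: "i \<in> indices K"
  shows "w i = 0"
proof (rule ccontr)
  assume "w i \<noteq> 0"
  define f where "f A = tensor_inner K w (tensor_act K A w)" for A :: "real^'d^'d"
  \<comment> \<open>The Gaussian family is indexed by matrix positions, so that Wick's formula sees
    a row index and a column index as one variable.\<close>
  define mk where "mk g = (\<chi> a b. g (a, b))" for g :: "('d \<times> 'd) \<Rightarrow> real"
  have f_mk: "f (mk g) = (\<Sum>i\<in>indices K. \<Sum>j\<in>indices K. w i * w j * (\<Prod>k\<in>K. g (i k, j k)))" for g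
    by (simp add: f_def tensor_inner_def tensor_act_def mk_def sum_distrib_left mult_ac)
  \<comment> \<open>A pairing contracts rows and columns simultaneously; therefore the mean of
    \<open>f\<close> becomes a sum of squares of inner products of \<open>w\<close> with
    pairings.\<close>
  have const_pair: "const_on P (\<lambda>k. (i k, j k)) \<longleftrightarrow> const_on P i \<and> const_on P j"
    for P :: "'k set set" and i j :: "'k \<Rightarrow> 'd"
    unfolding const_on_def prod.inject by blast
  have mono: "integrable gauss_family (\<lambda>g :: 'd \<times> 'd \<Rightarrow> real. \<Prod>k\<in>K. g (i k, j k))" for i j
    using wick(1)[OF K, of "\<lambda>k. (i k, j k)"] by simp
  have mono_integral: "(\<integral>g. (\<Prod>k\<in>K. g (i k, j k)) \<partial>gauss_family)
      = (\<Sum>P\<in>pairings_on K. of_bool (const_on P i) * of_bool (const_on P j) :: real)" for i j :: "'k \<Rightarrow> 'd"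
    unfolding wick(2)[OF K, of "\<lambda>k. (i k, j k)"] const_pair of_bool_conj ..
  have int: "integrable gauss_family (\<lambda>g. f (mk g))"
    unfolding f_mk
    by (rule Bochner_Integration.integrable_sum, rule Bochner_Integration.integrable_sum,
        rule integrable_mult_right, rule mono)
  have "(\<integral>g. f (mk g) \<partial>gauss_family)
      = (\<Sum>i\<in>indices K. \<Sum>j\<in>indices K. w i * w j *
           (\<Sum>P\<in>pairings_on K. of_bool (const_on P i) * of_bool (const_on P j)))"
    unfolding f_mk by (simp add: mono mono_integral)
  also have "\<dots> = (\<Sum>P\<in>pairings_on K. \<Sum>i\<in>indices K. \<Sum>j\<in>indices K.
      (w i * of_bool (const_on P i)) * (w j * of_bool (const_on P j)))"
    by (simp add: sum_distrib_left mult_ac) (subst sum.swap[of _ _ "pairings_on K"], rule sum.cong[OF refl], rule sum.swap)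
  also have "\<dots> = 0"
    using orth by (simp add: sum_product[symmetric] tensor_inner_def)
  finally have mean: "(\<integral>g. f (mk g) \<partial>gauss_family) = 0" .
  have nonneg: "0 \<le> f A" for A unfolding f_def using K inv by (rule invariant_tensor_form_nonneg)
  have "AE g in gauss_family. f (mk g) = 0"
    using integral_nonneg_eq_0_iff_AE[OF int] nonneg mean by simp
  have "f (mat 1) = (\<Sum>i\<in>indices K. w i * w i)"
    unfolding f_def tensor_inner_def
    by (intro sum.cong refl) (subst tensor_act_diagonal[OF K], auto simp: mat_def)
  also have "\<dots> > 0"
    using K i \<open>w i \<noteq> 0\<close> by (intro sum_pos2[of _ i]) (auto simp: zero_less_mult_iff)
  finally have pos: "0 < f (mat 1)" .
  have "continuous_on UNIV f"
    unfolding f_def tensor_inner_def tensor_act_def by (simp add: continuous_intros)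
  then have "open {A. 0 < f A}" by (intro open_Collect_less) (auto simp: continuous_intros)
  then obtain e where e: "0 < e" "ball (mat 1) e \<subseteq> {A. 0 < f A}"
    using pos by (metis mem_Collect_eq open_contains_ball)
  \<comment> \<open>The distance is bounded by the sum of the absolute values of all entries, at
    most \<open>d\<close> times the square of \<open>CARD('d)\<close>, which is
    \<open>e / 2\<close>.\<close>
  define d where "d = e / (2 * real CARD('d) * real CARD('d))"
  have d: "0 < d" using e by (simp add: d_def)
  define box where "box = PiE UNIV (\<lambda>v. {mat 1 $ fst v $ snd v - d<..<(mat 1 :: real^'d^'d) $ fst v $ snd v + d})"
  have pos_box: "0 < f (mk g)" if "g \<in> box" for g
  proof -
    have entry: "\<bar>mk g $ a $ b - (mat 1 :: real^'d^'d) $ a $ b\<bar> \<le> d" for a b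
    proof -
      have "g (a, b) \<in> {mat 1 $ a $ b - d<..<(mat 1 :: real^'d^'d) $ a $ b + d}"
        using that unfolding box_def by (auto simp: PiE_def Pi_def)
      then show ?thesis by (simp add: mk_def abs_le_iff)
    qed
    have "norm (mk g - mat 1) \<le> (\<Sum>a\<in>UNIV. norm ((mk g - mat 1) $ a))"
      unfolding norm_vec_def[of "mk g - mat 1"] by (intro L2_set_le_sum) simp
    also have "\<dots> \<le> (\<Sum>a\<in>(UNIV::'d set). \<Sum>b\<in>(UNIV::'d set). d)"
      by (intro sum_mono order.trans[OF norm_le_l1_cart]) (use entry in auto)
    also have "\<dots> < e" using e by (simp add: d_def)
    finally have "mk g \<in> ball (mat 1) e" by (simp add: dist_norm norm_minus_commute)
    then show ?thesis using e by blast
  qed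
  have "AE g in gauss_family. g \<notin> box"
    using \<open>AE g in gauss_family. f (mk g) = 0\<close>
  proof eventually_elim
    case (elim g) then show ?case using pos_box[of g] by auto
  qed
  moreover have "box \<in> sets gauss_family"
    unfolding box_def by (intro sets_PiM_I_finite) auto
  ultimately have "emeasure gauss_family box = 0"
    by (subst (asm) AE_iff_measurable[of box]) (auto simp: space_PiM dest: sets.sets_into_space)
  moreover have "0 < emeasure gauss_family box"
    unfolding box_def by (rule gauss_family_box_pos[OF d])
  ultimately show False by simp
qed

section \<open>Moments of Haar orthogonal matrices\<close>

text \<open>Each block contributes one entry of \<open>Q ** transpose Q\<close>, that is, of the
  identity matrix.\<close>

lemma tensor_act_pairing:
  fixes Q :: "real^'d::finite^'d"
  assumes K: "finite K" and P: "P \<in> pairings_on K" and Q: "orthogonal_matrix Q"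
  shows "tensor_act K Q (\<lambda>j. of_bool (const_on P j)) i = of_bool (const_on P i)"
proof -
  have part: "partition_on K P" using P by (simp add: pairings_on_def)
  have "tensor_act K Q (\<lambda>j. of_bool (const_on P j)) i = (\<Prod>B\<in>P. \<Sum>a\<in>UNIV. \<Prod>k\<in>B. Q$(i k)$a)"
    unfolding tensor_act_def sum_const_on_partition[OF K part, symmetric] by (simp add: mult.commute)
  also have "\<dots> = (\<Prod>B\<in>P. of_bool (\<forall>k\<in>B. \<forall>l\<in>B. i k = i l))"
  proof (rule prod.cong[OF refl])
    fix B assume "B \<in> P"
    then have "card B = 2" using P by (simp add: pairings_on_def)
    then obtain k l where B: "k \<noteq> l" "B = {k, l}" by (auto simp: card_2_iff)
    have 1: "(\<Sum>a\<in>UNIV. \<Prod>k\<in>B. Q$(i k)$a) = (Q ** transpose Q)$(i k)$(i l)"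
      using B by (simp add: matrix_matrix_mult_def transpose_def)
    have 2: "(Q ** transpose Q)$(i k)$(i l) = of_bool (i k = i l)"
      using Q by (simp add: orthogonal_matrix_def mat_def)
    have 3: "(\<forall>k\<in>B. \<forall>l\<in>B. i k = i l) \<longleftrightarrow> i k = i l" unfolding B(2) by (rule const_on_doubleton)
    show "(\<Sum>a\<in>UNIV. \<Prod>k\<in>B. Q$(i k)$a) = of_bool (\<forall>k\<in>B. \<forall>l\<in>B. i k = i l)"
      unfolding 1 2 3 ..
  qed
  also have "\<dots> = of_bool (const_on P i)"
    using finite_elements[OF K part] by (induction P rule: finite_induct) (simp_all only: prod.empty prod.insert const_on_insert const_on_empty of_bool_conj of_bool_eq simp_thms)
  finally show ?thesis .
qed

text \<open>If the family \<open>v\<close> is dependent, \<open>S = G W\<close> is not the identity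
  but the projection onto the range of \<open>G\<close>. The defect \<open>u\<close> satisfies
  \<open>G u = 0\<close>, so the combination of the \<open>v P\<close> with coefficients
  \<open>u P\<close> has squared norm 0; and \<open>S u = 0\<close> by the symmetry of
  \<open>S\<close> and \<open>G\<close>. Hence the sum of the squares of \<open>u\<close>, which is
  the product of \<open>u\<close> with \<open>v\<close> minus that with \<open>S v\<close>,
  vanishes.\<close>

lemma gram_pseudoinverse_projects:
  fixes v :: "'p \<Rightarrow> 'l \<Rightarrow> real"
  assumes J: "finite J" and L: "finite L"
    and G: "\<And>P Q. P \<in> J \<Longrightarrow> Q \<in> J \<Longrightarrow> G P Q = (\<Sum>l\<in>L. v P l * v Q l)"
    and W: "is_pseudoinverse_on J G W" and l: "l \<in> L" and P: "P \<in> J"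
  shows "(\<Sum>Q\<in>J. mmult_on J G W P Q * v Q l) = v P l"
proof -
  define S where "S = mmult_on J G W"
  define u where "u P = v P l - (\<Sum>Q\<in>J. S P Q * v Q l)" for P
  have symG: "G P Q = G Q P" if "P \<in> J" "Q \<in> J" for P Q
    using that by (simp add: G mult.commute)
  have symS: "S P Q = S Q P" if "P \<in> J" "Q \<in> J" for P Q
    using W that by (simp add: S_def is_pseudoinverse_on_def)
  have SG: "(\<Sum>R\<in>J. S P R * G R Q) = G P Q" if "P \<in> J" "Q \<in> J" for P Q
  proof -
    have "mmult_on J (mmult_on J G W) G P Q = G P Q"
      using W that unfolding is_pseudoinverse_on_def by blast
    then show ?thesis by (simp only: S_def mmult_on_def[of J "mmult_on J G W"])
  qed
  have Gu: "(\<Sum>P\<in>J. G R P * u P) = 0" if R: "R \<in> J" for R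
  proof -
    have GS: "(\<Sum>P\<in>J. G R P * S P Q) = G R Q" if "Q \<in> J" for Q
      using SG[OF that R] symG R symS that by (simp add: mult.commute cong: sum.cong)
    have "(\<Sum>P\<in>J. G R P * u P) = (\<Sum>P\<in>J. G R P * v P l) - (\<Sum>P\<in>J. \<Sum>Q\<in>J. G R P * S P Q * v Q l)"
      by (simp add: u_def algebra_simps sum_subtractf sum_distrib_left)
    also have "(\<Sum>P\<in>J. \<Sum>Q\<in>J. G R P * S P Q * v Q l) = (\<Sum>Q\<in>J. (\<Sum>P\<in>J. G R P * S P Q) * v Q l)"
      by (subst sum.swap) (simp add: sum_distrib_right)
    also have "\<dots> = (\<Sum>Q\<in>J. G R Q * v Q l)" by (intro sum.cong refl) (simp add: GS)
    finally show ?thesis by simp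
  qed
  have "(\<Sum>m\<in>L. (\<Sum>P\<in>J. u P * v P m) * (\<Sum>R\<in>J. u R * v R m)) = (\<Sum>P\<in>J. u P * (\<Sum>R\<in>J. G P R * u R))"
  proof -
    have "(\<Sum>m\<in>L. (\<Sum>P\<in>J. u P * v P m) * (\<Sum>R\<in>J. u R * v R m))
        = (\<Sum>m\<in>L. \<Sum>P\<in>J. \<Sum>R\<in>J. u P * u R * (v P m * v R m))"
      by (simp add: sum_product mult_ac)
    also have "\<dots> = (\<Sum>P\<in>J. \<Sum>R\<in>J. \<Sum>m\<in>L. u P * u R * (v P m * v R m))"
      by (subst sum.swap, rule sum.cong[OF refl], rule sum.swap)
    also have "\<dots> = (\<Sum>P\<in>J. u P * (\<Sum>R\<in>J. G P R * u R))"
      by (simp add: G sum_distrib_left sum_distrib_right mult_ac cong: sum.cong)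
    finally show ?thesis .
  qed
  also have "\<dots> = 0" by (simp add: Gu)
  finally have "\<forall>m\<in>L. (\<Sum>P\<in>J. u P * v P m) * (\<Sum>R\<in>J. u R * v R m) = 0"
    using L by (subst (asm) sum_nonneg_eq_0_iff) auto
  then have uv: "(\<Sum>P\<in>J. u P * v P l) = 0" using l by simp
  have Su: "(\<Sum>P\<in>J. S Q P * u P) = 0" if Q: "Q \<in> J" for Q
  proof -
    have "S Q P = (\<Sum>R\<in>J. W R Q * G R P)" if "P \<in> J" for P
      using symS[OF Q that] symG that by (simp add: S_def mmult_on_def mult.commute cong: sum.cong)
    then have "(\<Sum>P\<in>J. S Q P * u P) = (\<Sum>P\<in>J. \<Sum>R\<in>J. W R Q * (G R P * u P))"
      by (simp add: sum_distrib_right mult.assoc)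
    also have "\<dots> = (\<Sum>R\<in>J. W R Q * (\<Sum>P\<in>J. G R P * u P))"
      by (subst sum.swap) (simp add: sum_distrib_left)
    finally show ?thesis by (simp add: Gu)
  qed
  have "(\<Sum>P\<in>J. u P * u P) = (\<Sum>P\<in>J. u P * v P l) - (\<Sum>P\<in>J. \<Sum>Q\<in>J. u P * S P Q * v Q l)"
    by (subst (2) u_def) (simp add: algebra_simps sum_subtractf sum_distrib_left)
  also have "(\<Sum>P\<in>J. \<Sum>Q\<in>J. u P * S P Q * v Q l) = (\<Sum>Q\<in>J. (\<Sum>P\<in>J. S Q P * u P) * v Q l)"
  proof -
    have eq: "u P * S P Q * v Q l = S Q P * u P * v Q l" if "Q \<in> J" "P \<in> J" for P Q
      using symS[OF that] by simp
    show ?thesis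
      unfolding sum_distrib_right by (subst sum.swap, intro sum.cong refl, rule eq)
  qed
  finally have "(\<Sum>P\<in>J. u P * u P) = 0" using uv Su by simp
  then have "u P * u P = 0" using J P by (subst (asm) sum_nonneg_eq_0_iff) auto
  then show ?thesis by (simp add: u_def S_def)
qed

lemma orthogonal_matrix_entry_le_1:
  fixes Q :: "real^'d::finite^'d"
  assumes "orthogonal_matrix Q" shows "\<bar>Q$a$b\<bar> \<le> 1"
proof -
  have "norm (row a Q) = 1" using assms by (simp add: orthogonal_matrix_orthonormal_rows)
  then show ?thesis using component_le_norm_cart[of "row a Q" b] by (simp add: row_def)
qed

lemma borel_measurable_matrix_entry [measurable]:
  "(\<lambda>A :: 'a::real_normed_vector^'d::finite^'e::finite. A$a$b) \<in> borel_measurable borel"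
  by (intro borel_measurable_continuous_onI continuous_intros)

lemma haar_integrable_moment:
  fixes \<mu> :: "(real^'d::finite^'d) measure"
  assumes haar: "haar_orthogonal_measure \<mu>"
  shows "integrable \<mu> (\<lambda>A. \<Prod>k\<in>K. A$(i k)$(j k))"
proof -
  interpret prob_space \<mu> using haar by (simp add: haar_orthogonal_measure_def)
  have [measurable_cong]: "sets \<mu> = sets borel" and ae: "AE A in \<mu>. orthogonal_matrix A"
    using haar by (auto simp: haar_orthogonal_measure_def)
  show ?thesis
  proof (rule integrable_const_bound[where B = 1])
    show "AE A in \<mu>. norm (\<Prod>k\<in>K. A$(i k)$(j k)) \<le> 1"
      using ae
    proof eventually_elim
      case (elim A)
      then have "(\<Prod>k\<in>K. \<bar>A$(i k)$(j k)\<bar>) \<le> 1"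
        by (intro prod_le_1) (auto simp: orthogonal_matrix_entry_le_1)
      then show ?case by (simp add: abs_prod)
    qed
  qed measurable
qed

theorem haar_moment:
  fixes \<mu> :: "(real^'d::finite^'d) measure"
  assumes haar: "haar_orthogonal_measure \<mu>" and K: "finite K"
    and G: "\<And>P Q. P \<in> pairings_on K \<Longrightarrow> Q \<in> pairings_on K \<Longrightarrow>
      G P Q = (\<Sum>l\<in>(indices K :: ('k \<Rightarrow> 'd) set). of_bool (const_on P l) * of_bool (const_on Q l))"
    and W: "is_pseudoinverse_on (pairings_on K) G W"
    and ij: "i \<in> indices K" "j \<in> indices K"
  shows "(\<integral>A. (\<Prod>k\<in>K. A$(i k)$(j k)) \<partial>\<mu>) = (\<Sum>P\<in>pairings_on K. \<Sum>Q\<in>pairings_on K.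
      of_bool (const_on P i) * W P Q * of_bool (const_on Q j))"
proof -
  let ?J = "pairings_on K"
  define v where "v P l = (of_bool (const_on P l) :: real)" for P :: "'k set set" and l :: "'k \<Rightarrow> 'd"
  define m where "m i = (\<integral>A. (\<Prod>k\<in>K. A$(i k)$(j k)) \<partial>\<mu>)" for i
  define w where "w i = m i - (\<Sum>P\<in>?J. \<Sum>Q\<in>?J. v P i * W P Q * v Q j)" for i
  have [measurable_cong]: "sets \<mu> = sets borel" and ae: "AE A in \<mu>. orthogonal_matrix A"
    and distr: "\<And>Q. orthogonal_matrix Q \<Longrightarrow> distr \<mu> borel (\<lambda>A. Q ** A) = \<mu>"
    and prob: "prob_space \<mu>"
    using haar by (auto simp: haar_orthogonal_measure_def)
  note int = haar_integrable_moment[OF haar]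
  have "w i = 0"
  proof (rule invariant_tensor_orthogonal_to_pairings[OF K _ _ ij(1)])
    fix Q :: "real^'d^'d" and i :: "'k \<Rightarrow> 'd" assume Q: "orthogonal_matrix Q" and i: "i \<in> indices K"
    \<comment> \<open>The action of \<open>Q\<close> multiplies the matrix inside the integral from
      the left, and the Haar measure absorbs it.\<close>
    have "tensor_act K Q m i = (\<integral>A. (\<Sum>l\<in>indices K. (\<Prod>k\<in>K. Q$(i k)$(l k)) * (\<Prod>k\<in>K. A$(l k)$(j k))) \<partial>\<mu>)"
      unfolding tensor_act_def m_def by (simp add: int)
    also have "\<dots> = (\<integral>A. (\<Prod>k\<in>K. (Q ** A)$(i k)$(j k)) \<partial>\<mu>)"
      unfolding matrix_matrix_mult_def by (simp add: prod.distrib[symmetric] prod_sum_indices[OF K])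
    also have "\<dots> = (\<integral>A. (\<Prod>k\<in>K. A$(i k)$(j k)) \<partial>distr \<mu> borel (\<lambda>A. Q ** A))"
    proof (rule integral_distr[symmetric])
      have "(\<lambda>A. Q ** A) \<in> borel_measurable (borel :: (real^'d^'d) measure)"
        unfolding matrix_matrix_mult_def by (intro borel_measurable_continuous_onI) (simp add: continuous_intros)
      then show "(\<lambda>A. Q ** A) \<in> \<mu> \<rightarrow>\<^sub>M borel" by measurable
    qed measurable
    finally have m: "tensor_act K Q m i = m i" by (simp add: distr[OF Q] m_def)
    have "tensor_act K Q (\<lambda>i. \<Sum>P\<in>?J. \<Sum>Q\<in>?J. v P i * W P Q * v Q j) i
        = (\<Sum>P\<in>?J. \<Sum>R\<in>?J. tensor_act K Q (v P) i * W P R * v R j)"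
      unfolding tensor_act_def
      by (simp add: sum_distrib_left sum_distrib_right mult.assoc)
         (subst sum.swap, rule sum.cong[OF refl], rule sum.swap)
    also have "\<dots> = (\<Sum>P\<in>?J. \<Sum>R\<in>?J. v P i * W P R * v R j)"
      using tensor_act_pairing[OF K _ Q] by (intro sum.cong refl) (simp add: v_def[abs_def])
    finally have "tensor_act K Q (\<lambda>i. \<Sum>P\<in>?J. \<Sum>Q\<in>?J. v P i * W P Q * v Q j) i
        = (\<Sum>P\<in>?J. \<Sum>R\<in>?J. v P i * W P R * v R j)" .
    moreover have "tensor_act K Q w i = tensor_act K Q m i
        - tensor_act K Q (\<lambda>i. \<Sum>P\<in>?J. \<Sum>Q\<in>?J. v P i * W P Q * v Q j) i"
      unfolding tensor_act_def w_def right_diff_distrib sum_subtractf ..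
    ultimately show "tensor_act K Q w i = w i" by (simp add: m w_def)
  next
    fix R assume R: "R \<in> ?J"
    \<comment> \<open>The sum over \<open>i\<close> is the action of \<open>transpose A\<close> on
      the tensor of \<open>R\<close>, evaluated at \<open>j\<close>; almost surely it leaves that
      tensor unchanged.\<close>
    have "tensor_inner K m (v R) = (\<integral>A. tensor_act K (transpose A) (v R) j \<partial>\<mu>)"
      unfolding tensor_inner_def m_def tensor_act_def transpose_def by (simp add: int)
    also have "\<dots> = (\<integral>A. v R j \<partial>\<mu>)"
    proof (rule integral_cong_AE)
      show "AE A in \<mu>. tensor_act K (transpose A) (v R) j = v R j"
        using ae by eventually_elim (simp add: v_def[abs_def] tensor_act_pairing[OF K R])
      show "(\<lambda>A. tensor_act K (transpose A) (v R) j) \<in> borel_measurable \<mu>"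
        unfolding tensor_act_def transpose_def by simp measurable
    qed simp
    finally have m: "tensor_inner K m (v R) = v R j" using prob by (simp add: prob_space.prob_space)
    have "tensor_inner K (\<lambda>i. \<Sum>P\<in>?J. \<Sum>Q\<in>?J. v P i * W P Q * v Q j) (v R)
        = (\<Sum>P\<in>?J. \<Sum>Q\<in>?J. (\<Sum>i\<in>indices K. v R i * v P i) * W P Q * v Q j)"
      unfolding tensor_inner_def
      by (simp add: sum_distrib_left sum_distrib_right mult_ac)
         (subst sum.swap, rule sum.cong[OF refl], rule sum.swap)
    \<comment> \<open>The inner products of pairing tensors are the entries of the Gram matrix, so
      \<open>G W\<close> appears, which fixes the vector of their coordinates at
      \<open>j\<close>.\<close>
    also have "\<dots> = (\<Sum>P\<in>?J. \<Sum>Q\<in>?J. G R P * W P Q * v Q j)"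
      using R by (intro sum.cong refl) (simp add: G v_def)
    also have "\<dots> = (\<Sum>Q\<in>?J. mmult_on ?J G W R Q * v Q j)"
      by (subst sum.swap) (simp add: mmult_on_def sum_distrib_right)
    also have "\<dots> = v R j"
      by (rule gram_pseudoinverse_projects[where L = "indices K", OF _ _ _ W ij(2) R])
         (use K in \<open>auto simp: G v_def finite_pairings_on\<close>)
    finally have "tensor_inner K (\<lambda>i. \<Sum>P\<in>?J. \<Sum>Q\<in>?J. v P i * W P Q * v Q j) (v R) = v R j" .
    moreover have "tensor_inner K w (v R) = tensor_inner K m (v R)
        - tensor_inner K (\<lambda>i. \<Sum>P\<in>?J. \<Sum>Q\<in>?J. v P i * W P Q * v Q j) (v R)"
      unfolding tensor_inner_def w_def left_diff_distrib sum_subtractf ..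
    ultimately show "tensor_inner K w (\<lambda>i. of_bool (const_on R i)) = 0"
      using m by (simp add: v_def[abs_def])
  qed
  then show ?thesis by (simp add: w_def m_def v_def)
qed

section \<open>Cycles of premaps\<close>

text \<open>With \<open>I\<close> positive, the sign of an element of \<open>pm I\<close> tells on
  which side it lies, and the absolute value is the projection to \<open>I\<close>.\<close>

locale signed_set =
  fixes I :: "int set"
  assumes finite_I: "finite I" and pos_I: "\<And>k. k \<in> I \<Longrightarrow> 0 < k"
begin

lemma abs_I: "k \<in> I \<Longrightarrow> \<bar>k\<bar> = k"
  using pos_I[of k] by simp

lemma mem_pm: "k \<in> pm I \<longleftrightarrow> \<bar>k\<bar> \<in> I"
proof
  show "\<bar>k\<bar> \<in> I" if "k \<in> pm I" using that by (auto simp: pm_def abs_I)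
  show "k \<in> pm I" if "\<bar>k\<bar> \<in> I"
  proof (cases "0 \<le> k")
    case False
    then have "k = - \<bar>k\<bar>" by simp
    with that show ?thesis unfolding pm_def by blast
  qed (use that in \<open>simp add: pm_def\<close>)
qed

lemma finite_pm: "finite (pm I)"
  using finite_I by (simp add: pm_def)

lemma uminus_mem_pm [simp]: "- k \<in> pm I \<longleftrightarrow> k \<in> pm I"
  by (simp add: mem_pm)

lemma I_subset_pm: "k \<in> I \<Longrightarrow> k \<in> pm I"
  by (simp add: pm_def)

lemma pm_cases:
  assumes "k \<in> pm I"
  obtains (pos) "k \<in> I" "0 < k" | (neg) m where "m \<in> I" "0 < m" "k = - m"
  using assms pos_I by (auto simp: pm_def)

lemma pm_nonzero: "k \<in> pm I \<Longrightarrow> k \<noteq> 0"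
  using pos_I[of 0] by (auto simp: mem_pm)

lemma uminus_notin_I: "k \<in> I \<Longrightarrow> - k \<notin> I"
  using pos_I[of k] pos_I[of "- k"] by auto

lemma delta_simp: "k \<in> pm I \<Longrightarrow> delta I k = - k"
  by (simp add: delta_def)

lemma permutation_pm: "\<pi> permutes pm I \<Longrightarrow> permutation \<pi>"
  using finite_pm by (auto simp: permutation_permutes)

text \<open>The condition on whole cycles reduces to \<open>\<pi> k \<noteq> - k\<close>: if a power
  of \<open>\<pi>\<close> maps \<open>k\<close> to \<open>- k\<close>, the relation
  \<open>\<pi> (- \<pi> k) = - k\<close> and injectivity yield the same for \<open>\<pi> k\<close>
  with an exponent smaller by 2, until the exponent is 0 or 1.\<close>

lemma premap_iff:
  "\<pi> \<in> premaps I \<longleftrightarrow> \<pi> permutes pm I \<and> (\<forall>k\<in>pm I. \<pi> (- \<pi> k) = - k) \<and> (\<forall>k\<in>pm I. \<pi> k \<noteq> - k)"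
proof -
  have "(delta I \<circ> \<pi> \<circ> delta I = inv \<pi>) \<longleftrightarrow> (\<forall>k\<in>pm I. \<pi> (- \<pi> k) = - k)" if \<pi>: "\<pi> permutes pm I"
  proof
    assume eq: "delta I \<circ> \<pi> \<circ> delta I = inv \<pi>"
    show "\<forall>k\<in>pm I. \<pi> (- \<pi> k) = - k"
    proof
      fix k assume k: "k \<in> pm I"
      have "inv \<pi> (- k) = - \<pi> k"
        unfolding eq[symmetric] using k permutes_in_image[OF \<pi>] by (simp add: delta_simp)
      then show "\<pi> (- \<pi> k) = - k" by (metis permutes_inverses(1)[OF \<pi>])
    qed
  next
    assume neg: "\<forall>k\<in>pm I. \<pi> (- \<pi> k) = - k"
    show "delta I \<circ> \<pi> \<circ> delta I = inv \<pi>"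
    proof
      fix k
      have "\<pi> ((delta I \<circ> \<pi> \<circ> delta I) k) = k"
      proof (cases "k \<in> pm I")
        case True
        then show ?thesis using neg[rule_format, of "- k"] permutes_in_image[OF \<pi>] by (simp add: delta_simp)
      next
        case False
        then show ?thesis using permutes_not_in[OF \<pi>] by (simp add: delta_def)
      qed
      then show "(delta I \<circ> \<pi> \<circ> delta I) k = inv \<pi> k" by (metis permutes_inverses(2)[OF \<pi>])
    qed
  qed
  moreover have "(\<forall>k\<in>I. \<not> (\<exists>c\<in>cycles_on (pm I) \<pi>. k \<in> c \<and> - k \<in> c)) \<longleftrightarrow> (\<forall>k\<in>pm I. \<pi> k \<noteq> - k)"
    if \<pi>: "\<pi> permutes pm I" and neg: "\<forall>k\<in>pm I. \<pi> (- \<pi> k) = - k"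
  proof
    assume *: "\<forall>k\<in>I. \<not> (\<exists>c\<in>cycles_on (pm I) \<pi>. k \<in> c \<and> - k \<in> c)"
    show "\<forall>k\<in>pm I. \<pi> k \<noteq> - k"
    proof (intro ballI notI)
      fix k assume k: "k \<in> pm I" "\<pi> k = - k"
      have "k \<in> orbit \<pi> k" "- k \<in> orbit \<pi> k"
        using permutation_self_in_orbit[OF permutation_pm[OF \<pi>]] orbit.base[of \<pi> k] k by auto
      moreover have "orbit \<pi> k \<in> cycles_on (pm I) \<pi>" using k by (simp add: cycles_on_def)
      ultimately show False using * by - (rule pm_cases[OF k(1)], auto)
    qed
  next
    assume neq: "\<forall>k\<in>pm I. \<pi> k \<noteq> - k"
    have pow: "(\<forall>k\<in>pm I. (\<pi> ^^ m) k \<noteq> - k) \<and> (\<forall>k\<in>pm I. (\<pi> ^^ Suc m) k \<noteq> - k)" for m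
    proof (induction m)
      case 0 show ?case using neq pm_nonzero by auto
    next
      case (Suc m)
      have "(\<pi> ^^ Suc (Suc m)) k \<noteq> - k" if k: "k \<in> pm I" for k
      proof
        assume "(\<pi> ^^ Suc (Suc m)) k = - k"
        then have "\<pi> ((\<pi> ^^ m) (\<pi> k)) = \<pi> (- \<pi> k)" using neg k by (simp add: funpow_swap1)
        then have "(\<pi> ^^ m) (\<pi> k) = - \<pi> k" using permutes_inj[OF \<pi>] by (simp add: inj_eq)
        then show False using Suc permutes_in_image[OF \<pi>] k by blast
      qed
      with Suc show ?case by blast
    qed
    show "\<forall>k\<in>I. \<not> (\<exists>c\<in>cycles_on (pm I) \<pi>. k \<in> c \<and> - k \<in> c)"
    proof (intro ballI notI)
      fix k assume k: "k \<in> I" "\<exists>c\<in>cycles_on (pm I) \<pi>. k \<in> c \<and> - k \<in> c"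
      then obtain x where "k \<in> orbit \<pi> x" "- k \<in> orbit \<pi> x" by (auto simp: cycles_on_def)
      then have "- k \<in> orbit \<pi> k"
        by (meson permutation_pm[OF \<pi>] orbit_swap orbit_trans permutation_self_in_orbit)
      then obtain m where "- k = (\<pi> ^^ m) k" by (auto simp: orbit_altdef)
      then show False using pow[of m] I_subset_pm[OF k(1)] by metis
    qed
  qed
  ultimately show ?thesis unfolding premaps_def by blast
qed

lemma orbit_subset_pm: "\<pi> permutes pm I \<Longrightarrow> k \<in> pm I \<Longrightarrow> orbit \<pi> k \<subseteq> pm I"
  by (rule permutes_orbit_subset)

lemma orbit_eq:
  assumes "\<pi> permutes pm I" "x \<in> orbit \<pi> k"
  shows "orbit \<pi> x = orbit \<pi> k"
  using cyclic_on_orbit'[OF permutation_pm[OF assms(1)], of k] assms(2)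
  by (rule orbit_cyclic_eq3)

lemma self_in_orbit: "\<pi> permutes pm I \<Longrightarrow> k \<in> orbit \<pi> k"
  by (rule permutation_self_in_orbit[OF permutation_pm])

section \<open>Negation as a symmetry of the cycles of a premap\<close>

context
  fixes \<pi> assumes premap: "\<pi> \<in> premaps I"
begin

lemma premap_permutes: "\<pi> permutes pm I"
  and premap_neg: "k \<in> pm I \<Longrightarrow> \<pi> (- \<pi> k) = - k"
  and premap_neq: "k \<in> pm I \<Longrightarrow> \<pi> k \<noteq> - k"
  using premap by (auto simp: premap_iff)

text \<open>Negation conjugates \<open>\<pi>\<close> to its inverse, and both have the same
  orbits.\<close>

lemma premap_orbit_uminus:
  assumes "k \<in> pm I" shows "orbit \<pi> (- k) = uminus ` orbit \<pi> k"
proof -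
  have "uminus ` orbit \<pi> k = orbit (inv \<pi>) (- k)"
  proof (rule orbit_inverse)
    show "k \<in> orbit \<pi> k" by (rule self_in_orbit[OF premap_permutes])
    fix x assume "x \<in> orbit \<pi> k"
    then have "x \<in> pm I" using orbit_subset_pm[OF premap_permutes assms] by blast
    then show "inv \<pi> (- x) = - \<pi> x"
      using premap_neg permutes_inverses(2)[OF premap_permutes] by metis
  qed
  then show ?thesis by (simp add: orbit_inv_eq[OF permutation_pm[OF premap_permutes]])
qed

lemma premap_orbit_no_uminus:
  assumes "x \<in> pm I" "k \<in> orbit \<pi> x" shows "- k \<notin> orbit \<pi> x"
proof
  assume "- k \<in> orbit \<pi> x"
  moreover have "k \<in> pm I" using assms orbit_subset_pm[OF premap_permutes] by blast
  moreover have "orbit \<pi> x \<in> cycles_on (pm I) \<pi>" using assms by (simp add: cycles_on_def)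
  ultimately show False
    using premap assms(2) unfolding premaps_def by - (rule pm_cases[OF \<open>k \<in> pm I\<close>], auto)
qed

lemma premap_inj_abs:
  assumes "k \<in> pm I" shows "inj_on abs (orbit \<pi> k)"
proof (rule inj_onI)
  fix x y assume xy: "x \<in> orbit \<pi> k" "y \<in> orbit \<pi> k" "\<bar>x\<bar> = \<bar>y\<bar>"
  then have "y \<noteq> - x" using premap_orbit_no_uminus[OF assms] by blast
  with xy show "x = y" by arith
qed

text \<open>The smallest absolute value is attained in the cycle and, with the opposite sign, in its
  negative. A cycle never contains both signs of an element.\<close>

lemma particular_uminus:
  assumes x: "x \<in> pm I"
  shows "particular (orbit \<pi> (- x)) \<longleftrightarrow> \<not> particular (orbit \<pi> x)"
proof -
  let ?c = "orbit \<pi> x"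
  have sub: "?c \<subseteq> pm I" by (rule orbit_subset_pm[OF premap_permutes x])
  have fin: "finite ?c" using sub finite_pm finite_subset by blast
  obtain m where m: "m \<in> ?c" "\<forall>j\<in>?c. \<bar>m\<bar> \<le> \<bar>j\<bar>"
    using ex_min_if_finite[of "abs ` ?c"] fin orbit_nonempty[of \<pi> x]
    by (metis (no_types, lifting) arg_min_if_finite(1) arg_min_least)
  have "particular ?c \<or> particular (uminus ` ?c)"
  proof (cases "0 < m")
    case True then show ?thesis using m by (auto simp: particular_def)
  next
    case False
    then have "0 < - m" using m sub pm_nonzero by force
    then have "particular (uminus ` ?c)" using m unfolding particular_def
      by (intro bexI[of _ "- m"]) auto
    then show ?thesis ..
  qed
  moreover have False if "particular ?c" "particular (uminus ` ?c)"
  proof -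
    obtain k where k: "k \<in> ?c" "0 < k" "\<forall>j\<in>?c. \<bar>k\<bar> \<le> \<bar>j\<bar>" using \<open>particular ?c\<close> by (auto simp: particular_def)
    obtain l where l: "l \<in> ?c" "0 < - l" "\<forall>j\<in>?c. \<bar>l\<bar> \<le> \<bar>j\<bar>"
      using \<open>particular (uminus ` ?c)\<close> by (auto simp: particular_def)
    have "\<bar>k\<bar> = \<bar>l\<bar>" using k l by (meson antisym)
    then have "l = - k" using k l by simp
    then show False using premap_orbit_no_uminus[OF x k(1)] l by simp
  qed
  ultimately show ?thesis unfolding premap_orbit_uminus[OF x] by blast
qed

lemma mem_half_set: "k \<in> half_set I \<pi> \<longleftrightarrow> k \<in> pm I \<and> particular (orbit \<pi> k)"
proof
  assume "k \<in> half_set I \<pi>"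
  then obtain x where x: "x \<in> pm I" "k \<in> orbit \<pi> x" "particular (orbit \<pi> x)"
    by (auto simp: half_set_def cycles_on_def)
  then show "k \<in> pm I \<and> particular (orbit \<pi> k)"
    using orbit_subset_pm[OF premap_permutes x(1)] orbit_eq[OF premap_permutes x(2)] by auto
next
  assume "k \<in> pm I \<and> particular (orbit \<pi> k)"
  then show "k \<in> half_set I \<pi>"
    using self_in_orbit[OF premap_permutes, of k] by (auto simp: half_set_def cycles_on_def)
qed

lemma half_set_subset: "half_set I \<pi> \<subseteq> pm I"
  by (auto simp: mem_half_set)

lemma finite_half_set: "finite (half_set I \<pi>)"
  using half_set_subset finite_pm by (rule finite_subset)

lemma half_set_uminus: "k \<in> pm I \<Longrightarrow> - k \<in> half_set I \<pi> \<longleftrightarrow> k \<notin> half_set I \<pi>"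
  using particular_uminus by (auto simp: mem_half_set)

lemma half_set_image: "\<pi> k \<in> half_set I \<pi> \<longleftrightarrow> k \<in> half_set I \<pi>"
  using permutes_in_image[OF premap_permutes] orbit_eq[OF premap_permutes orbit.base]
  by (simp add: mem_half_set)

lemma half_perm_permutes: "half_perm I \<pi> permutes half_set I \<pi>"
proof (rule bij_imp_permutes)
  have "inj_on \<pi> (half_set I \<pi>)" using permutes_inj[OF premap_permutes] by (rule inj_on_subset) simp
  moreover have "\<pi> ` half_set I \<pi> \<subseteq> half_set I \<pi>" using half_set_image by blast
  ultimately have "bij_betw \<pi> (half_set I \<pi>) (half_set I \<pi>)"
    using finite_half_set by (simp add: bij_betw_def endo_inj_surj)
  then show "bij_betw (half_perm I \<pi>) (half_set I \<pi>) (half_set I \<pi>)"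
    by (subst bij_betw_cong[of _ _ \<pi>]) (auto simp: half_perm_def perm_restrict_def)
qed (simp add: half_perm_def perm_restrict_def)

lemma half_perm_simp: "k \<in> half_set I \<pi> \<Longrightarrow> half_perm I \<pi> k = \<pi> k"
  by (simp add: half_perm_def perm_restrict_def)

lemma half_cycles: "cycles_on (half_set I \<pi>) (half_perm I \<pi>) = orbit \<pi> ` half_set I \<pi>"
  unfolding cycles_on_def
proof (rule image_cong[OF refl])
  fix k assume "k \<in> half_set I \<pi>"
  then show "orbit (half_perm I \<pi>) k = orbit \<pi> k"
    by (rule orbit_cong0) (auto simp: half_perm_simp half_set_image)
qed

text \<open>A cycle and its negative are different, and one of the two is particular. This is the
  origin of the halves in \<open>chi\<close>.\<close>

lemma num_cycles_half: "num_cycles (pm I) \<pi> = 2 * num_cycles (half_set I \<pi>) (half_perm I \<pi>)"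
proof -
  let ?H = "half_set I \<pi>"
  have split: "cycles_on (pm I) \<pi> = orbit \<pi> ` ?H \<union> image uminus ` (orbit \<pi> ` ?H)" (is "_ = ?A \<union> ?B")
  proof (intro equalityI subsetI)
    fix c assume "c \<in> cycles_on (pm I) \<pi>"
    then obtain k where k: "k \<in> pm I" "c = orbit \<pi> k" by (auto simp: cycles_on_def)
    show "c \<in> ?A \<union> ?B"
    proof (cases "k \<in> ?H")
      case False
      then have "- k \<in> ?H" using half_set_uminus k by simp
      moreover have "c = uminus ` orbit \<pi> (- k)"
        using premap_orbit_uminus[of "- k"] k by simp
      ultimately show ?thesis by blast
    qed (use k in auto)
  next
    fix c assume "c \<in> ?A \<union> ?B"
    then consider k where "k \<in> ?H" "c = orbit \<pi> k" | k where "k \<in> ?H" "c = uminus ` orbit \<pi> k" by blast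
    then show "c \<in> cycles_on (pm I) \<pi>"
    proof cases
      case 1 then show ?thesis using half_set_subset by (auto simp: cycles_on_def)
    next
      case 2
      then have "k \<in> pm I" using half_set_subset by blast
      then show ?thesis using 2 premap_orbit_uminus[of k] by (metis cycles_on_def imageI uminus_mem_pm)
    qed
  qed
  have "?A \<inter> ?B = {}"
  proof (intro equals0I)
    fix c assume "c \<in> ?A \<inter> ?B"
    then obtain k l where "k \<in> ?H" "c = orbit \<pi> k" "l \<in> ?H" "c = uminus ` orbit \<pi> l" by blast
    then show False
      using particular_uminus[of l] premap_orbit_uminus[of l] by (auto simp: mem_half_set)
  qed
  moreover have "inj_on (image uminus) ?A"
    by (intro inj_onI) (simp add: inj_image_eq_iff)
  ultimately have "card (cycles_on (pm I) \<pi>) = card ?A + card ?A"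
    unfolding split using finite_half_set by (subst card_Un_disjoint) (auto simp: card_image)
  then show ?thesis by (simp add: num_cycles_def half_cycles)
qed

end

end

section \<open>Pairings and their joins\<close>

lemma pairing_perm_eqI:
  assumes P: "P \<in> pairings_on A" and B: "{k, l} \<in> P" shows "pairing_perm P k = l"
proof -
  have "(THE j. {k, j} \<in> P) = l"
  proof (rule the_equality)
    show "{k, l} \<in> P" by (rule B)
    fix j assume j: "{k, j} \<in> P"
    have "disjoint P" using P by (simp add: pairings_on_def partition_on_def)
    then have "{k, j} = {k, l}"
      using j B unfolding disjoint_def by (metis (no_types) Int_iff empty_iff insertI1)
    then show "j = l" by (auto simp: doubleton_eq_iff)
  qed
  moreover have "k \<in> \<Union> P" using B by blast
  ultimately show ?thesis by (simp add: pairing_perm_def)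
qed

lemma pairing_perm_mem:
  assumes P: "P \<in> pairings_on A" and k: "k \<in> A"
  shows "{k, pairing_perm P k} \<in> P" "pairing_perm P k \<in> A" "pairing_perm P k \<noteq> k"
    "pairing_perm P (pairing_perm P k) = k"
proof -
  obtain B where B: "B \<in> P" "k \<in> B" using P k by (auto simp: pairings_on_def partition_on_def)
  have "card B = 2" using P B by (simp add: pairings_on_def)
  then obtain l where l: "B = {k, l}" "l \<noteq> k" using B(2) by (auto simp: card_2_iff)
  have "pairing_perm P k = l" using pairing_perm_eqI[OF P] B l by simp
  moreover have "pairing_perm P l = k" using pairing_perm_eqI[OF P, of l k] B l by (simp add: insert_commute)
  moreover have "l \<in> A" using P B l by (auto simp: pairings_on_def partition_on_def)
  ultimately show "{k, pairing_perm P k} \<in> P" "pairing_perm P k \<in> A" "pairing_perm P k \<noteq> k"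
    "pairing_perm P (pairing_perm P k) = k" using B l by auto
qed

lemma pairing_perm_outside: "P \<in> pairings_on A \<Longrightarrow> k \<notin> A \<Longrightarrow> pairing_perm P k = k"
  by (auto simp: pairing_perm_def pairings_on_def partition_on_def)

lemma pairing_block:
  assumes P: "P \<in> pairings_on A" and B: "B \<in> P"
  obtains k where "k \<in> A" "B = {k, pairing_perm P k}"
proof -
  have "card B = 2" using P B by (simp add: pairings_on_def)
  then obtain k l where "B = {k, l}" by (auto simp: card_2_iff)
  moreover have "k \<in> A" using P B calculation by (auto simp: pairings_on_def partition_on_def)
  ultimately show ?thesis using that pairing_perm_eqI[OF P] B by metis
qed

lemma pairing_perm_permutes: "P \<in> pairings_on A \<Longrightarrow> pairing_perm P permutes A"
  unfolding permutes_def using pairing_perm_mem pairing_perm_outside by metis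

lemma const_on_pairing_iff:
  assumes P: "P \<in> pairings_on A"
  shows "const_on P i \<longleftrightarrow> (\<forall>k\<in>A. i (pairing_perm P k) = i k)"
proof
  assume const: "const_on P i"
  show "\<forall>k\<in>A. i (pairing_perm P k) = i k"
  proof
    fix k assume "k \<in> A"
    from const pairing_perm_mem(1)[OF P this]
    have "\<forall>a\<in>{k, pairing_perm P k}. \<forall>b\<in>{k, pairing_perm P k}. i a = i b"
      unfolding const_on_def by (rule bspec)
    then show "i (pairing_perm P k) = i k" unfolding const_on_doubleton by (rule sym)
  qed
next
  assume *: "\<forall>k\<in>A. i (pairing_perm P k) = i k"
  show "const_on P i" unfolding const_on_def
  proof (intro ballI)
    fix B k l assume B: "B \<in> P" "k \<in> B" "l \<in> B"
    obtain m where "m \<in> A" "B = {m, pairing_perm P m}" using pairing_block[OF P B(1)] .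
    have "i m = i (pairing_perm P m)" using * \<open>m \<in> A\<close> by simp
    then have "\<forall>k\<in>B. \<forall>l\<in>B. i k = i l"
      unfolding \<open>B = {m, pairing_perm P m}\<close> const_on_doubleton .
    then show "i k = i l" using B by blast
  qed
qed

interpretation intv: signed_set "intv n" for n
  by unfold_locales auto

lemma pairings_eq: "pairings n = pairings_on (intv n)"
  by (simp add: pairings_def pairings_on_def)

lemma delta_permutes: "delta I permutes pm I"
proof (rule bij_imp_permutes)
  show "bij_betw (delta I) (pm I) (pm I)"
    by (rule bij_betw_byWitness[of _ "delta I"]) (auto simp: delta_def pm_def)
qed (simp add: delta_def)

section \<open>The alternating premap of two pairings and their join\<close>

context
  fixes n :: nat and P Q :: "int set set"
  assumes P: "P \<in> pairings_on (intv n)" and Q: "Q \<in> pairings_on (intv n)"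
begin

private abbreviation "\<alpha> \<equiv> pair_premap n P Q"

lemma pair_premap_pos: "k \<in> intv n \<Longrightarrow> \<alpha> k = - pairing_perm P k"
  using pairing_perm_mem(2)[OF P, of k] pairing_perm_outside[OF Q, of "- pairing_perm P k"]
  by (simp add: pair_premap_def intv.delta_simp intv.I_subset_pm)

lemma pair_premap_neg: "k \<in> intv n \<Longrightarrow> \<alpha> (- k) = pairing_perm Q k"
  using pairing_perm_outside[OF P, of "- k"]
  by (simp add: pair_premap_def intv.delta_simp intv.I_subset_pm)

lemma pair_premap_in_premaps: "\<alpha> \<in> premaps (intv n)"
  unfolding intv.premap_iff
proof (intro conjI ballI)
  have "intv n \<subseteq> pm (intv n)" by (auto simp: pm_def)
  then show "\<alpha> permutes pm (intv n)"
    unfolding pair_premap_def using P Q delta_permutes pairing_perm_permutes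
    by (intro permutes_compose) (blast intro: permutes_subset)+
  fix k assume k: "k \<in> pm (intv n)"
  show "\<alpha> (- \<alpha> k) = - k"
    using k by (cases rule: intv.pm_cases)
      (simp_all add: pair_premap_pos pair_premap_neg pairing_perm_mem[OF P] pairing_perm_mem[OF Q] del: atLeastAtMost_iff)
  show "\<alpha> k \<noteq> - k"
    using k by (cases rule: intv.pm_cases)
      (simp_all add: pair_premap_pos pair_premap_neg pairing_perm_mem[OF P] pairing_perm_mem[OF Q] del: atLeastAtMost_iff)
qed

lemma pair_premap_in_alt_premaps: "\<alpha> \<in> alt_premaps (intv n)"
  unfolding alt_premaps_def
proof (intro CollectI conjI ballI pair_premap_in_premaps)
  fix k assume k: "k \<in> pm (intv n)"
  then show "sgn (\<alpha> k) = - sgn k"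
  proof (cases rule: intv.pm_cases)
    case pos
    then show ?thesis using pairing_perm_mem(2)[OF P pos(1)] by (simp add: pair_premap_pos)
  next
    case (neg m)
    then show ?thesis using pairing_perm_mem(2)[OF Q neg(1)] by (simp add: pair_premap_neg)
  qed
qed

text \<open>\<open>\<alpha>\<close> applies the pairing \<open>P\<close> at positive and
  \<open>Q\<close> at negative elements and changes the sign each time, so forgetting signs turns
  its orbits into the blocks of the join.\<close>

definition join_block :: "int \<Rightarrow> int set" where
  "join_block k = abs ` orbit \<alpha> k"

private lemmas perm = intv.premap_permutes[OF pair_premap_in_premaps]
private lemmas uminus = intv.premap_orbit_uminus[OF pair_premap_in_premaps]

lemma join_block_uminus: "k \<in> pm (intv n) \<Longrightarrow> join_block (- k) = join_block k"
  by (simp add: join_block_def uminus image_image)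

lemma join_block_subset: "k \<in> pm (intv n) \<Longrightarrow> join_block k \<subseteq> intv n"
proof
  fix j assume "k \<in> pm (intv n)" "j \<in> join_block k"
  then obtain x where "x \<in> pm (intv n)" "j = \<bar>x\<bar>"
    using intv.orbit_subset_pm[OF perm] unfolding join_block_def by blast
  then show "j \<in> intv n" by (simp only: intv.mem_pm)
qed

lemma join_block_orbit: "x \<in> orbit \<alpha> k \<Longrightarrow> join_block x = join_block k"
  by (simp add: join_block_def intv.orbit_eq[OF perm])

lemma join_block_eq:
  assumes "k \<in> pm (intv n)" "j \<in> join_block k" shows "join_block j = join_block k"
proof -
  obtain x where x: "x \<in> orbit \<alpha> k" "j = \<bar>x\<bar>"
    using assms by (auto simp: join_block_def)
  have "x \<in> pm (intv n)" using x(1) intv.orbit_subset_pm[OF perm assms(1)] by blast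
  then have "join_block j = join_block x"
    using x(2) join_block_uminus by (cases "0 \<le> x") auto
  then show ?thesis using join_block_orbit[OF x(1)] by simp
qed

lemma join_block_mem:
  assumes k: "k \<in> intv n"
  shows "k \<in> join_block k" "pairing_perm P k \<in> join_block k" "pairing_perm Q k \<in> join_block k"
proof -
  have pos: "\<bar>k\<bar> = k" using k by simp
  have "\<bar>x\<bar> \<in> join_block k" if "x \<in> orbit \<alpha> k" for x
    using that by (simp add: join_block_def)
  from this[OF intv.self_in_orbit[OF perm]] show "k \<in> join_block k" using pos by simp
  show "pairing_perm P k \<in> join_block k"
    unfolding join_block_def
    using k pairing_perm_mem(2)[OF P k] orbit.base[of "\<alpha>" k]
    by (intro image_eqI[of _ _ "\<alpha> k"]) (auto simp: pair_premap_pos)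
  have "pairing_perm Q k \<in> join_block (- k)"
    unfolding join_block_def
    using k pairing_perm_mem(2)[OF Q k] orbit.base[of "\<alpha>" "- k"]
    by (intro image_eqI[of _ _ "\<alpha> (- k)"]) (auto simp: pair_premap_neg)
  then show "pairing_perm Q k \<in> join_block k"
    using k by (simp add: join_block_uminus intv.I_subset_pm)
qed

text \<open>A block holds nothing but what the two pairings generate from \<open>k\<close>. This
  minimality yields the least upper bound property and \<open>const_on_join\<close>.\<close>

lemma join_block_induct:
  assumes k: "k \<in> intv n" and j: "j \<in> join_block k" and "S k"
    and step: "\<And>j. j \<in> intv n \<Longrightarrow> S j \<Longrightarrow> S (pairing_perm P j) \<and> S (pairing_perm Q j)"
  shows "S j"
proof -
  have *: "S \<bar>\<alpha> y\<bar>" if "y \<in> pm (intv n)" "S \<bar>y\<bar>" for y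
    using that(1)
  proof (cases rule: intv.pm_cases)
    case pos
    then show ?thesis using step[OF pos(1)] that(2) pairing_perm_mem(2)[OF P pos(1)]
      by (simp add: pair_premap_pos)
  next
    case (neg m)
    then show ?thesis using step[OF neg(1)] that(2) pairing_perm_mem(2)[OF Q neg(1)]
      by (simp add: pair_premap_neg)
  qed
  obtain x where x: "x \<in> orbit \<alpha> k" and jx: "j = \<bar>x\<bar>"
    using j by (auto simp: join_block_def)
  from x have "x \<in> pm (intv n) \<and> S \<bar>x\<bar>"
  proof (induction rule: orbit.induct)
    case base
    show ?case using *[of k] k \<open>S k\<close> intv.I_subset_pm permutes_in_image[OF perm] by simp
  next
    case (step y)
    then show ?case using * permutes_in_image[OF perm] by simp
  qed
  then show ?thesis by (simp add: jx)
qed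

lemma partition_on_join_blocks: "partition_on (intv n) (join_block ` intv n)"
  unfolding partition_on_def
proof (intro conjI)
  show "\<Union> (join_block ` intv n) = intv n"
    using join_block_subset[OF intv.I_subset_pm] join_block_mem(1) by blast
  show "disjoint (join_block ` intv n)"
  proof (rule disjointI)
    fix A B assume "A \<in> join_block ` intv n" "B \<in> join_block ` intv n" "A \<noteq> B"
    then show "A \<inter> B = {}" using join_block_eq[OF intv.I_subset_pm] by blast
  qed
  show "{} \<notin> join_block ` intv n" using join_block_mem(1) by blast
qed

lemma partition_join_eq: "partition_join (intv n) P Q = join_block ` intv n"
proof -
  let ?R = "join_block ` intv n"
  have part: "partition_on (intv n) P" "partition_on (intv n) Q"
    using P Q by (auto simp: pairings_on_def)
  have sub: "\<exists>Y\<in>?R. X \<subseteq> Y" if "X \<in> P \<or> X \<in> Q" for X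
  proof -
    have ex: ?thesis if "k \<in> intv n" "X = {k, pairing_perm P k} \<or> X = {k, pairing_perm Q k}" for k
      using that join_block_mem[of k] by (intro bexI[of _ "join_block k"]) auto
    show ?thesis
    proof (cases "X \<in> P")
      case True
      obtain k where "k \<in> intv n" "X = {k, pairing_perm P k}" by (rule pairing_block[OF P True])
      then show ?thesis by (intro ex[of k]) simp_all
    next
      case False
      then have "X \<in> Q" using that by simp
      then obtain k where "k \<in> intv n" "X = {k, pairing_perm Q k}" by (rule pairing_block[OF Q])
      then show ?thesis by (intro ex[of k]) simp_all
    qed
  qed
  have ub: "refines (intv n) P ?R" "refines (intv n) Q ?R"
    using part sub partition_on_join_blocks by (auto simp: refines_def)
  have lub: "refines (intv n) ?R T" if T: "refines (intv n) P T" "refines (intv n) Q T" for T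
    unfolding refines_def
  proof (intro conjI ballI partition_on_join_blocks)
    show partT: "partition_on (intv n) T" using T by (simp add: refines_def)
    fix X assume "X \<in> ?R"
    then obtain k where k: "k \<in> intv n" "X = join_block k" by blast
    have "k \<in> \<Union> T" using partT k(1) by (simp only: partition_on_def)
    then obtain Y where Y: "Y \<in> T" "k \<in> Y" by blast
    have closed: "l \<in> Y" if j: "j \<in> Y" "{j, l} \<in> P \<or> {j, l} \<in> Q" for j l
    proof -
      obtain Y' where Y': "Y' \<in> T" "{j, l} \<subseteq> Y'" using j(2) T unfolding refines_def by blast
      then have "Y' = Y" using partT Y(1) j(1) by (auto simp: partition_on_def disjoint_def)
      then show ?thesis using Y' by simp
    qed
    have "X \<subseteq> Y"
    proof
      fix j assume "j \<in> X"
      then have "j \<in> join_block k" using k by simp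
      then show "j \<in> Y"
        using k(1) Y(2) closed pairing_perm_mem(1)[OF P] pairing_perm_mem(1)[OF Q]
        by (intro join_block_induct[of k j "\<lambda>j. j \<in> Y"]) blast+
    qed
    then show "\<exists>Y\<in>T. X \<subseteq> Y" using Y by blast
  qed
  show ?thesis unfolding partition_join_def
  proof (rule the_equality)
    show "refines (intv n) P ?R \<and> refines (intv n) Q ?R \<and>
      (\<forall>S. refines (intv n) P S \<and> refines (intv n) Q S \<longrightarrow> refines (intv n) ?R S)"
      using ub lub by blast
    fix R assume R: "refines (intv n) P R \<and> refines (intv n) Q R \<and>
      (\<forall>S. refines (intv n) P S \<and> refines (intv n) Q S \<longrightarrow> refines (intv n) R S)"
    show "R = ?R"
    proof (rule refines_asym)
      show "refines (intv n) R ?R" using R ub by blast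
      show "refines (intv n) ?R R" using R by (intro lub) auto
    qed
  qed
qed

lemma const_on_join: "const_on (join_block ` intv n) l \<longleftrightarrow> const_on P l \<and> const_on Q l"
proof
  assume *: "const_on (join_block ` intv n) l"
  have eq: "l j = l k" if "k \<in> intv n" "j \<in> join_block k" for j k
  proof -
    have "\<forall>a\<in>join_block k. \<forall>b\<in>join_block k. l a = l b"
      using * that(1) unfolding const_on_def by (rule bspec[OF _ imageI])
    then show ?thesis using that(2) join_block_mem(1)[OF that(1)] by blast
  qed
  show "const_on P l \<and> const_on Q l"
    unfolding const_on_pairing_iff[OF P] const_on_pairing_iff[OF Q]
    using eq join_block_mem(2,3) by (intro conjI ballI) auto
next
  assume *: "const_on P l \<and> const_on Q l"
  have **: "l j = l k" if "k \<in> intv n" "j \<in> join_block k" for j k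
    by (rule join_block_induct[OF that])
       (use * in \<open>auto simp: const_on_pairing_iff[OF P] const_on_pairing_iff[OF Q]\<close>)
  show "const_on (join_block ` intv n) l"
    unfolding const_on_def
  proof (intro ballI)
    fix B j k assume "B \<in> join_block ` intv n" "j \<in> B" "k \<in> B"
    then obtain m where "m \<in> intv n" "j \<in> join_block m" "k \<in> join_block m" by blast
    then show "l j = l k" using **[of m j] **[of m k] by simp
  qed
qed

text \<open>Both sides count the index functions that are constant on the join, with a free index
  for each block. Hence \<open>gram\<close> is the Gram matrix of the pairing tensors.\<close>

lemma gram_eq_sum:
  "gram CARD('d) n P Q =
    (\<Sum>l\<in>(indices (intv n) :: (int \<Rightarrow> 'd::finite) set). of_bool (const_on P l) * of_bool (const_on Q l))"
proof -
  have "(\<Sum>l\<in>(indices (intv n) :: (int \<Rightarrow> 'd) set). of_bool (const_on P l) * of_bool (const_on Q l))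
      = (\<Prod>B\<in>join_block ` intv n. \<Sum>a\<in>(UNIV :: 'd set). \<Prod>k\<in>B. 1 :: real)"
    unfolding sum_const_on_partition[OF intv.finite_I partition_on_join_blocks, symmetric]
      const_on_join of_bool_conj by simp
  then show ?thesis by (simp add: gram_def partition_join_eq)
qed

text \<open>A cycle and its negative have the same absolute values, and exactly one of them is
  particular.\<close>

private lemma abs_bij:
  "bij_betw ((`) abs) (orbit \<alpha> ` half_set (intv n) \<alpha>) (join_block ` intv n)"
proof (rule bij_betw_imageI)
  let ?H = "half_set (intv n) \<alpha>"
  note prem = pair_premap_in_premaps
  show "inj_on ((`) abs) (orbit \<alpha> ` ?H)"
  proof (rule inj_onI)
    fix c d assume "c \<in> orbit \<alpha> ` ?H" "d \<in> orbit \<alpha> ` ?H" and eq: "abs ` c = abs ` d"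
    then obtain k l where k: "k \<in> ?H" "c = orbit \<alpha> k" and l: "l \<in> ?H" "d = orbit \<alpha> l" by blast
    have "\<bar>k\<bar> \<in> abs ` d" using eq k intv.self_in_orbit[OF perm] by blast
    then obtain x where x: "x \<in> d" "\<bar>k\<bar> = \<bar>x\<bar>" by auto
    have d: "orbit \<alpha> x = d" using x(1) l intv.orbit_eq[OF perm] by simp
    have "x \<in> ?H"
    proof -
      have "x \<in> pm (intv n)"
        using x(1) l intv.orbit_subset_pm[OF perm] intv.half_set_subset[OF prem] by blast
      then show ?thesis using l d unfolding intv.mem_half_set[OF prem] by simp
    qed
    have "x \<noteq> - k"
      using k(1) \<open>x \<in> ?H\<close> intv.half_set_uminus[OF prem] intv.half_set_subset[OF prem] by blast
    then have "x = k" using x(2) by arith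
    then show "c = d" using d k by simp
  qed
  show "(`) abs ` (orbit \<alpha> ` ?H) = join_block ` intv n"
  proof (intro equalityI subsetI)
    fix B assume "B \<in> (`) abs ` (orbit \<alpha> ` ?H)"
    then obtain k where k: "k \<in> ?H" "B = join_block k" by (auto simp: join_block_def)
    have "k \<in> pm (intv n)" using k intv.half_set_subset[OF prem] by blast
    then show "B \<in> join_block ` intv n"
      by (cases rule: intv.pm_cases) (use k in \<open>auto simp: join_block_uminus intv.I_subset_pm simp del: atLeastAtMost_iff\<close>)
  next
    fix B assume "B \<in> join_block ` intv n"
    then obtain k where k: "k \<in> intv n" "B = join_block k" by blast
    then have "k \<in> pm (intv n)" by (simp add: intv.I_subset_pm)
    then have "k \<in> ?H \<or> - k \<in> ?H" "B = join_block (- k)"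
      using intv.half_set_uminus[OF prem] join_block_uminus k by auto
    then show "B \<in> (`) abs ` (orbit \<alpha> ` ?H)"
      using k(2) unfolding join_block_def by blast
  qed
qed

lemma num_cycles_pair_premap:
  "num_cycles (pm (intv n)) \<alpha> = 2 * card (partition_join (intv n) P Q)"
  unfolding intv.num_cycles_half[OF pair_premap_in_premaps]
  unfolding num_cycles_def
    intv.half_cycles[OF pair_premap_in_premaps] partition_join_eq bij_betw_same_card[OF abs_bij] ..

text \<open>The absolute value is injective on every cycle, so a particular cycle and its block have
  the same size.\<close>

lemma young_pair_premap:
  "young (intv n) \<alpha> = half_diagram (partition_join (intv n) P Q)"
proof -
  let ?C = "orbit \<alpha> ` half_set (intv n) \<alpha>"
  have card_abs: "card (abs ` c) = card c" if "c \<in> ?C" for c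
  proof -
    from that obtain k where "k \<in> half_set (intv n) \<alpha>" and c: "c = orbit \<alpha> k" by blast
    then have "k \<in> pm (intv n)" using intv.half_set_subset[OF pair_premap_in_premaps] by blast
    then show ?thesis
      unfolding c by (intro card_image intv.premap_inj_abs[OF pair_premap_in_premaps])
  qed
  have "half_diagram (partition_join (intv n) P Q)
      = image_mset (\<lambda>c. card c div 2) (mset_set ((`) abs ` ?C))"
    using abs_bij by (simp add: half_diagram_def partition_join_eq bij_betw_def)
  also have "mset_set ((`) abs ` ?C) = image_mset ((`) abs) (mset_set ?C)"
    using abs_bij by (simp add: image_mset_mset_set bij_betw_def)
  also have "image_mset (\<lambda>c. card c div 2) (image_mset ((`) abs) (mset_set ?C))
      = image_mset (\<lambda>c. card c div 2) (mset_set ?C)"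
    unfolding multiset.map_comp
    by (intro image_mset_cong) (use intv.finite_half_set[OF pair_premap_in_premaps] card_abs in auto)
  finally show ?thesis
    by (simp add: young_def half_diagram_def intv.half_cycles[OF pair_premap_in_premaps])
qed

end

section \<open>Traces as sums over index functions\<close>

lemma sum_indices_insert:
  fixes F :: "('k \<Rightarrow> 'd::finite) \<Rightarrow> 'a::comm_monoid_add"
  assumes "k \<notin> K"
  shows "(\<Sum>i\<in>indices (insert k K). F i) = (\<Sum>c\<in>UNIV. \<Sum>j\<in>indices K. F (j(k := c)))"
proof -
  have "(\<Sum>i\<in>indices (insert k K). F i) = (\<Sum>(c, j)\<in>UNIV \<times> indices K. F (j(k := c)))"
    using sum.reindex[OF inj_combinator[OF assms, of "\<lambda>_. UNIV"], of F]
    by (simp add: PiE_insert_eq o_def case_prod_unfold)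
  then show ?thesis by (simp add: sum.cartesian_product)
qed

lemma sum_indices_Un:
  fixes f g :: "('k \<Rightarrow> 'd::finite) \<Rightarrow> 'a::comm_semiring_0"
  assumes "A \<inter> B = {}"
  shows "(\<Sum>i\<in>indices (A \<union> B). f (restrict i A) * g (restrict i B))
    = (\<Sum>i\<in>indices A. f i) * (\<Sum>i\<in>indices B. g i)"
proof -
  have "(\<Sum>i\<in>indices (A \<union> B). f (restrict i A) * g (restrict i B))
      = (\<Sum>(i, j)\<in>indices A \<times> indices B. f i * g j)"
  proof (rule sum.reindex_bij_witness[where
        i = "\<lambda>(i, j). \<lambda>k\<in>A \<union> B. if k \<in> A then i k else j k" and j = "\<lambda>i. (restrict i A, restrict i B)"], goal_cases)
    case (1 i) then show ?case by (auto simp: fun_eq_iff PiE_def extensional_def)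
  next
    case (2 i) then show ?case by auto
  next
    case (3 p)
    then show ?case using assms by (auto simp: fun_eq_iff PiE_def extensional_def split: prod.splits)
  next
    case (4 p) then show ?case by auto
  next
    case (5 i) then show ?case by auto
  qed
  then show ?thesis by (simp add: sum_product sum.cartesian_product)
qed

lemma prod_sum_indices_disjoint:
  fixes F :: "'k set \<Rightarrow> ('k \<Rightarrow> 'd::finite) \<Rightarrow> 'a::comm_semiring_1"
  assumes "finite C" "disjoint C" and F: "\<And>c i. c \<in> C \<Longrightarrow> F c (restrict i c) = F c i"
  shows "(\<Prod>c\<in>C. \<Sum>i\<in>indices c. F c i) = (\<Sum>i\<in>indices (\<Union>C). \<Prod>c\<in>C. F c i)"
  using assms
proof (induction C rule: finite_induct)
  case empty show ?case by simp
next
  case (insert c C)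
  have disj: "c \<inter> \<Union>C = {}" using insert.prems insert.hyps by (auto simp: disjoint_def)
  have IH: "(\<Prod>c\<in>C. \<Sum>i\<in>indices c. F c i) = (\<Sum>i\<in>indices (\<Union>C). \<Prod>c\<in>C. F c i)"
    using insert.prems by (intro insert.IH) (auto simp: disjoint_def)
  have rest: "(\<Prod>d\<in>C. F d (restrict i (\<Union>C))) = (\<Prod>d\<in>C. F d i)" for i
  proof (rule prod.cong[OF refl])
    fix d assume d: "d \<in> C"
    then have "restrict (restrict i (\<Union>C)) d = restrict i d" by (auto simp: fun_eq_iff)
    then show "F d (restrict i (\<Union>C)) = F d i"
      using insert.prems(2)[of d] d by (metis insertI2)
  qed
  have Fc: "F c (restrict i c) = F c i" for i by (rule insert.prems(2)) simp
  have "(\<Prod>c\<in>insert c C. \<Sum>i\<in>indices c. F c i)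
      = (\<Sum>i\<in>indices c. F c i) * (\<Sum>i\<in>indices (\<Union>C). \<Prod>c\<in>C. F c i)"
    using insert.hyps by (simp add: IH)
  also have "\<dots> = (\<Sum>i\<in>indices (c \<union> \<Union>C). F c (restrict i c) * (\<Prod>d\<in>C. F d (restrict i (\<Union>C))))"
    by (rule sum_indices_Un[OF disj, symmetric])
  also have "\<dots> = (\<Sum>i\<in>indices (\<Union>(insert c C)). \<Prod>c\<in>insert c C. F c i)"
    using insert.hyps by (simp add: rest Fc)
  finally show ?case .
qed

text \<open>The contribution of one index function to an entry of a matrix product. The last column
  index \<open>b\<close> stays free; setting it to the first row index closes the path to a
  cycle.\<close>

fun path_prod :: "('k \<Rightarrow> 'a::comm_semiring_1^'d^'d) \<Rightarrow> 'k list \<Rightarrow> ('k \<Rightarrow> 'd) \<Rightarrow> 'd \<Rightarrow> 'a" where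
  "path_prod Y [] i b = 1"
| "path_prod Y [k] i b = Y k $ i k $ b"
| "path_prod Y (k # k' # ks) i b = Y k $ i k $ i k' * path_prod Y (k' # ks) i b"

lemma path_prod_cong:
  "(\<And>k. k \<in> set ks \<Longrightarrow> i k = i' k) \<Longrightarrow> path_prod Y ks i b = path_prod Y ks i' b"
  by (induction Y ks i b rule: path_prod.induct) auto

lemma path_prod_nth:
  "path_prod Y ks i b = (\<Prod>t<length ks. Y (ks ! t) $ i (ks ! t) $
     (if Suc t < length ks then i (ks ! Suc t) else b))"
proof (induction Y ks i b rule: path_prod.induct)
  case (3 Y k k' ks i b)
  then show ?case
    by (simp only: length_Cons prod.lessThan_Suc_shift path_prod.simps) (simp cong: if_cong)
qed auto

text \<open>Every matrix in the list carries its row index as a value of \<open>i\<close>; the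
  indicator pins the first one to \<open>a\<close>, so that the sum can run over all index functions
  on the list.\<close>

lemma mat_prod_list_entry:
  fixes Y :: "'k \<Rightarrow> complex^'d::finite^'d"
  assumes "distinct (k # ks)"
  shows "mat_prod_list (map Y (k # ks)) $ a $ b
    = (\<Sum>i\<in>indices (set (k # ks)). of_bool (i k = a) * path_prod Y (k # ks) i b)"
  using assms
proof (induction ks arbitrary: k a)
  case Nil
  show ?case
    by (simp add: mat_prod_list_def sum_indices_insert if_distrib[of "\<lambda>x. x * _"] of_bool_def cong: if_cong)
next
  case (Cons k' ks)
  have "mat_prod_list (map Y (k # k' # ks)) $ a $ b
      = (\<Sum>c\<in>UNIV. Y k $ a $ c * mat_prod_list (map Y (k' # ks)) $ c $ b)"
    by (simp add: mat_prod_list_def matrix_matrix_mult_def)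
  also have "\<dots> = (\<Sum>c\<in>UNIV. \<Sum>j\<in>indices (set (k' # ks)). Y k $ a $ c * (of_bool (j k' = c) * path_prod Y (k' # ks) j b))"
    unfolding sum_distrib_left[symmetric]
    using Cons.prems by (intro sum.cong refl arg_cong2[of _ _ _ _ "(*)"] Cons.IH) auto
  also have "\<dots> = (\<Sum>j\<in>indices (set (k' # ks)). \<Sum>c\<in>UNIV. if j k' = c then Y k $ a $ c * path_prod Y (k' # ks) j b else 0)"
    by (subst sum.swap) (intro sum.cong refl, simp)
  also have "\<dots> = (\<Sum>j\<in>indices (set (k' # ks)). Y k $ a $ j k' * path_prod Y (k' # ks) j b)"
    by simp
  also have "\<dots> = (\<Sum>j\<in>indices (set (k' # ks)). path_prod Y (k # k' # ks) (j(k := a)) b)"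
  proof (rule sum.cong[OF refl])
    fix j
    have "path_prod Y (k' # ks) (j(k := a)) b = path_prod Y (k' # ks) j b"
      using Cons.prems by (intro path_prod_cong) auto
    then show "Y k $ a $ j k' * path_prod Y (k' # ks) j b = path_prod Y (k # k' # ks) (j(k := a)) b"
      using Cons.prems by auto
  qed
  also have "\<dots> = (\<Sum>c\<in>UNIV. if c = a then \<Sum>j\<in>indices (set (k' # ks)). path_prod Y (k # k' # ks) (j(k := c)) b else 0)"
    by simp
  also have "\<dots> = (\<Sum>c\<in>UNIV. \<Sum>j\<in>indices (set (k' # ks)). of_bool ((j(k := c)) k = a) * path_prod Y (k # k' # ks) (j(k := c)) b)"
    by (intro sum.cong refl) (simp del: path_prod.simps)
  also have "\<dots> = (\<Sum>i\<in>indices (set (k # k' # ks)). of_bool (i k = a) * path_prod Y (k # k' # ks) i b)"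
    using Cons.prems
    by (simp only: list.set(2)[of k] distinct.simps sum_indices_insert[of k "set (k' # ks)"] simp_thms)
  finally show ?case .
qed

lemma trace_support:
  fixes Y :: "int \<Rightarrow> complex^'d::finite^'d"
  assumes "permutation \<pi>"
  shows "trace (mat_prod_list (map Y (support \<pi> k)))
    = (\<Sum>i\<in>indices (orbit \<pi> k). \<Prod>m\<in>orbit \<pi> k. Y m $ i m $ i (\<pi> m))"
proof -
  let ?L = "least_power \<pi> k"
  define ks where "ks = support \<pi> k"
  have L: "0 < ?L" "(\<pi> ^^ ?L) k = k" using least_power_of_permutation[OF assms] by auto
  have nth: "t < ?L \<Longrightarrow> ks ! t = (\<pi> ^^ t) k" and len: "length ks = ?L" for t
    by (simp_all add: ks_def)
  obtain ks' where ks': "ks = k # ks'"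
    using nth[of 0] len L(1) by (cases ks) auto
  have dist: "distinct ks" unfolding ks_def using cycle_of_permutation[OF assms] .
  have set: "set ks = orbit \<pi> k"
    unfolding ks_def support_set[OF assms] orbit_altdef_permutation[OF assms] by auto
  have "trace (mat_prod_list (map Y ks)) = (\<Sum>a\<in>UNIV. \<Sum>i\<in>indices (orbit \<pi> k). of_bool (i k = a) * path_prod Y ks i a)"
    unfolding trace_def set[symmetric] using dist unfolding ks' by (intro sum.cong refl mat_prod_list_entry)
  also have "\<dots> = (\<Sum>i\<in>indices (orbit \<pi> k). \<Sum>a\<in>UNIV. if i k = a then path_prod Y ks i a else 0)"
    by (subst sum.swap) (intro sum.cong refl, simp)
  also have "\<dots> = (\<Sum>i\<in>indices (orbit \<pi> k). path_prod Y ks i (i k))" by simp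
  also have "\<dots> = (\<Sum>i\<in>indices (orbit \<pi> k). \<Prod>m\<in>orbit \<pi> k. Y m $ i m $ i (\<pi> m))"
  proof (rule sum.cong[OF refl])
    fix i :: "int \<Rightarrow> 'd"
    have "path_prod Y ks i (i k) = (\<Prod>t<?L. Y (ks ! t) $ i (ks ! t) $ i (\<pi> (ks ! t)))"
      unfolding path_prod_nth len
    proof (intro prod.cong refl)
      fix t assume "t \<in> {..<?L}"
      then have t: "t < ?L" by simp
      \<comment> \<open>The last factor closes the cycle: its column index \<open>i k\<close> is the
        value of \<open>i\<close> at the power \<open>?L\<close> of \<open>\<pi>\<close> applied to
        \<open>k\<close>.\<close>
      have "(if Suc t < ?L then i (ks ! Suc t) else i k) = i ((\<pi> ^^ Suc t) k)"
      proof (cases "Suc t < ?L")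
        case False
        then have "Suc t = ?L" using t by simp
        then show ?thesis using L by simp
      qed (simp add: nth)
      then show "Y (ks ! t) $ i (ks ! t) $ (if Suc t < ?L then i (ks ! Suc t) else i k)
          = Y (ks ! t) $ i (ks ! t) $ i (\<pi> (ks ! t))"
        using nth[OF t] by simp
    qed
    also have "\<dots> = (\<Prod>m\<in>set ks. Y m $ i m $ i (\<pi> m))"
      by (rule prod.reindex_bij_betw) (use dist len in \<open>auto intro: bij_betw_nth\<close>)
    finally show "path_prod Y ks i (i k) = (\<Prod>m\<in>orbit \<pi> k. Y m $ i m $ i (\<pi> m))"
      by (simp add: set)
  qed
  finally show ?thesis by (simp add: ks_def)
qed

lemma tr_perm_eq_sum:
  fixes X :: "int \<Rightarrow> complex^'d::finite^'d"
  assumes A: "finite A" and \<pi>: "\<pi> permutes A"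
  shows "of_nat CARD('d) ^ num_cycles A \<pi> * tr_perm A \<pi> X
    = (\<Sum>i\<in>indices A. \<Prod>k\<in>A. signed_mat X k $ i k $ i (\<pi> k))"
proof -
  have perm: "permutation \<pi>" using A \<pi> by (auto simp: permutation_permutes)
  let ?C = "cycles_on A \<pi>"
  define F where "F c i = (\<Prod>m\<in>c. signed_mat X m $ i m $ i (\<pi> m))" for c and i :: "int \<Rightarrow> 'd"
  have finC: "finite ?C" using A by (simp add: cycles_on_def)
  have self: "x \<in> orbit \<pi> x" for x by (rule permutation_self_in_orbit[OF perm])
  have orbit_eq: "orbit \<pi> x = orbit \<pi> y" if "x \<in> orbit \<pi> y" for x y
    using cyclic_on_orbit'[OF perm, of y] that by (rule orbit_cyclic_eq3)
  have sub: "c \<subseteq> A" if "c \<in> ?C" for c using that permutes_orbit_subset[OF \<pi>] by (auto simp: cycles_on_def)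
  have UC: "\<Union>?C = A" using sub self by (auto simp: cycles_on_def)
  have disj: "disjoint ?C"
  proof (rule disjointI)
    fix c d assume "c \<in> ?C" "d \<in> ?C" "c \<noteq> d"
    then obtain x y where "c = orbit \<pi> x" "d = orbit \<pi> y" by (auto simp: cycles_on_def)
    then show "c \<inter> d = {}" using orbit_eq \<open>c \<noteq> d\<close> by blast
  qed
  have orb: "orbit \<pi> (Min c) = c" if c: "c \<in> ?C" for c
  proof -
    obtain x where x: "c = orbit \<pi> x" using c by (auto simp: cycles_on_def)
    have "Min c \<in> c" using sub[OF c] A orbit_nonempty[of \<pi> x] x by (intro Min_in) (auto intro: finite_subset)
    then show ?thesis using orbit_eq x by simp
  qed
  have "tr_perm A \<pi> X = (\<Prod>c\<in>?C. (\<Sum>i\<in>indices c. F c i) / of_nat CARD('d))"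
    unfolding tr_perm_def ntr_def F_def
    by (intro prod.cong refl) (simp only: trace_support[OF perm] orb)
  also have "\<dots> = (\<Prod>c\<in>?C. \<Sum>i\<in>indices c. F c i) / of_nat CARD('d) ^ card ?C"
    by (simp add: prod_dividef)
  also have "(\<Prod>c\<in>?C. \<Sum>i\<in>indices c. F c i) = (\<Sum>i\<in>indices (\<Union>?C). \<Prod>c\<in>?C. F c i)"
  proof (rule prod_sum_indices_disjoint[OF finC disj])
    fix c i assume "c \<in> ?C"
    then obtain x where "c = orbit \<pi> x" by (auto simp: cycles_on_def)
    then show "F c (restrict i c) = F c i" unfolding F_def
      by (intro prod.cong refl) (simp add: orbit.step)
  qed
  also have "\<dots> = (\<Sum>i\<in>indices A. \<Prod>k\<in>A. signed_mat X k $ i k $ i (\<pi> k))"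
    unfolding UC
  proof (rule sum.cong[OF refl])
    fix i :: "int \<Rightarrow> 'd"
    have "(\<Prod>k\<in>\<Union>?C. signed_mat X k $ i k $ i (\<pi> k)) = (\<Prod>c\<in>?C. F c i)"
      unfolding F_def using disj sub A
      by (subst prod.Union_disjoint) (auto simp: disjoint_def dest: finite_subset[OF sub])
    then show "(\<Prod>c\<in>?C. F c i) = (\<Prod>k\<in>A. signed_mat X k $ i k $ i (\<pi> k))" by (simp add: UC)
  qed
  finally show ?thesis by (simp add: num_cycles_def)
qed

section \<open>Index sums constrained by a premap\<close>

context signed_set
begin

text \<open>The constraint expresses the values of \<open>r\<close> outside \<open>half_set I \<kappa>\<close> by those inside.\<close>

lemma sum_premap_constraint:
  fixes X :: "int \<Rightarrow> complex^'d::finite^'d"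
  assumes \<kappa>: "\<kappa> \<in> premaps I"
  shows "(\<Sum>r\<in>indices (pm I). of_bool (\<forall>k\<in>pm I. r (\<kappa> k) = r (- k)) * (\<Prod>k\<in>I. X k $ r k $ r (- k)))
    = of_nat CARD('d) ^ num_cycles (half_set I \<kappa>) (half_perm I \<kappa>) * tr_half I \<kappa> X"
proof -
  let ?H = "half_set I \<kappa>"
  note H = half_set_uminus[OF \<kappa>] half_set_image[OF \<kappa>]
  have sub: "k \<in> ?H \<Longrightarrow> k \<in> pm I" for k using half_set_subset[OF \<kappa>] by blast
  have bij: "bij_betw abs ?H I"
  proof (rule bij_betw_imageI)
    show "inj_on abs ?H"
    proof (rule inj_onI)
      fix x y :: int assume xy: "x \<in> ?H" "y \<in> ?H" "\<bar>x\<bar> = \<bar>y\<bar>"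
      then have "y \<noteq> - x" using H(1)[of x] sub by blast
      with xy show "x = y" by arith
    qed
    show "abs ` ?H = I"
    proof (intro equalityI subsetI)
      fix k assume "k \<in> abs ` ?H" then show "k \<in> I" using sub mem_pm by auto
    next
      fix k assume k: "k \<in> I"
      have "k \<in> ?H \<or> - k \<in> ?H" using H(1)[OF I_subset_pm[OF k]] by blast
      moreover have "\<bar>k\<bar> = k" "\<bar>- k\<bar> = k" using pos_I[OF k] by auto
      ultimately show "k \<in> abs ` ?H" by (metis imageI)
    qed
  qed
  \<comment> \<open>\<open>half_set\<close> contains exactly one of \<open>k\<close> and
    \<open>- k\<close>; for a negative representative \<open>signed_mat\<close> transposes, which
    exchanges the two indices.\<close>
  have prod_H: "(\<Prod>k\<in>I. X k $ r k $ r (- k)) = (\<Prod>k\<in>?H. signed_mat X k $ r k $ r (- k))" for r :: "int \<Rightarrow> 'd"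
  proof -
    have "(\<Prod>k\<in>I. X k $ r k $ r (- k)) = (\<Prod>k\<in>?H. X \<bar>k\<bar> $ r \<bar>k\<bar> $ r (- \<bar>k\<bar>))"
      by (rule prod.reindex_bij_betw[OF bij, symmetric])
    also have "\<dots> = (\<Prod>k\<in>?H. signed_mat X k $ r k $ r (- k))"
      by (intro prod.cong refl) (auto simp: signed_mat_def transpose_def abs_if sub pm_nonzero not_less dest: sub pm_nonzero)
    finally show ?thesis .
  qed
  define G where "G s = (\<Prod>k\<in>?H. signed_mat X k $ s k $ s (\<kappa> k))" for s :: "int \<Rightarrow> 'd"
  have "(\<Sum>r\<in>indices (pm I). of_bool (\<forall>k\<in>pm I. r (\<kappa> k) = r (- k)) * (\<Prod>k\<in>I. X k $ r k $ r (- k)))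
      = (\<Sum>r\<in>{r\<in>indices (pm I). \<forall>k\<in>pm I. r (\<kappa> k) = r (- k)}. \<Prod>k\<in>I. X k $ r k $ r (- k))"
    using finite_pm by (intro sum.mono_neutral_cong_right) auto
  also have "\<dots> = (\<Sum>s\<in>indices ?H. G s)"
  proof (rule sum.reindex_bij_witness[where i = "\<lambda>s. \<lambda>k\<in>pm I. if k \<in> ?H then s k else s (\<kappa> (- k))"
        and j = "\<lambda>r. restrict r ?H"], goal_cases)
    case (1 r)
    show ?case
    proof
      fix k
      show "(\<lambda>k\<in>pm I. if k \<in> ?H then restrict r ?H k else restrict r ?H (\<kappa> (- k))) k = r k"
      proof (cases "k \<in> pm I")
        case True
        then have "r (\<kappa> (- k)) = r (- (- k))" using 1 uminus_mem_pm by blast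
        then show ?thesis using True H by simp
      next
        case False then show ?thesis using 1 by (auto simp: PiE_def extensional_def)
      qed
    qed
  next
    case (2 r) then show ?case by simp
  next
    case (3 s)
    show ?case
    proof
      fix k
      show "restrict (\<lambda>k\<in>pm I. if k \<in> ?H then s k else s (\<kappa> (- k))) ?H k = s k"
        using 3 sub[of k] by (cases "k \<in> ?H") (auto simp: PiE_def extensional_def)
    qed
  next
    case (4 s)
    let ?r = "\<lambda>k\<in>pm I. if k \<in> ?H then s k else s (\<kappa> (- k))"
    have "?r (\<kappa> k) = ?r (- k)" if k: "k \<in> pm I" for k
      using k H premap_neg[OF \<kappa> k] permutes_in_image[OF premap_permutes[OF \<kappa>]] by simp
    then show ?case by simp
  next
    case (5 r)
    then have "(\<Prod>k\<in>I. X k $ r k $ r (- k)) = (\<Prod>k\<in>?H. signed_mat X k $ r k $ r (\<kappa> k))"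
      unfolding prod_H by (intro prod.cong refl) (simp add: sub)
    then show ?case unfolding G_def using H by (simp cong: prod.cong)
  qed
  also have "\<dots> = (\<Sum>s\<in>indices ?H. \<Prod>k\<in>?H. signed_mat X k $ s k $ s (half_perm I \<kappa> k))"
    unfolding G_def by (intro sum.cong prod.cong refl) (simp add: half_perm_simp[OF \<kappa>])
  also have "\<dots> = of_nat CARD('d) ^ num_cycles ?H (half_perm I \<kappa>) * tr_half I \<kappa> X"
    unfolding tr_half_def
    by (rule tr_perm_eq_sum[OF finite_half_set[OF \<kappa>] half_perm_permutes[OF \<kappa>], symmetric])
  finally show ?thesis .
qed

end

section \<open>Premaps in the genus expansion\<close>

context signed_set
begin

lemma orbit_conjugate:
  assumes \<pi>: "\<pi> permutes pm I" and s: "\<And>k. s (s k) = k"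
  shows "orbit (s \<circ> \<pi> \<circ> s) (s k) = s ` orbit \<pi> k"
  by (rule orbit_inverse[symmetric]) (simp_all add: s self_in_orbit[OF \<pi>])

lemma num_cycles_conjugate:
  assumes \<pi>: "\<pi> permutes pm I" and s: "\<And>k. s (s k) = k" "\<And>k. s k \<in> pm I \<longleftrightarrow> k \<in> pm I"
  shows "num_cycles (pm I) (s \<circ> \<pi> \<circ> s) = num_cycles (pm I) \<pi>"
proof -
  have "s ` pm I = pm I" using s by (metis image_eqI subsetI subset_antisym image_subsetI)
  then have "cycles_on (pm I) (s \<circ> \<pi> \<circ> s) = (\<lambda>k. orbit (s \<circ> \<pi> \<circ> s) (s k)) ` pm I"
    unfolding cycles_on_def by (metis image_image)
  also have "\<dots> = (`) s ` cycles_on (pm I) \<pi>"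
    by (simp add: orbit_conjugate[OF \<pi> s(1)] cycles_on_def image_image)
  finally have "cycles_on (pm I) (s \<circ> \<pi> \<circ> s) = (`) s ` cycles_on (pm I) \<pi>" .
  moreover have "inj s" using s(1) by (metis injI)
  then have "inj_on ((`) s) (cycles_on (pm I) \<pi>)" by (simp add: inj_on_def inj_image_eq_iff)
  ultimately show ?thesis by (simp add: num_cycles_def card_image)
qed

section \<open>The premaps built from a permutation of \<open>I\<close>\<close>

context
  fixes \<phi> assumes \<phi>: "\<phi> permutes I"
begin

abbreviation "\<phi>m \<equiv> minus_perm I \<phi>"

lemma phi_permutes_pm: "\<phi> permutes pm I"
  by (rule permutes_subset[OF \<phi>]) (auto simp: pm_def)

lemma phi_outside: "k \<in> I \<Longrightarrow> \<phi> (- k) = - k"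
  using uminus_notin_I permutes_not_in[OF \<phi>] by blast

lemma phi_in: "k \<in> I \<Longrightarrow> \<phi> k \<in> I"
  using permutes_in_image[OF \<phi>] by simp

lemma minus_perm_permutes: "\<phi>m permutes pm I"
  unfolding minus_perm_def by (intro permutes_compose delta_permutes phi_permutes_pm)

lemma minus_perm_simp: "k \<in> pm I \<Longrightarrow> \<phi>m k = - \<phi> (- k)"
  using permutes_in_image[OF phi_permutes_pm] by (simp add: minus_perm_def delta_simp)

lemma minus_perm_pos: "k \<in> I \<Longrightarrow> \<phi>m k = k"
  using phi_outside by (simp add: minus_perm_simp I_subset_pm)

lemma phi_minus_inv_pos: "k \<in> I \<Longrightarrow> (\<phi> \<circ> inv \<phi>m) k = \<phi> k"
  using minus_perm_pos permutes_inv_eq[OF minus_perm_permutes] by (metis comp_apply)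

text \<open>On \<open>I\<close> the permutation acts as \<open>\<phi>\<close>, on the negatives as
  the mirror image of its inverse.\<close>

lemma phi_minus_inv_premap: "\<phi> \<circ> inv \<phi>m \<in> premaps I" (is "?\<psi> \<in> _")
proof -
  have psi_neg: "?\<psi> (- m) = - inv \<phi> m" if "m \<in> I" for m
  proof -
    have m: "inv \<phi> m \<in> I" using that permutes_in_image[OF permutes_inv[OF \<phi>]] by simp
    then have "\<phi>m (- inv \<phi> m) = - m"
      by (simp add: minus_perm_simp I_subset_pm permutes_inverses(1)[OF \<phi>])
    then have "inv \<phi>m (- m) = - inv \<phi> m"
      using permutes_inv_eq[OF minus_perm_permutes] by metis
    then show ?thesis using phi_outside[OF m] by simp
  qed
  have inv_in: "inv \<phi> m \<in> I" if "m \<in> I" for m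
    using that permutes_in_image[OF permutes_inv[OF \<phi>]] by simp
  show ?thesis unfolding premap_iff
  proof (intro conjI ballI)
    show "?\<psi> permutes pm I"
      by (intro permutes_compose permutes_inv minus_perm_permutes phi_permutes_pm)
    fix k assume k: "k \<in> pm I"
    show "?\<psi> (- ?\<psi> k) = - k"
      using k
    proof (cases rule: pm_cases)
      case pos
      then show ?thesis using psi_neg[OF phi_in[OF pos(1)]] phi_minus_inv_pos[OF pos(1)]
        by (simp add: permutes_inverses(2)[OF \<phi>])
    next
      case (neg m)
      then show ?thesis
        using psi_neg[OF neg(1)] phi_minus_inv_pos[OF inv_in[OF neg(1)]]
        by (simp add: permutes_inverses(1)[OF \<phi>])
    qed
    show "?\<psi> k \<noteq> - k"
      using k
    proof (cases rule: pm_cases)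
      case pos
      then show ?thesis
        using phi_minus_inv_pos[OF pos(1)] pos_I[OF phi_in[OF pos(1)]] by simp
    next
      case (neg m)
      then show ?thesis
        using psi_neg[OF neg(1)] pos_I[OF inv_in[OF neg(1)]] by simp
    qed
  qed
qed

text \<open>A cycle inside \<open>I\<close> has only positive elements and is therefore particular,
  so the half set is \<open>I\<close> and the half permutation has the cycles of
  \<open>\<phi>\<close>.\<close>

lemma num_cycles_phi_minus_inv:
  "num_cycles (pm I) (\<phi> \<circ> inv \<phi>m) = 2 * num_cycles I \<phi>"
proof -
  let ?\<psi> = "\<phi> \<circ> inv \<phi>m"
  note prem = phi_minus_inv_premap
  have orb: "orbit ?\<psi> k = orbit \<phi> k" if "k \<in> I" for k
    using that by (rule orbit_cong0) (auto simp: phi_minus_inv_pos[simplified] phi_in)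
  have mem: "k \<in> half_set I ?\<psi>" if k: "k \<in> I" for k
  proof -
    have sub: "orbit \<phi> k \<subseteq> I" by (rule permutes_orbit_subset[OF \<phi> k])
    have "finite (orbit \<phi> k)" using sub finite_I by (rule finite_subset)
    then have "Min (orbit \<phi> k) \<in> orbit \<phi> k" "\<forall>j\<in>orbit \<phi> k. Min (orbit \<phi> k) \<le> j"
      using orbit_nonempty[of \<phi> k] by auto
    then have "particular (orbit \<phi> k)" unfolding particular_def
      using sub abs_I pos_I by (intro bexI[of _ "Min (orbit \<phi> k)"]) (auto simp: subset_iff)
    then show ?thesis unfolding mem_half_set[OF prem] orb[OF k] using I_subset_pm[OF k] by simp
  qed
  have "half_set I ?\<psi> = I"
  proof (intro equalityI subsetI mem)
    fix k assume k: "k \<in> half_set I ?\<psi>"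
    then have pm: "k \<in> pm I" using half_set_subset[OF prem] by blast
    then show "k \<in> I"
    proof (cases rule: pm_cases)
      case (neg m)
      then show ?thesis using mem[OF neg(1)] half_set_uminus[OF prem I_subset_pm[OF neg(1)]] k by simp
    qed
  qed
  then show ?thesis
    unfolding num_cycles_half[OF prem] unfolding num_cycles_def half_cycles[OF prem] cycles_on_def[of I]
    using orb by (simp cong: image_cong)
qed

context
  fixes \<alpha> assumes \<alpha>: "\<alpha> \<in> premaps I"
begin

lemma K_map_permutes: "K_map I \<phi> \<alpha> permutes pm I"
  unfolding K_map_def
  by (intro permutes_compose permutes_inv minus_perm_permutes phi_permutes_pm premap_permutes[OF \<alpha>])

abbreviation "\<kappa> \<equiv> inv (K_map I \<phi> \<alpha>)"

text \<open>The definition of \<open>K_map\<close> solved for its inverse, in a form free of the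
  inverses of \<open>\<alpha>\<close> and \<open>\<phi>\<close>.\<close>

lemma minus_perm_inv_K_map: "\<phi>m (\<kappa> k) = \<alpha> (\<phi> k)"
proof -
  have "K_map I \<phi> \<alpha> (inv \<phi>m (\<alpha> (\<phi> k))) = k"
    by (simp add: K_map_def permutes_inverses[OF minus_perm_permutes] permutes_inverses[OF phi_permutes_pm]
        permutes_inverses[OF premap_permutes[OF \<alpha>]])
  then have "\<kappa> k = inv \<phi>m (\<alpha> (\<phi> k))"
    using permutes_inv_eq[OF K_map_permutes] by metis
  then show ?thesis by (simp add: permutes_inverses[OF minus_perm_permutes])
qed

text \<open>Both premap conditions become those of \<open>\<alpha>\<close> at
  \<open>\<phi> k\<close> after applying the injective \<open>\<phi>m\<close>, which sends
  \<open>- k\<close> to \<open>- \<phi> k\<close>.\<close>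

lemma inv_K_map_premap: "\<kappa> \<in> premaps I"
  unfolding premap_iff
proof (intro conjI ballI)
  show perm: "\<kappa> permutes pm I" by (rule permutes_inv[OF K_map_permutes])
  fix k assume k: "k \<in> pm I"
  have \<phi>k: "\<phi> k \<in> pm I" and \<kappa>k: "\<kappa> k \<in> pm I"
    using k permutes_in_image[OF phi_permutes_pm] permutes_in_image[OF perm] by auto
  have inj: "inj (\<phi>m)" using permutes_inj[OF minus_perm_permutes] .
  have "- \<phi> (- \<kappa> k) = \<alpha> (\<phi> k)"
    using minus_perm_inv_K_map[of k] minus_perm_simp[OF \<kappa>k] by simp
  then have "\<phi> (- \<kappa> k) = - \<alpha> (\<phi> k)" by simp
  then have "\<phi>m (\<kappa> (- \<kappa> k)) = - \<phi> k"
    by (simp add: minus_perm_inv_K_map premap_neg[OF \<alpha> \<phi>k])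
  also have "\<dots> = \<phi>m (- k)" using k by (simp add: minus_perm_simp)
  finally show "\<kappa> (- \<kappa> k) = - k" using inj by (simp add: inj_eq)
  show "\<kappa> k \<noteq> - k"
  proof
    assume "\<kappa> k = - k"
    then have "\<alpha> (\<phi> k) = \<phi>m (- k)" using minus_perm_inv_K_map[of k] by simp
    then show False using premap_neq[OF \<alpha> \<phi>k] k by (simp add: minus_perm_simp)
  qed
qed

lemma num_cycles_K_map:
  "num_cycles (pm I) (K_map I \<phi> \<alpha>) = 2 * num_cycles (half_set I (\<kappa>)) (half_perm I (\<kappa>))"
  unfolding num_cycles_half[OF inv_K_map_premap, symmetric]
  unfolding num_cycles_def cycles_on_def
  by (simp add: orbit_inv_eq[OF permutation_pm[OF K_map_permutes]])

lemma chi_eq: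
  "chi I \<phi> \<alpha> = real (num_cycles I \<phi>) + real (num_cycles (pm I) \<alpha>) / 2
    + real (num_cycles (half_set I (\<kappa>)) (half_perm I (\<kappa>))) - real (card I)"
  by (simp add: chi_def num_cycles_phi_minus_inv num_cycles_K_map)

text \<open>With \<open>r k = z (- \<phi>\<^sub>- k)\<close> the constraint imposed by \<open>\<alpha>\<close> on \<open>z\<close> becomes the
  one imposed by \<open>K(\<phi>, \<alpha>)\<close> on \<open>r\<close>.\<close>

lemma sum_alpha_constraint:
  fixes X :: "int \<Rightarrow> complex^'d::finite^'d"
  shows "(\<Sum>z\<in>indices (pm I). of_bool (\<forall>m\<in>pm I. z (- \<alpha> m) = z m) * (\<Prod>k\<in>I. X k $ z (- k) $ z (\<phi> k)))
    = of_nat CARD('d) ^ num_cycles (half_set I (\<kappa>)) (half_perm I (\<kappa>))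
      * tr_half I (\<kappa>) X"
proof -
  define p where "p = delta I \<circ> \<phi>m"
  have p: "p permutes pm I" unfolding p_def by (intro permutes_compose delta_permutes minus_perm_permutes)
  have p_simp: "p k = - \<phi>m k" if "k \<in> pm I" for k
    using that permutes_in_image[OF minus_perm_permutes] by (simp add: p_def delta_simp)
  have p_in: "p k \<in> pm I" if "k \<in> pm I" for k using that permutes_in_image[OF p] by simp
  have p_inv_in: "inv p k \<in> pm I" if "k \<in> pm I" for k
    using that permutes_in_image[OF permutes_inv[OF p]] by simp
  have p_neg: "p (- k) = \<phi> k" if "k \<in> pm I" for k
    using that by (simp add: p_simp minus_perm_simp)
  have p_\<kappa>: "p (\<kappa> k) = - \<alpha> (\<phi> k)" if "k \<in> pm I" for k
    using that permutes_in_image[OF premap_permutes[OF inv_K_map_premap]]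
    by (simp add: p_simp minus_perm_inv_K_map)
  have "(\<Sum>z\<in>indices (pm I). of_bool (\<forall>m\<in>pm I. z (- \<alpha> m) = z m) * (\<Prod>k\<in>I. X k $ z (- k) $ z (\<phi> k)))
      = (\<Sum>r\<in>indices (pm I). of_bool (\<forall>k\<in>pm I. r (\<kappa> k) = r (- k)) * (\<Prod>k\<in>I. X k $ r k $ r (- k)))"
  proof (rule sum.reindex_bij_witness[where i = "\<lambda>r. \<lambda>k\<in>pm I. r (inv p k)" and j = "\<lambda>z. \<lambda>k\<in>pm I. z (p k)"], goal_cases)
    case (1 z)
    show ?case
    proof
      fix k show "(\<lambda>k\<in>pm I. (\<lambda>k\<in>pm I. z (p k)) (inv p k)) k = z k"
        using 1 p_inv_in by (cases "k \<in> pm I") (auto simp: permutes_inverses(1)[OF p] PiE_def extensional_def)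
    qed
  next
    case (2 z) then show ?case by simp
  next
    case (3 r)
    show ?case
    proof
      fix k show "(\<lambda>k\<in>pm I. (\<lambda>k\<in>pm I. r (inv p k)) (p k)) k = r k"
        using 3 p_in by (cases "k \<in> pm I") (auto simp: permutes_inverses(2)[OF p] PiE_def extensional_def)
    qed
  next
    case (4 r) then show ?case by simp
  next
    case (5 z)
    let ?r = "\<lambda>k\<in>pm I. z (p k)"
    have r\<kappa>: "?r (\<kappa> k) = z (- \<alpha> (\<phi> k))" and rneg: "?r (- k) = z (\<phi> k)" if "k \<in> pm I" for k
      using that p_\<kappa> p_neg permutes_in_image[OF premap_permutes[OF inv_K_map_premap]] by auto
    have "(\<forall>k\<in>pm I. ?r (\<kappa> k) = ?r (- k)) \<longleftrightarrow> (\<forall>k\<in>pm I. z (- \<alpha> (\<phi> k)) = z (\<phi> k))"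
      by (intro ball_cong refl) (simp only: r\<kappa> rneg)
    also have "\<dots> \<longleftrightarrow> (\<forall>m\<in>\<phi> ` pm I. z (- \<alpha> m) = z m)" by simp
    also have "\<phi> ` pm I = pm I" by (rule permutes_image[OF phi_permutes_pm])
    finally have 1: "(\<forall>k\<in>pm I. ?r (\<kappa> k) = ?r (- k)) \<longleftrightarrow> (\<forall>m\<in>pm I. z (- \<alpha> m) = z m)" .
    have 2: "(\<Prod>k\<in>I. X k $ ?r k $ ?r (- k)) = (\<Prod>k\<in>I. X k $ z (- k) $ z (\<phi> k))"
    proof (rule prod.cong[OF refl])
      fix k assume k: "k \<in> I"
      have "?r k = z (- k)" using k by (simp add: I_subset_pm p_simp minus_perm_pos)
      then show "X k $ ?r k $ ?r (- k) = X k $ z (- k) $ z (\<phi> k)"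
        using rneg[OF I_subset_pm[OF k]] by simp
    qed
    show ?case unfolding 1 2 ..
  qed
  also have "\<dots> = of_nat CARD('d) ^ num_cycles (half_set I \<kappa>) (half_perm I \<kappa>) * tr_half I \<kappa> X"
    by (rule sum_premap_constraint[OF inv_K_map_premap])
  finally show ?thesis .
qed

end

end

end

section \<open>The expectation over the orthogonal group\<close>

lemma gram_sym:
  assumes "P \<in> pairings_on (intv n)" "Q \<in> pairings_on (intv n)"
  shows "gram CARD('d::finite) n P Q = gram CARD('d) n Q P"
  unfolding gram_eq_sum[OF assms] gram_eq_sum[OF assms(2,1)] by (simp add: mult.commute)

lemma Wg_pseudoinverse:
  "is_pseudoinverse_on (pairings n) (gram CARD('d::finite) n) (Wg CARD('d) n)"
  unfolding Wg_def pairings_eq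
  by (rule pseudoinverse_on_symmetric(1)[OF _ gram_sym]) (simp_all add: finite_pairings_on)

locale signs =
  fixes n :: nat and \<epsilon> :: "int \<Rightarrow> int"
  assumes \<epsilon>: "\<And>k. k \<in> intv n \<Longrightarrow> \<epsilon> k \<in> {1, -1}"
begin

abbreviation "D \<equiv> pm (intv n)"
abbreviation "s \<equiv> delta_eps (intv n) \<epsilon>"
abbreviation "tau P Q \<equiv> twist n \<epsilon> (pair_premap n P Q)"
abbreviation "inv_K \<phi> P Q \<equiv> inv (K_map (intv n) \<phi> (tau P Q))"
abbreviation "genus_weight N \<phi> P Q \<equiv>
  real N powr (chi (intv n) \<phi> (tau P Q) - 2 * real (num_cycles (intv n) \<phi>)) * wg N n P Q"

lemma s_cases: "k \<in> D \<Longrightarrow> s k = k \<or> s k = - k"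
  using \<epsilon>[of "\<bar>k\<bar>"] unfolding intv.mem_pm by (auto simp: delta_eps_def intv.mem_pm simp del: atLeastAtMost_iff)

lemma s_uminus: "k \<in> D \<Longrightarrow> s (- k) = - s k"
  by (simp add: delta_eps_def)

lemma s_mem [simp]: "s k \<in> D \<longleftrightarrow> k \<in> D"
proof (cases "k \<in> D")
  case True then show ?thesis using s_cases[OF True] by auto
qed (simp add: delta_eps_def)

lemma s_s [simp]: "s (s k) = k"
proof (cases "k \<in> D")
  case True then show ?thesis using s_cases[OF True] s_uminus[OF True] by auto
qed (simp add: delta_eps_def)

lemma s_permutes: "s permutes D"
proof (rule bij_imp_permutes)
  show "bij_betw s D D"
    by (rule bij_betw_byWitness[of _ s]) (simp_all add: image_subset_iff)
qed (simp add: delta_eps_def)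

lemma twist_simp: "twist n \<epsilon> \<alpha> k = s (\<alpha> (s k))"
  by (simp add: twist_def)

lemma twist_premap:
  assumes \<alpha>: "\<alpha> \<in> premaps (intv n)" shows "twist n \<epsilon> \<alpha> \<in> premaps (intv n)"
  unfolding intv.premap_iff
proof (intro conjI ballI)
  have \<alpha>_mem: "\<alpha> k \<in> D \<longleftrightarrow> k \<in> D" for k by (rule permutes_in_image[OF intv.premap_permutes[OF \<alpha>]])
  show "twist n \<epsilon> \<alpha> permutes pm (intv n)"
    unfolding twist_def by (intro permutes_compose s_permutes intv.premap_permutes[OF \<alpha>])
  fix k assume k: "k \<in> D"
  show "twist n \<epsilon> \<alpha> (- twist n \<epsilon> \<alpha> k) = - k"
    using k by (simp add: twist_simp s_uminus \<alpha>_mem intv.premap_neg[OF \<alpha>])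
  show "twist n \<epsilon> \<alpha> k \<noteq> - k"
  proof
    assume "twist n \<epsilon> \<alpha> k = - k"
    then have "\<alpha> (s k) = - s k" using k s_uminus by (metis twist_simp s_s)
    then show False using intv.premap_neq[OF \<alpha>, of "s k"] k by simp
  qed
qed

lemma num_cycles_twist:
  "\<alpha> \<in> premaps (intv n) \<Longrightarrow> num_cycles D (twist n \<epsilon> \<alpha>) = num_cycles D \<alpha>"
  unfolding twist_def by (rule intv.num_cycles_conjugate[OF intv.premap_permutes]) simp_all

text \<open>\<open>P\<close> pairs the row indices \<open>z (s k)\<close> of \<open>A\<close> and
  \<open>Q\<close> the column indices \<open>z (- s k)\<close>. With \<open>m = s k\<close>, the
  single constraint is that of \<open>P\<close> at positive \<open>k\<close> and that of
  \<open>Q\<close> at negative \<open>k\<close>.\<close>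

lemma twist_constraint:
  assumes P: "P \<in> pairings_on (intv n)" and Q: "Q \<in> pairings_on (intv n)"
  shows "const_on P (\<lambda>k\<in>intv n. z (s k)) \<and> const_on Q (\<lambda>k\<in>intv n. z (- s k))
    \<longleftrightarrow> (\<forall>m\<in>D. z (- twist n \<epsilon> (pair_premap n P Q) m) = z m)"
proof -
  let ?\<alpha> = "pair_premap n P Q"
  have "(\<forall>m\<in>D. z (- twist n \<epsilon> ?\<alpha> m) = z m) \<longleftrightarrow> (\<forall>m\<in>s ` D. z (- twist n \<epsilon> ?\<alpha> m) = z m)"
    by (simp only: permutes_image[OF s_permutes])
  also have "\<dots> \<longleftrightarrow> (\<forall>k\<in>D. z (- s (?\<alpha> k)) = z (s k))" by (simp add: twist_simp)
  also have "\<dots> \<longleftrightarrow> (\<forall>k\<in>intv n. z (- s (?\<alpha> k)) = z (s k)) \<and> (\<forall>k\<in>intv n. z (- s (?\<alpha> (- k))) = z (s (- k)))"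
    unfolding pm_def by blast
  also have "(\<forall>k\<in>intv n. z (- s (?\<alpha> k)) = z (s k)) \<longleftrightarrow> const_on P (\<lambda>k\<in>intv n. z (s k))"
    unfolding const_on_pairing_iff[OF P]
    by (intro ball_cong refl)
      (simp add: pair_premap_pos[OF P Q] pairing_perm_mem(2)[OF P] intv.I_subset_pm s_uminus del: atLeastAtMost_iff)
  also have "(\<forall>k\<in>intv n. z (- s (?\<alpha> (- k))) = z (s (- k))) \<longleftrightarrow> const_on Q (\<lambda>k\<in>intv n. z (- s k))"
    unfolding const_on_pairing_iff[OF Q]
    by (intro ball_cong refl)
      (simp add: pair_premap_neg[OF P Q] pairing_perm_mem(2)[OF Q] intv.I_subset_pm s_uminus del: atLeastAtMost_iff)
  finally show ?thesis by blast
qed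

text \<open>\<open>z k\<close> is the row index of the orthogonal factor at place \<open>k\<close>;
  \<open>z (- k)\<close> is its column index and the row index of \<open>X k\<close>. Replacing
  \<open>k\<close> by \<open>s k\<close> exchanges the two indices exactly where the factor is
  transposed.\<close>

lemma tr_perm_orth_expand:
  fixes A :: "real^'d::finite^'d" and X :: "int \<Rightarrow> complex^'d^'d"
  assumes \<phi>: "\<phi> permutes intv n"
  shows "of_nat CARD('d) ^ num_cycles (intv n) \<phi> * tr_perm (intv n) \<phi> (\<lambda>k. orth_power A (\<epsilon> k) ** X k)
    = (\<Sum>z\<in>indices D. of_real (\<Prod>k\<in>intv n. A $ (z (s k)) $ (z (- s k))) * (\<Prod>k\<in>intv n. X k $ z (- k) $ z (\<phi> k)))"
proof -
  let ?I = "intv n"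
  have "of_nat CARD('d) ^ num_cycles ?I \<phi> * tr_perm ?I \<phi> (\<lambda>k. orth_power A (\<epsilon> k) ** X k)
      = (\<Sum>i\<in>indices ?I. \<Prod>k\<in>?I. \<Sum>b\<in>UNIV. orth_power A (\<epsilon> k) $ i k $ b * X k $ b $ i (\<phi> k))"
    unfolding tr_perm_eq_sum[OF intv.finite_I \<phi>]
    by (intro sum.cong prod.cong refl) (simp add: signed_mat_def matrix_matrix_mult_def)
  also have "\<dots> = (\<Sum>i\<in>indices ?I. \<Sum>j\<in>indices ?I. \<Prod>k\<in>?I. orth_power A (\<epsilon> k) $ i k $ j k * X k $ j k $ i (\<phi> k))"
    by (intro sum.cong refl prod_sum_indices) simp
  also have "\<dots> = (\<Sum>(i, j)\<in>indices ?I \<times> indices ?I. \<Prod>k\<in>?I. orth_power A (\<epsilon> k) $ i k $ j k * X k $ j k $ i (\<phi> k))"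
    by (rule sum.cartesian_product)
  also have "\<dots> = (\<Sum>z\<in>indices D. \<Prod>k\<in>?I. orth_power A (\<epsilon> k) $ z k $ z (- k) * X k $ z (- k) $ z (\<phi> k))"
  proof (rule sum.reindex_bij_witness[symmetric, where
        j = "\<lambda>z. (restrict z ?I, \<lambda>k\<in>?I. z (- k))" and i = "\<lambda>(i, j). \<lambda>k\<in>D. if k \<in> ?I then i k else j (- k)"], goal_cases)
    case (1 z)
    show ?case
    proof
      fix k
      show "(case (restrict z ?I, \<lambda>k\<in>?I. z (- k)) of (i, j) \<Rightarrow> \<lambda>k\<in>D. if k \<in> ?I then i k else j (- k)) k = z k"
      proof (cases "k \<in> D")
        case True
        show ?thesis
          by (cases rule: intv.pm_cases[OF True]) (use True in auto)
      next
        case False then show ?thesis using 1 by (auto simp: PiE_def extensional_def)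
      qed
    qed
  next
    case (2 z) then show ?case by simp
  next
    case (3 p)
    obtain i j where p: "p = (i, j)" "i \<in> indices ?I" "j \<in> indices ?I" using 3 by auto
    have a: "(\<lambda>k\<in>?I. (\<lambda>k\<in>D. if k \<in> ?I then i k else j (- k)) k) = i"
      using p(2) intv.I_subset_pm by (auto simp: fun_eq_iff PiE_def extensional_def simp del: atLeastAtMost_iff)
    have b: "(\<lambda>k\<in>?I. (\<lambda>k\<in>D. if k \<in> ?I then i k else j (- k)) (- k)) = j"
      using p(3) intv.I_subset_pm intv.uminus_notin_I
      by (auto simp: fun_eq_iff PiE_def extensional_def simp del: atLeastAtMost_iff)
    show ?case by (simp only: p(1) prod.case a b)
  next
    case (4 p) then show ?case by auto
  next
    case (5 z)
    show ?case using permutes_in_image[OF \<phi>] by (auto intro!: prod.cong simp del: atLeastAtMost_iff)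
  qed
  also have "\<dots> = (\<Sum>z\<in>indices D. of_real (\<Prod>k\<in>?I. A $ (z (s k)) $ (z (- s k))) * (\<Prod>k\<in>?I. X k $ z (- k) $ z (\<phi> k)))"
  proof (rule sum.cong[OF refl])
    fix z :: "int \<Rightarrow> 'd"
    have "orth_power A (\<epsilon> k) $ z k $ z (- k) = of_real (A $ (z (s k)) $ (z (- s k)))" if k: "k \<in> ?I" for k
    proof -
      have "k \<in> D" "\<bar>k\<bar> = k" using k by (auto simp: intv.I_subset_pm)
      then show ?thesis using \<epsilon>[OF k]
        by (auto simp: orth_power_def delta_eps_def map_matrix_def transpose_def)
    qed
    then show "(\<Prod>k\<in>?I. orth_power A (\<epsilon> k) $ z k $ z (- k) * X k $ z (- k) $ z (\<phi> k))
        = of_real (\<Prod>k\<in>?I. A $ (z (s k)) $ (z (- s k))) * (\<Prod>k\<in>?I. X k $ z (- k) $ z (\<phi> k))"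
      unfolding of_real_prod prod.distrib[symmetric] by (intro prod.cong refl) simp
  qed
  finally show ?thesis .
qed

lemma haar_moment_signs:
  fixes \<mu> :: "(real^'d::finite^'d) measure" and z :: "int \<Rightarrow> 'd"
  assumes haar: "haar_orthogonal_measure \<mu>"
  shows "(\<integral>A. (\<Prod>k\<in>intv n. A $ (z (s k)) $ (z (- s k))) \<partial>\<mu>)
    = (\<Sum>(P, Q)\<in>pairings n \<times> pairings n. Wg CARD('d) n P Q *
        of_bool (\<forall>m\<in>D. z (- tau P Q m) = z m))"
proof -
  have "(\<integral>A. (\<Prod>k\<in>intv n. A $ (z (s k)) $ (z (- s k))) \<partial>\<mu>)
      = (\<integral>A. (\<Prod>k\<in>intv n. A $ ((\<lambda>k\<in>intv n. z (s k)) k) $ ((\<lambda>k\<in>intv n. z (- s k)) k)) \<partial>\<mu>)"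
    by (simp cong: prod.cong del: atLeastAtMost_iff)
  also have "\<dots> = (\<Sum>P\<in>pairings_on (intv n). \<Sum>Q\<in>pairings_on (intv n).
      of_bool (const_on P (\<lambda>k\<in>intv n. z (s k))) * Wg CARD('d) n P Q * of_bool (const_on Q (\<lambda>k\<in>intv n. z (- s k))))"
    using Wg_pseudoinverse[where 'd = 'd] gram_eq_sum[where 'd = 'd] unfolding pairings_eq
    by (intro haar_moment[OF haar, of "intv n" "gram CARD('d) n"]) auto
  also have "\<dots> = (\<Sum>P\<in>pairings_on (intv n). \<Sum>Q\<in>pairings_on (intv n). Wg CARD('d) n P Q *
        of_bool (\<forall>m\<in>D. z (- tau P Q m) = z m))"
    by (intro sum.cong refl) (simp only: twist_constraint[symmetric] of_bool_conj mult_ac)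
  finally show ?thesis by (simp only: pairings_eq sum.cartesian_product)
qed

text \<open>The cycles of the twisted premap count the blocks of the join, so the power of
  \<open>N\<close> inside \<open>wg\<close> cancels against part of \<open>chi\<close>; what remains
  counts the cycles of the half permutation and of \<open>\<phi>\<close>.\<close>

lemma genus_exponent:
  assumes \<phi>: "\<phi> permutes intv n" and P: "P \<in> pairings n" and Q: "Q \<in> pairings n" and N: "0 < N"
  shows "genus_weight N \<phi> P Q = real N ^ num_cycles (half_set (intv n) (inv_K \<phi> P Q))
      (half_perm (intv n) (inv_K \<phi> P Q)) * Wg N n P Q / real N ^ num_cycles (intv n) \<phi>"
proof -
  note PQ = P[unfolded pairings_eq] Q[unfolded pairings_eq]
  have prem: "pair_premap n P Q \<in> premaps (intv n)" by (rule pair_premap_in_premaps[OF PQ])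
  let ?h = "num_cycles (half_set (intv n) (inv_K \<phi> P Q)) (half_perm (intv n) (inv_K \<phi> P Q))"
  let ?f = "num_cycles (intv n) \<phi>"
  let ?J = "card (partition_join (intv n) P Q)"
  have chi: "chi (intv n) \<phi> (tau P Q) - 2 * real ?f = real ?h - real ?f - (real n - real ?J)"
    by (subst intv.chi_eq[OF \<phi> twist_premap[OF prem]])
       (simp add: num_cycles_twist[OF prem] num_cycles_pair_premap[OF PQ])
  have "real N powi (int n - int ?J) = real N powr (real n - real ?J)"
    using N by (subst powr_real_of_int'[symmetric]) auto
  then show ?thesis
    unfolding chi wg_def using N
    by (simp add: powr_diff powr_realpow divide_simps mult_ac)
qed

text \<open>Here the \<open>X k\<close> are constants. Multiplication by \<open>N\<close> to the
  number of cycles of \<open>\<phi>\<close> turns the trace into an index sum, in which the sum over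
  \<open>z\<close> can be carried out separately for each pair of pairings.\<close>

theorem haar_expectation_tr_perm:
  fixes \<mu> :: "(real^'d::finite^'d) measure" and X :: "int \<Rightarrow> complex^'d^'d"
  assumes haar: "haar_orthogonal_measure \<mu>" and \<phi>: "\<phi> permutes intv n"
  shows "(\<integral>A. tr_perm (intv n) \<phi> (\<lambda>k. orth_power A (\<epsilon> k) ** X k) \<partial>\<mu>)
    = (\<Sum>(P, Q)\<in>pairings n \<times> pairings n.
        of_real (genus_weight CARD('d) \<phi> P Q)
        * tr_half (intv n) (inv_K \<phi> P Q) X)"
proof -
  let ?I = "intv n" let ?N = "of_nat CARD('d) ^ num_cycles (intv n) \<phi> :: complex"
  define c where "c z = (\<Prod>k\<in>?I. X k $ z (- k) $ z (\<phi> k))" for z :: "int \<Rightarrow> 'd"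
  define b where "b P Q z = (\<forall>m\<in>D. z (- tau P Q m) = z m)" for P Q and z :: "int \<Rightarrow> 'd"
  define h where "h P Q = num_cycles (half_set ?I (inv_K \<phi> P Q))
      (half_perm ?I (inv_K \<phi> P Q))" for P Q
  define T where "T P Q = tr_half ?I (inv_K \<phi> P Q) X" for P Q
  have N: "?N \<noteq> 0" by simp
  have "?N * (\<integral>A. tr_perm ?I \<phi> (\<lambda>k. orth_power A (\<epsilon> k) ** X k) \<partial>\<mu>)
      = (\<integral>A. (\<Sum>z\<in>indices D. of_real (\<Prod>k\<in>?I. A $ (z (s k)) $ (z (- s k))) * c z) \<partial>\<mu>)"
    unfolding c_def tr_perm_orth_expand[OF \<phi>, symmetric] by simp
  also have "\<dots> = (\<Sum>z\<in>indices D. of_real (\<integral>A. (\<Prod>k\<in>?I. A $ (z (s k)) $ (z (- s k))) \<partial>\<mu>) * c z)"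
  proof -
    have "integrable \<mu> (\<lambda>A. of_real (\<Prod>k\<in>?I. A $ (z (s k)) $ (z (- s k))) * c z)" for z
      by (intro integrable_mult_left integrable_of_real haar_integrable_moment[OF haar])
    then show ?thesis
      by (simp add: integral_complex_of_real del: of_real_prod)
  qed
  also have "\<dots> = (\<Sum>z\<in>indices D. \<Sum>(P, Q)\<in>pairings n \<times> pairings n.
      of_real (Wg CARD('d) n P Q) * (of_bool (b P Q z) * c z))"
    unfolding haar_moment_signs[OF haar] of_real_sum sum_distrib_right b_def
    by (intro sum.cong refl) (auto split: prod.splits)
  also have "\<dots> = (\<Sum>(P, Q)\<in>pairings n \<times> pairings n. of_real (Wg CARD('d) n P Q) * (\<Sum>z\<in>indices D. of_bool (b P Q z) * c z))"
    by (subst sum.swap) (simp add: sum_distrib_left case_prod_unfold)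
  also have "\<dots> = (\<Sum>(P, Q)\<in>pairings n \<times> pairings n. of_real (Wg CARD('d) n P Q) * (of_nat CARD('d) ^ h P Q * T P Q))"
  proof (rule sum.cong[OF refl], clarify)
    fix P Q assume "P \<in> pairings n" "Q \<in> pairings n"
    then have "tau P Q \<in> premaps ?I"
      unfolding pairings_eq by (intro twist_premap pair_premap_in_premaps)
    then show "of_real (Wg CARD('d) n P Q) * (\<Sum>z\<in>indices D. of_bool (b P Q z) * c z)
        = of_real (Wg CARD('d) n P Q) * (of_nat CARD('d) ^ h P Q * T P Q)"
      unfolding b_def c_def h_def T_def by (subst intv.sum_alpha_constraint[OF \<phi>]) simp_all
  qed
  also have "\<dots> = (\<Sum>(P, Q)\<in>pairings n \<times> pairings n. ?N *
      (of_real (genus_weight CARD('d) \<phi> P Q) * T P Q))"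
  proof (rule sum.cong[OF refl], clarify)
    fix P Q assume PQ: "P \<in> pairings n" "Q \<in> pairings n"
    show "of_real (Wg CARD('d) n P Q) * (of_nat CARD('d) ^ h P Q * T P Q) = ?N *
      (of_real (genus_weight CARD('d) \<phi> P Q) * T P Q)"
      by (subst genus_exponent[OF \<phi> PQ]) (simp_all add: h_def)
  qed
  finally have "?N * (\<integral>A. tr_perm ?I \<phi> (\<lambda>k. orth_power A (\<epsilon> k) ** X k) \<partial>\<mu>)
      = ?N * (\<Sum>(P, Q)\<in>pairings n \<times> pairings n.
          of_real (genus_weight CARD('d) \<phi> P Q) * T P Q)"
    by (simp only: sum_distrib_left case_prod_unfold)
  then show ?thesis using N unfolding T_def by simp
qed

end

section \<open>Alternating premaps\<close>

lemma involution_pairing: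
  assumes f: "\<And>k. k \<in> A \<Longrightarrow> f k \<in> A \<and> f k \<noteq> k \<and> f (f k) = k"
  shows "(\<lambda>k. {k, f k}) ` A \<in> pairings_on A"
    and "k \<in> A \<Longrightarrow> pairing_perm ((\<lambda>k. {k, f k}) ` A) k = f k"
proof -
  let ?P = "(\<lambda>k. {k, f k}) ` A"
  have "{k, f k} = {l, f l}" if kl: "k \<in> A" "l \<in> A" "{k, f k} \<inter> {l, f l} \<noteq> {}" for k l
  proof -
    have ff: "f (f k) = k" "f (f l) = l" using f kl by blast+
    consider "k = l" | "k = f l" | "f k = l" | "f k = f l" using kl(3) by blast
    then show ?thesis
    proof cases
      case 2 then show ?thesis using ff(2) by (simp add: insert_commute)
    next
      case 3 then show ?thesis using ff(1) by (metis insert_commute)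
    next
      case 4 then show ?thesis using ff by metis
    qed simp
  qed
  then have "disjoint ?P" by (intro disjointI) blast
  moreover have "\<Union> ?P = A" using f by auto
  moreover have "card B = 2" if "B \<in> ?P" for B
  proof -
    from that obtain k where "k \<in> A" "B = {k, f k}" by blast
    then show ?thesis using f[of k] by simp
  qed
  moreover have "{} \<notin> ?P" by blast
  ultimately show P: "?P \<in> pairings_on A" by (simp add: pairings_on_def partition_on_def)
  show "pairing_perm ?P k = f k" if "k \<in> A"
    using that by (intro pairing_perm_eqI[OF P]) blast
qed

lemma pairing_eq_image:
  assumes P: "P \<in> pairings_on A" shows "P = (\<lambda>k. {k, pairing_perm P k}) ` A"
proof (intro equalityI subsetI)
  fix B assume "B \<in> P"
  then obtain k where "k \<in> A" "B = {k, pairing_perm P k}" by (rule pairing_block[OF P])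
  then show "B \<in> (\<lambda>k. {k, pairing_perm P k}) ` A" by blast
next
  fix B assume "B \<in> (\<lambda>k. {k, pairing_perm P k}) ` A"
  then show "B \<in> P" using pairing_perm_mem(1)[OF P] by blast
qed

text \<open>An alternating premap \<alpha> determines its pairings by
  \<open>k \<mapsto> - \<alpha> k\<close> and \<open>k \<mapsto> \<alpha> (- k)\<close>: alternation
  keeps both maps inside [n], and the premap conditions make them involutions without fixed
  points.\<close>

lemma bij_betw_pair_premap:
  "bij_betw (\<lambda>(P, Q). pair_premap n P Q) (pairings n \<times> pairings n) (alt_premaps (intv n))"
  unfolding pairings_eq
proof (rule bij_betw_imageI)
  let ?J = "pairings_on (intv n)"
  show "inj_on (\<lambda>(P, Q). pair_premap n P Q) (?J \<times> ?J)"
  proof (rule inj_onI, clarify)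
    fix P Q P' Q' assume PQ: "P \<in> ?J" "Q \<in> ?J" and PQ': "P' \<in> ?J" "Q' \<in> ?J"
      and eq: "pair_premap n P Q = pair_premap n P' Q'"
    have "pairing_perm P k = pairing_perm P' k" "pairing_perm Q k = pairing_perm Q' k" if "k \<in> intv n" for k
      using that pair_premap_pos[OF PQ that] pair_premap_pos[OF PQ' that]
        pair_premap_neg[OF PQ that] pair_premap_neg[OF PQ' that] eq by auto
    then show "P = P' \<and> Q = Q'"
      using pairing_eq_image[OF PQ(1)] pairing_eq_image[OF PQ(2)]
        pairing_eq_image[OF PQ'(1)] pairing_eq_image[OF PQ'(2)] by (metis (no_types, lifting) image_cong)
  qed
  show "(\<lambda>(P, Q). pair_premap n P Q) ` (?J \<times> ?J) = alt_premaps (intv n)"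
  proof (intro equalityI subsetI)
    fix \<alpha> assume "\<alpha> \<in> (\<lambda>(P, Q). pair_premap n P Q) ` (?J \<times> ?J)"
    then show "\<alpha> \<in> alt_premaps (intv n)" using pair_premap_in_alt_premaps by auto
  next
    fix \<alpha> assume "\<alpha> \<in> alt_premaps (intv n)"
    then have \<alpha>: "\<alpha> \<in> premaps (intv n)" and alt: "\<And>k. k \<in> pm (intv n) \<Longrightarrow> sgn (\<alpha> k) = - sgn k"
      by (auto simp: alt_premaps_def)
    have mem: "\<alpha> k \<in> pm (intv n) \<longleftrightarrow> k \<in> pm (intv n)" for k
      by (rule permutes_in_image[OF intv.premap_permutes[OF \<alpha>]])
    have pos: "j \<in> intv n" if "j \<in> pm (intv n)" "0 < j" for j
      using that by (cases rule: intv.pm_cases) auto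
    have f: "- \<alpha> k \<in> intv n \<and> - \<alpha> k \<noteq> k \<and> - \<alpha> (- \<alpha> k) = k" if k: "k \<in> intv n" for k
    proof -
      have D: "k \<in> pm (intv n)" using k by (rule intv.I_subset_pm)
      have "sgn (\<alpha> k) = -1" using alt[OF D] k by simp
      then have "0 < - \<alpha> k" by (simp add: sgn_if split: if_splits)
      then have "- \<alpha> k \<in> intv n" using D mem by (intro pos) auto
      then show ?thesis using intv.premap_neg[OF \<alpha> D] intv.premap_neq[OF \<alpha> D] by auto
    qed
    have g: "\<alpha> (- k) \<in> intv n \<and> \<alpha> (- k) \<noteq> k \<and> \<alpha> (- \<alpha> (- k)) = k" if k: "k \<in> intv n" for k
    proof -
      have D: "- k \<in> pm (intv n)" using intv.I_subset_pm[OF k] by simp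
      have "sgn (\<alpha> (- k)) = 1" using alt[OF D] k by (simp add: sgn_minus)
      then have "0 < \<alpha> (- k)" by (simp add: sgn_if split: if_splits)
      then have "\<alpha> (- k) \<in> intv n" using D mem by (intro pos) auto
      then show ?thesis using intv.premap_neg[OF \<alpha> D] intv.premap_neq[OF \<alpha> D] by auto
    qed
    define P where "P = (\<lambda>k. {k, - \<alpha> k}) ` intv n"
    define Q where "Q = (\<lambda>k. {k, \<alpha> (- k)}) ` intv n"
    have PQ: "P \<in> ?J" "Q \<in> ?J"
      unfolding P_def Q_def by (intro involution_pairing(1) f g; assumption)+
    have p: "pairing_perm P k = - \<alpha> k" if "k \<in> intv n" for k
      unfolding P_def using f that by (intro involution_pairing(2)) auto
    have q: "pairing_perm Q k = \<alpha> (- k)" if "k \<in> intv n" for k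
      unfolding Q_def using g that by (intro involution_pairing(2)) auto
    have "pair_premap n P Q = \<alpha>"
    proof
      fix k show "pair_premap n P Q k = \<alpha> k"
      proof (cases "k \<in> pm (intv n)")
        case True
        then show ?thesis
        proof (cases rule: intv.pm_cases)
          case pos then show ?thesis by (simp add: pair_premap_pos[OF PQ] p)
        next
          case (neg m) then show ?thesis by (simp add: pair_premap_neg[OF PQ] q)
        qed
      next
        case False
        then show ?thesis
          using permutes_not_in[OF intv.premap_permutes[OF \<alpha>]]
            permutes_not_in[OF intv.premap_permutes[OF pair_premap_in_premaps[OF PQ]]] by simp
      qed
    qed
    then show "\<alpha> \<in> (\<lambda>(P, Q). pair_premap n P Q) ` (?J \<times> ?J)" using PQ by auto
  qed
qed

section \<open>The Weingarten function as a function of Young diagrams\<close>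

text \<open>The sign of an iterate, given by the parity of the exponent, decides which pairing moves
  it.\<close>

lemma pair_premap_power:
  assumes PQ: "P \<in> pairings_on (intv n)" "Q \<in> pairings_on (intv n)" and k: "k \<in> intv n"
  defines "f \<equiv> pair_premap n P Q"
  shows "even t \<Longrightarrow> (f ^^ t) k \<in> intv n" "odd t \<Longrightarrow> - (f ^^ t) k \<in> intv n"
    and "even t \<Longrightarrow> pairing_perm P \<bar>(f ^^ t) k\<bar> = \<bar>(f ^^ Suc t) k\<bar>"
    and "odd t \<Longrightarrow> pairing_perm Q \<bar>(f ^^ t) k\<bar> = \<bar>(f ^^ Suc t) k\<bar>"
proof -
  have mem: "(even t \<longrightarrow> (f ^^ t) k \<in> intv n) \<and> (odd t \<longrightarrow> - (f ^^ t) k \<in> intv n)" for t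
  proof (induction t)
    case 0 show ?case using k by simp
  next
    case (Suc t)
    show ?case
    proof (cases "even t")
      case True
      then show ?thesis using Suc pairing_perm_mem(2)[OF PQ(1)]
        by (simp add: f_def pair_premap_pos[OF PQ] del: atLeastAtMost_iff)
    next
      case False
      then have "- (f ^^ t) k \<in> intv n" using Suc by simp
      from pair_premap_neg[OF PQ this] pairing_perm_mem(2)[OF PQ(2) this] show ?thesis
        using False by (simp add: f_def)
    qed
  qed
  show 1: "(f ^^ t) k \<in> intv n" if "even t" for t using mem that by blast
  show 2: "- (f ^^ t) k \<in> intv n" if "odd t" for t using mem that by blast
  show "pairing_perm P \<bar>(f ^^ t) k\<bar> = \<bar>(f ^^ Suc t) k\<bar>" if "even t"
  proof -
    have "\<bar>(f ^^ t) k\<bar> = (f ^^ t) k" using 1[OF that] by simp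
    then show ?thesis
      using pair_premap_pos[OF PQ 1[OF that]] pairing_perm_mem(2)[OF PQ(1) 1[OF that]]
      by (simp add: f_def)
  qed
  show "pairing_perm Q \<bar>(f ^^ t) k\<bar> = \<bar>(f ^^ Suc t) k\<bar>" if "odd t"
  proof -
    have "\<bar>(f ^^ t) k\<bar> = - (f ^^ t) k" using 2[OF that] by simp
    then show ?thesis
      using pair_premap_neg[OF PQ 2[OF that]] pairing_perm_mem(2)[OF PQ(2) 2[OF that]]
      by (simp add: f_def)
  qed
qed

text \<open>Each pairing moves an iterate to one of its two neighbours in the orbit,
  \<open>P\<close> and \<open>Q\<close> to opposite ones. Counting from \<open>Suc t\<close> gives
  every iterate a predecessor.\<close>

lemma pair_premap_power_step:
  assumes PQ: "P \<in> pairings_on (intv n)" "Q \<in> pairings_on (intv n)" and k: "k \<in> intv n"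
  defines "f \<equiv> pair_premap n P Q"
  shows "pairing_perm P \<bar>(f ^^ Suc t) k\<bar> = \<bar>(f ^^ (if even t then t else Suc (Suc t))) k\<bar>"
    and "pairing_perm Q \<bar>(f ^^ Suc t) k\<bar> = \<bar>(f ^^ (if even t then Suc (Suc t) else t)) k\<bar>"
proof -
  note pow = pair_premap_power[OF PQ k, folded f_def]
  have mem: "\<bar>(f ^^ t) k\<bar> \<in> intv n"
    using pow(1,2)[of t] by (cases "even t") auto
  show "pairing_perm P \<bar>(f ^^ Suc t) k\<bar> = \<bar>(f ^^ (if even t then t else Suc (Suc t))) k\<bar>"
  proof (cases "even t")
    case True
    then show ?thesis using pow(3)[OF True, symmetric] pairing_perm_mem(4)[OF PQ(1) mem] by simp
  next
    case False
    then show ?thesis using pow(3)[of "Suc t"] by simp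
  qed
  show "pairing_perm Q \<bar>(f ^^ Suc t) k\<bar> = \<bar>(f ^^ (if even t then Suc (Suc t) else t)) k\<bar>"
  proof (cases "even t")
    case False
    then show ?thesis using pow(4)[OF False, symmetric] pairing_perm_mem(4)[OF PQ(2) mem] by simp
  next
    case True
    then show ?thesis using pow(4)[of "Suc t"] by simp
  qed
qed

lemma image_mset_eq_bij_betw:
  assumes "finite A" "finite B" "image_mset f (mset_set A) = image_mset g (mset_set B)"
  shows "\<exists>h. bij_betw h A B \<and> (\<forall>a\<in>A. f a = g (h a))"
  using assms
proof (induction A arbitrary: B rule: finite_induct)
  case empty
  then have "B = {}" by (simp add: mset_set_empty_iff)
  then show ?case by (auto simp: bij_betw_def)
next
  case (insert a A)
  have "f a \<in># image_mset g (mset_set B)" using insert.hyps insert.prems(2)[symmetric] by simp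
  then obtain b where b: "b \<in> B" "g b = f a" using insert.prems(1) by auto
  have "mset_set B = add_mset b (mset_set (B - {b}))"
    by (rule mset_set.remove[OF insert.prems(1) b(1)])
  then have "image_mset f (mset_set A) = image_mset g (mset_set (B - {b}))"
    using insert b by simp
  then obtain h where h: "bij_betw h A (B - {b})" "\<forall>x\<in>A. f x = g (h x)"
    using insert.IH[of "B - {b}"] insert.prems(1) by auto
  have "bij_betw (h(a := b)) A (B - {b})"
    using h(1) insert.hyps by (subst bij_betw_cong[of _ _ h]) auto
  then have "bij_betw (h(a := b)) (insert a A) (insert b (B - {b}))"
    using notIn_Un_bij_betw[of a A "h(a := b)" "B - {b}"] insert.hyps by simp
  moreover have "insert b (B - {b}) = B" using b by blast
  ultimately have "bij_betw (h(a := b)) (insert a A) B" by simp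
  moreover have "\<forall>x\<in>insert a A. f x = g ((h(a := b)) x)" using h(2) b insert.hyps by auto
  ultimately show ?case by blast
qed

text \<open>Either side says that the common cycle length divides the difference of the
  exponents.\<close>

lemma power_eq_iff_least_power:
  assumes f: "permutation f" and g: "permutation g" and eq: "least_power f k = least_power g l"
  shows "(f ^^ t) k = (f ^^ u) k \<longleftrightarrow> (g ^^ t) l = (g ^^ u) l"
proof -
  have red: "(f ^^ t) k = (f ^^ u) k \<longleftrightarrow> least_power f k dvd (t - u)"
    if f: "permutation f" and le: "u \<le> t" for f :: "'x \<Rightarrow> 'x" and k t u
  proof -
    have "inj (f ^^ u)" using f by (intro inj_fn bij_is_inj permutation_bijective)
    moreover have "(f ^^ t) k = (f ^^ u) ((f ^^ (t - u)) k)"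
      using le by (metis comp_apply funpow_add le_add_diff_inverse)
    ultimately show ?thesis unfolding least_power_dvd[OF f] by (simp add: inj_eq)
  qed
  show ?thesis
  proof (cases "u \<le> t")
    case True then show ?thesis using red[OF f True] red[OF g True] eq by simp
  next
    case False
    then have "t \<le> u" by simp
    then have "(f ^^ u) k = (f ^^ t) k \<longleftrightarrow> (g ^^ u) l = (g ^^ t) l"
      using red[OF f, of t u k] red[OF g, of t u l] eq by simp
    then show ?thesis by (simp only: eq_commute)
  qed
qed

lemma least_power_eq_card_orbit:
  assumes "permutation f" shows "least_power f k = card (orbit f k)"
proof -
  have "orbit f k = set (support f k)"
    unfolding support_set[OF assms] orbit_altdef_permutation[OF assms] by auto
  then show ?thesis using distinct_card[OF cycle_of_permutation[OF assms, of k]] by simp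
qed

lemma card_join_block:
  assumes PQ: "P \<in> pairings_on (intv n)" "Q \<in> pairings_on (intv n)" and k: "k \<in> intv n"
  shows "card (join_block n P Q k) = least_power (pair_premap n P Q) k"
proof -
  note prem = pair_premap_in_premaps[OF PQ]
  have "card (join_block n P Q k) = card (orbit (pair_premap n P Q) k)"
    unfolding join_block_def[OF PQ]
    by (intro card_image intv.premap_inj_abs[OF prem] intv.I_subset_pm k)
  then show ?thesis
    by (simp add: least_power_eq_card_orbit[OF intv.permutation_pm[OF intv.premap_permutes[OF prem]]])
qed

text \<open>An odd cycle length would bring the positive \<open>k\<close> back with a negative sign.
  Evenness lets the halved sizes in a diagram determine the block sizes.\<close>

lemma even_card_join_block:
  assumes PQ: "P \<in> pairings_on (intv n)" "Q \<in> pairings_on (intv n)" and k: "k \<in> intv n"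
  shows "even (card (join_block n P Q k))"
proof (rule ccontr)
  let ?f = "pair_premap n P Q"
  let ?L = "least_power ?f k"
  assume "odd (card (join_block n P Q k))"
  then have "- (?f ^^ ?L) k \<in> intv n"
    unfolding card_join_block[OF PQ k] by (rule pair_premap_power(2)[OF PQ k])
  moreover have "(?f ^^ ?L) k = k"
    by (rule least_power_of_permutation(1)[OF intv.permutation_pm[OF intv.premap_permutes[OF pair_premap_in_premaps[OF PQ]]]])
  ultimately show False using k by simp
qed

text \<open>Equal diagrams allow a size-preserving bijection \<open>F\<close> between the blocks. In
  matching blocks with base points, the permutation sends the \<open>t\<close>-th iterate of one
  base point, in absolute value, to the \<open>t\<close>-th iterate of the other. Equal cycle
  lengths make this well defined, and it respects the pairings because they move to neighbouring
  iterates.\<close>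

lemma same_diagram_conjugate:
  assumes PQ: "P \<in> pairings_on (intv n)" "Q \<in> pairings_on (intv n)"
    and PQ': "P' \<in> pairings_on (intv n)" "Q' \<in> pairings_on (intv n)"
    and diag: "half_diagram (partition_join (intv n) P Q) = half_diagram (partition_join (intv n) P' Q')"
  obtains \<sigma> where "\<sigma> permutes intv n"
    "\<And>x. x \<in> intv n \<Longrightarrow> \<sigma> (pairing_perm P x) = pairing_perm P' (\<sigma> x)"
    "\<And>x. x \<in> intv n \<Longrightarrow> \<sigma> (pairing_perm Q x) = pairing_perm Q' (\<sigma> x)"
proof -
  let ?I = "intv n"
  define f where "f = pair_premap n P Q"
  define g where "g = pair_premap n P' Q'"
  define blk where "blk = join_block n P Q"
  define blk' where "blk' = join_block n P' Q'"
  have f: "f \<in> premaps ?I" and g: "g \<in> premaps ?I"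
    unfolding f_def g_def by (intro pair_premap_in_premaps PQ PQ')+
  have perm: "permutation f" "permutation g"
    using intv.permutation_pm intv.premap_permutes f g by blast+
  obtain F where F: "bij_betw F (blk ` ?I) (blk' ` ?I)" "\<And>B. B \<in> blk ` ?I \<Longrightarrow> card B div 2 = card (F B) div 2"
    using image_mset_eq_bij_betw[of "blk ` ?I" "blk' ` ?I" "\<lambda>c. card c div 2" "\<lambda>c. card c div 2"] diag
    unfolding half_diagram_def partition_join_eq[OF PQ] partition_join_eq[OF PQ'] blk_def blk'_def
    by (metis finite_imageI intv.finite_I)
  define base where "base B = (SOME k. k \<in> ?I \<and> blk k = B)" for B
  define base' where "base' B = (SOME l. l \<in> ?I \<and> blk' l = B)" for B
  have base: "base B \<in> ?I \<and> blk (base B) = B" if "B \<in> blk ` ?I" for B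
    unfolding base_def by (rule someI_ex) (use that in blast)
  have base': "base' B \<in> ?I \<and> blk' (base' B) = B" if "B \<in> blk' ` ?I" for B
    unfolding base'_def by (rule someI_ex) (use that in blast)
  \<comment> \<open>Both base points depend only on the block of \<open>x\<close>, so they agree
    throughout a block; \<open>l x\<close> lies in the matching block.\<close>
  define k where "k x = base (blk x)" for x
  define l where "l x = base' (F (blk x))" for x
  have k: "k x \<in> ?I" "blk (k x) = blk x" if "x \<in> ?I" for x
    using base[of "blk x"] that by (auto simp: k_def)
  have Fmem: "F (blk x) \<in> blk' ` ?I" if "x \<in> ?I" for x
    using bij_betwE[OF F(1)] that by blast
  have l: "l x \<in> ?I" "blk' (l x) = F (blk x)" if "x \<in> ?I" for x
    using base'[OF Fmem[OF that]] by (auto simp: l_def)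
  have L: "least_power f (k x) = least_power g (l x)" if x: "x \<in> ?I" for x
  proof -
    have "card (blk x) div 2 = card (F (blk x)) div 2" using F(2) x by blast
    moreover have "even (card (blk x))" "even (card (F (blk x)))"
      using even_card_join_block[OF PQ x] even_card_join_block[OF PQ' l(1)[OF x]] l(2)[OF x]
      by (auto simp: blk_def blk'_def)
    ultimately have "card (blk x) = card (F (blk x))" by (metis dvd_mult_div_cancel)
    then have "card (blk (k x)) = card (blk' (l x))" using k l x by simp
    then show ?thesis
      using card_join_block[OF PQ k(1)[OF x]] card_join_block[OF PQ' l(1)[OF x]]
      by (simp add: blk_def blk'_def f_def g_def)
  qed
  \<comment> \<open>Positive exponents, as in \<open>pair_premap_power_step\<close>; they exist
    because \<open>orbit\<close> consists of positive powers.\<close>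
  define rep where "rep x t \<longleftrightarrow> x = \<bar>(f ^^ Suc t) (k x)\<bar>" for x t
  have rep_ex: "\<exists>t. rep x t" if x: "x \<in> ?I" for x
  proof -
    have "x \<in> blk (k x)" using k(2)[OF x] join_block_mem(1)[OF PQ x] by (simp add: blk_def)
    then obtain y where "y \<in> orbit f (k x)" "x = \<bar>y\<bar>"
      by (auto simp: blk_def join_block_def[OF PQ] f_def)
    then obtain t where "0 < t" "x = \<bar>(f ^^ t) (k x)\<bar>" by (auto simp: orbit_altdef)
    then show ?thesis unfolding rep_def by (intro exI[of _ "t - 1"]) simp
  qed
  \<comment> \<open>Any exponent that represents \<open>x\<close> may be chosen: by
    \<open>abs_iff\<close> below, two of them give the same image.\<close>
  define \<sigma> where "\<sigma> x = (if x \<in> ?I then \<bar>(g ^^ Suc (SOME t. rep x t)) (l x)\<bar> else x)" for x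
  have pow_mem: "\<bar>(f ^^ t) (k x)\<bar> \<in> ?I" "\<bar>(f ^^ t) (k x)\<bar> \<in> blk x" if x: "x \<in> ?I" for x t
  proof -
    have "(f ^^ t) (k x) \<in> orbit f (k x)" using perm(1) by (auto simp: orbit_altdef_permutation)
    then have "\<bar>(f ^^ t) (k x)\<bar> \<in> blk (k x)" by (auto simp: blk_def join_block_def[OF PQ] f_def)
    then show "\<bar>(f ^^ t) (k x)\<bar> \<in> blk x" using k(2)[OF x] by simp
    then show "\<bar>(f ^^ t) (k x)\<bar> \<in> ?I"
      using join_block_subset[OF PQ intv.I_subset_pm[OF x]] by (auto simp: blk_def)
  qed
  have pow_mem': "\<bar>(g ^^ t) (l x)\<bar> \<in> ?I" "\<bar>(g ^^ t) (l x)\<bar> \<in> F (blk x)" if x: "x \<in> ?I" for x t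
  proof -
    have "(g ^^ t) (l x) \<in> orbit g (l x)" using perm(2) by (auto simp: orbit_altdef_permutation)
    then have *: "\<bar>(g ^^ t) (l x)\<bar> \<in> blk' (l x)" by (auto simp: blk'_def join_block_def[OF PQ'] g_def)
    then show "\<bar>(g ^^ t) (l x)\<bar> \<in> F (blk x)" using l(2)[OF x] by simp
    show "\<bar>(g ^^ t) (l x)\<bar> \<in> ?I"
      using * join_block_subset[OF PQ' intv.I_subset_pm[OF l(1)[OF x]]] by (auto simp: blk'_def)
  qed
  have blk_eq: "blk y = blk x" if "x \<in> ?I" "y \<in> blk x" for x y
    using join_block_eq[OF PQ intv.I_subset_pm[OF that(1)]] that(2) by (simp add: blk_def)
  have blk'_eq: "blk' y = blk' x" if "x \<in> ?I" "y \<in> blk' x" for x y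
    using join_block_eq[OF PQ' intv.I_subset_pm[OF that(1)]] that(2) by (simp add: blk'_def)
  have abs_iff: "\<bar>(f ^^ t) (k x)\<bar> = \<bar>(f ^^ u) (k x)\<bar> \<longleftrightarrow> \<bar>(g ^^ t) (l x)\<bar> = \<bar>(g ^^ u) (l x)\<bar>"
    if x: "x \<in> ?I" for x t u
  proof -
    have orb: "(f ^^ t) (k x) \<in> orbit f (k x)" "(g ^^ t) (l x) \<in> orbit g (l x)" for t
      using perm by (auto simp: orbit_altdef_permutation)
    have "\<bar>(f ^^ t) (k x)\<bar> = \<bar>(f ^^ u) (k x)\<bar> \<longleftrightarrow> (f ^^ t) (k x) = (f ^^ u) (k x)"
      by (rule inj_on_eq_iff[OF intv.premap_inj_abs[OF f intv.I_subset_pm[OF k(1)[OF x]]] orb(1) orb(1)])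
    also have "\<dots> \<longleftrightarrow> (g ^^ t) (l x) = (g ^^ u) (l x)"
      by (rule power_eq_iff_least_power[OF perm L[OF x]])
    also have "\<dots> \<longleftrightarrow> \<bar>(g ^^ t) (l x)\<bar> = \<bar>(g ^^ u) (l x)\<bar>"
      by (rule inj_on_eq_iff[OF intv.premap_inj_abs[OF g intv.I_subset_pm[OF l(1)[OF x]]] orb(2) orb(2), symmetric])
    finally show ?thesis .
  qed
  have \<sigma>_pow: "\<sigma> \<bar>(f ^^ t) (k x)\<bar> = \<bar>(g ^^ t) (l x)\<bar>" if x: "x \<in> ?I" for x t
  proof -
    let ?y = "\<bar>(f ^^ t) (k x)\<bar>"
    have y: "?y \<in> ?I" "blk ?y = blk x" using pow_mem[OF x] blk_eq[OF x] by blast+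
    then have kl: "k ?y = k x" "l ?y = l x" by (simp_all add: k_def l_def)
    have "rep ?y (SOME u. rep ?y u)" by (rule someI_ex[OF rep_ex[OF y(1)]])
    then have "?y = \<bar>(f ^^ Suc (SOME u. rep ?y u)) (k x)\<bar>" unfolding rep_def kl .
    then have "\<bar>(g ^^ t) (l x)\<bar> = \<bar>(g ^^ Suc (SOME u. rep ?y u)) (l x)\<bar>"
      unfolding abs_iff[OF x] .
    then show ?thesis using y(1) by (simp add: \<sigma>_def kl del: atLeastAtMost_iff)
  qed
  have \<sigma>_rep: "\<exists>t. x = \<bar>(f ^^ Suc t) (k x)\<bar> \<and> \<sigma> x = \<bar>(g ^^ Suc t) (l x)\<bar>" if x: "x \<in> ?I" for x
  proof -
    obtain t where "x = \<bar>(f ^^ Suc t) (k x)\<bar>" using rep_ex[OF x] unfolding rep_def by blast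
    then show ?thesis using \<sigma>_pow[OF x, of "Suc t"] by metis
  qed
  have maps: "\<sigma> x \<in> ?I" if "x \<in> ?I" for x using \<sigma>_rep[OF that] pow_mem'(1)[OF that] by metis
  have "inj_on \<sigma> ?I"
  proof (rule inj_onI)
    fix x y assume x: "x \<in> ?I" and y: "y \<in> ?I" and eq: "\<sigma> x = \<sigma> y"
    have "\<sigma> z \<in> blk' (l z)" if "z \<in> ?I" for z
      using \<sigma>_rep[OF that] pow_mem'(2)[OF that] l(2)[OF that] by metis
    then have "blk' (l x) = blk' (l y)"
      using blk'_eq[OF l(1)[OF x]] blk'_eq[OF l(1)[OF y]] x y eq by metis
    then have "F (blk x) = F (blk y)" using l(2) x y by simp
    then have "blk x = blk y" using F(1) x y by (auto simp: bij_betw_def inj_on_def)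
    then have kl: "k y = k x" "l y = l x" by (simp_all add: k_def l_def)
    obtain t where t: "x = \<bar>(f ^^ Suc t) (k x)\<bar>" "\<sigma> x = \<bar>(g ^^ Suc t) (l x)\<bar>" using \<sigma>_rep[OF x] by blast
    obtain u where u: "y = \<bar>(f ^^ Suc u) (k x)\<bar>" "\<sigma> y = \<bar>(g ^^ Suc u) (l x)\<bar>" using \<sigma>_rep[OF y] kl by metis
    have "\<bar>(g ^^ Suc t) (l x)\<bar> = \<bar>(g ^^ Suc u) (l x)\<bar>" using t(2) u(2) eq by simp
    then have "\<bar>(f ^^ Suc t) (k x)\<bar> = \<bar>(f ^^ Suc u) (k x)\<bar>" unfolding abs_iff[OF x] .
    then show "x = y" using t(1) u(1) by simp
  qed
  moreover have "\<sigma> ` ?I \<subseteq> ?I" using maps by blast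
  ultimately have "bij_betw \<sigma> ?I ?I" by (simp add: bij_betw_def endo_inj_surj)
  then have "\<sigma> permutes ?I" by (rule bij_imp_permutes) (simp add: \<sigma>_def del: atLeastAtMost_iff)
  moreover have "\<sigma> (pairing_perm P x) = pairing_perm P' (\<sigma> x)" "\<sigma> (pairing_perm Q x) = pairing_perm Q' (\<sigma> x)"
    if x: "x \<in> ?I" for x
  proof -
    obtain t where t: "x = \<bar>(f ^^ Suc t) (k x)\<bar>" "\<sigma> x = \<bar>(g ^^ Suc t) (l x)\<bar>" using \<sigma>_rep[OF x] by blast
    note a = pair_premap_power_step[OF PQ k(1)[OF x], folded f_def]
    note b = pair_premap_power_step[OF PQ' l(1)[OF x], folded g_def]
    show "\<sigma> (pairing_perm P x) = pairing_perm P' (\<sigma> x)"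
      using a(1)[of t] b(1)[of t] \<sigma>_pow[OF x] t by metis
    show "\<sigma> (pairing_perm Q x) = pairing_perm Q' (\<sigma> x)"
      using a(2)[of t] b(2)[of t] \<sigma>_pow[OF x] t by metis
  qed
  ultimately show ?thesis using that by blast
qed

section \<open>Invariance of the Weingarten function under relabelling\<close>

lemma is_pseudoinverse_on_reindex:
  assumes h: "bij_betw h J J" and G: "\<And>i j. i \<in> J \<Longrightarrow> j \<in> J \<Longrightarrow> G (h i) (h j) = G i j"
    and W: "is_pseudoinverse_on J G W"
    and W': "\<And>i j. i \<in> J \<Longrightarrow> j \<in> J \<Longrightarrow> W' i j = W (h i) (h j)"
  shows "is_pseudoinverse_on J G W'"
proof -
  have hJ: "h i \<in> J" if "i \<in> J" for i using h that by (auto simp: bij_betw_def)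
  have mult: "mmult_on J A B i j = mmult_on J A' B' (h i) (h j)"
    if "\<And>i j. i \<in> J \<Longrightarrow> j \<in> J \<Longrightarrow> A i j = A' (h i) (h j)" "\<And>i j. i \<in> J \<Longrightarrow> j \<in> J \<Longrightarrow> B i j = B' (h i) (h j)"
      "i \<in> J" "j \<in> J" for A A' B B' :: "'a \<Rightarrow> 'a \<Rightarrow> real" and i j
  proof -
    have "mmult_on J A B i j = (\<Sum>k\<in>J. A' (h i) (h k) * B' (h k) (h j))"
      unfolding mmult_on_def using that by (intro sum.cong) auto
    also have "\<dots> = mmult_on J A' B' (h i) (h j)"
      unfolding mmult_on_def by (rule sum.reindex_bij_betw[OF h, of "\<lambda>k. A' (h i) k * B' k (h j)"])
    finally show ?thesis .
  qed
  have GW: "mmult_on J G W' i j = mmult_on J G W (h i) (h j)" and WG: "mmult_on J W' G i j = mmult_on J W G (h i) (h j)"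
    if "i \<in> J" "j \<in> J" for i j
    by (intro mult G[symmetric] W' that; assumption)+
  have GWG: "mmult_on J (mmult_on J G W') G i j = mmult_on J (mmult_on J G W) G (h i) (h j)"
    and WGW: "mmult_on J (mmult_on J W' G) W' i j = mmult_on J (mmult_on J W G) W (h i) (h j)"
    if "i \<in> J" "j \<in> J" for i j
    by (intro mult GW WG G[symmetric] W' that; assumption)+
  show ?thesis
    unfolding is_pseudoinverse_on_def
  proof (intro conjI ballI)
    fix i j assume ij: "i \<in> J" "j \<in> J"
    note * = W[unfolded is_pseudoinverse_on_def] hJ[OF ij(1)] hJ[OF ij(2)]
    show "mmult_on J (mmult_on J G W') G i j = G i j" using * GWG[OF ij] G[OF ij] by metis
    show "mmult_on J (mmult_on J W' G) W' i j = W' i j" using * WGW[OF ij] W'[OF ij] by metis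
    show "mmult_on J G W' i j = mmult_on J G W' j i" using * GW[OF ij] GW[OF ij(2,1)] by metis
    show "mmult_on J W' G i j = mmult_on J W' G j i" using * WG[OF ij] WG[OF ij(2,1)] by metis
  qed
qed

lemma pairing_relabel:
  assumes \<sigma>: "\<sigma> permutes A" and P: "P \<in> pairings_on A"
  shows "(`) ((`) \<sigma>) P \<in> pairings_on A"
    and "k \<in> A \<Longrightarrow> pairing_perm ((`) ((`) \<sigma>) P) (\<sigma> k) = \<sigma> (pairing_perm P k)"
proof -
  have inj: "inj \<sigma>" by (rule permutes_inj[OF \<sigma>])
  have part: "partition_on A P" using P by (simp add: pairings_on_def)
  have "{} \<notin> (`) ((`) \<sigma>) P" using part by (auto simp: partition_on_def)
  then have "partition_on (\<sigma> ` A) ((`) ((`) \<sigma>) P)"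
    using partition_on_inj_image[OF part inj_on_subset[OF inj]] by simp
  then show mem: "(`) ((`) \<sigma>) P \<in> pairings_on A"
    using P inj by (auto simp: pairings_on_def permutes_image[OF \<sigma>] card_image inj_on_subset)
  show "pairing_perm ((`) ((`) \<sigma>) P) (\<sigma> k) = \<sigma> (pairing_perm P k)" if "k \<in> A"
    using imageI[OF pairing_perm_mem(1)[OF P that], of "(`) \<sigma>"] by (intro pairing_perm_eqI[OF mem]) simp
qed

text \<open>Relabelling permutes the pairings without changing the Gram matrix, so the relabelled
  \<open>Wg\<close> is again a pseudoinverse, and uniqueness applies.\<close>

lemma Wg_relabel:
  assumes \<sigma>: "\<sigma> permutes intv n" and PQ: "P \<in> pairings n" "Q \<in> pairings n"
  shows "Wg CARD('d::finite) n ((`) ((`) \<sigma>) P) ((`) ((`) \<sigma>) Q) = Wg CARD('d) n P Q"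
proof -
  let ?J = "pairings_on (intv n)" and ?G = "gram CARD('d) n" and ?W = "Wg CARD('d) n"
  define h where "h P = (`) ((`) \<sigma>) P" for P :: "int set set"
  have hJ: "h P \<in> ?J" if "P \<in> ?J" for P unfolding h_def by (rule pairing_relabel(1)[OF \<sigma> that])
  have "inj ((`) \<sigma>)" using permutes_inj[OF \<sigma>] by (simp add: inj_on_def inj_image_eq_iff)
  then have "inj_on h ?J" by (intro inj_onI) (simp only: h_def inj_image_eq_iff)
  moreover have "h ` ?J \<subseteq> ?J" using hJ by blast
  ultimately have bij: "bij_betw h ?J ?J"
    by (simp add: bij_betw_def endo_inj_surj finite_pairings_on)
  have const: "const_on (h P) l \<longleftrightarrow> const_on P (\<lambda>k\<in>intv n. l (\<sigma> k))" if P: "P \<in> ?J" for P and l :: "int \<Rightarrow> 'd"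
  proof -
    have "const_on (h P) l \<longleftrightarrow> (\<forall>k\<in>\<sigma> ` intv n. l (pairing_perm (h P) k) = l k)"
      by (simp only: const_on_pairing_iff[OF hJ[OF P]] permutes_image[OF \<sigma>])
    also have "\<dots> \<longleftrightarrow> (\<forall>k\<in>intv n. l (\<sigma> (pairing_perm P k)) = l (\<sigma> k))"
      using pairing_relabel(2)[OF \<sigma> P] by (simp add: h_def del: atLeastAtMost_iff)
    also have "\<dots> \<longleftrightarrow> const_on P (\<lambda>k\<in>intv n. l (\<sigma> k))"
      unfolding const_on_pairing_iff[OF P]
      by (intro ball_cong refl) (simp add: pairing_perm_mem(2)[OF P] del: atLeastAtMost_iff)
    finally show ?thesis .
  qed
  have gram: "?G (h P) (h Q) = ?G P Q" if P: "P \<in> ?J" and Q: "Q \<in> ?J" for P Q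
    unfolding gram_eq_sum[OF P Q, where 'd = 'd] gram_eq_sum[OF hJ[OF P] hJ[OF Q], where 'd = 'd] const[OF P] const[OF Q]
  proof (rule sum.reindex_bij_witness[where i = "\<lambda>l. \<lambda>k\<in>intv n. l (inv \<sigma> k)" and j = "\<lambda>l. \<lambda>k\<in>intv n. l (\<sigma> k)"], goal_cases)
    case (1 l)
    then show ?case
      using permutes_in_image[OF permutes_inv[OF \<sigma>]]
      by (auto simp: fun_eq_iff permutes_inverses[OF \<sigma>] PiE_def extensional_def simp del: atLeastAtMost_iff)
  next
    case (3 l)
    then show ?case
      using permutes_in_image[OF \<sigma>]
      by (auto simp: fun_eq_iff permutes_inverses[OF \<sigma>] PiE_def extensional_def simp del: atLeastAtMost_iff)
  qed auto
  \<comment> \<open>Uniqueness holds among the functions that vanish outside the pairings; hence the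
    cutoff.\<close>
  define B where "B P Q = (if P \<in> ?J \<and> Q \<in> ?J then ?W (h P) (h Q) else 0)" for P Q
  have "B = pseudoinverse_on ?J ?G"
  proof (rule pseudoinverse_on_symmetric(3)[OF _ gram_sym])
    show "is_pseudoinverse_on ?J ?G B"
    proof (rule is_pseudoinverse_on_reindex[where h = h and G = ?G and W = ?W])
      show "is_pseudoinverse_on ?J ?G ?W"
        using Wg_pseudoinverse[of n, where 'd = 'd] by (simp only: pairings_eq)
    qed (rule bij gram; assumption | simp add: B_def)+
    show "supported_on ?J B" by (simp add: supported_on_def B_def)
  qed (simp add: finite_pairings_on)
  then have "B P Q = ?W P Q" by (simp add: Wg_def pairings_eq)
  then show ?thesis using PQ by (simp add: B_def h_def pairings_eq)
qed

lemma wg_diagram_young: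
  assumes PQ: "P \<in> pairings n" "Q \<in> pairings n"
  shows "wg_diagram CARD('d::finite) (young (intv n) (pair_premap n P Q)) = wg CARD('d) n P Q"
proof -
  let ?J = "pairings_on (intv n)"
  note PQ' = PQ[unfolded pairings_eq]
  let ?R = "partition_join (intv n) P Q"
  have R: "?R = join_block n P Q ` intv n" by (rule partition_join_eq[OF PQ'])
  have finR: "finite ?R" unfolding R by simp
  have part: "partition_on (intv n) ?R" unfolding R by (rule partition_on_join_blocks[OF PQ'])
  \<comment> \<open>\<open>wg_diagram\<close> recovers \<open>n\<close> from the diagram. Halving
    the block sizes loses nothing because they are even.\<close>
  have "2 * sum_mset (half_diagram ?R) = (\<Sum>B\<in>?R. 2 * (card B div 2))"
    unfolding half_diagram_def sum_unfold_sum_mset[symmetric] by (simp add: sum_distrib_left)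
  also have "\<dots> = (\<Sum>B\<in>?R. card B)"
    using even_card_join_block[OF PQ'] by (intro sum.cong refl) (auto simp: R simp del: atLeastAtMost_iff)
  also have "\<dots> = card (intv n)"
  proof -
    have "finite B" if "B \<in> ?R" for B
      using that part by (auto simp: partition_on_def intro!: finite_subset[of B "intv n"])
    then show ?thesis using product_partition[OF part] by simp
  qed
  finally have size: "2 * sum_mset (half_diagram ?R) = n" by simp
  have uniq: "wg CARD('d) n P1 Q1 = wg CARD('d) n P Q"
    if PQ1: "P1 \<in> ?J" "Q1 \<in> ?J" and diag: "half_diagram (partition_join (intv n) P1 Q1) = half_diagram ?R" for P1 Q1
  proof -
    obtain \<sigma> where \<sigma>: "\<sigma> permutes intv n"
      "\<And>x. x \<in> intv n \<Longrightarrow> \<sigma> (pairing_perm P x) = pairing_perm P1 (\<sigma> x)"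
      "\<And>x. x \<in> intv n \<Longrightarrow> \<sigma> (pairing_perm Q x) = pairing_perm Q1 (\<sigma> x)"
      using same_diagram_conjugate[OF PQ' PQ1 diag[symmetric]] by blast
    have relabel: "(`) ((`) \<sigma>) S = S1"
      if "S \<in> ?J" "S1 \<in> ?J" "\<And>x. x \<in> intv n \<Longrightarrow> \<sigma> (pairing_perm S x) = pairing_perm S1 (\<sigma> x)" for S S1
    proof -
      have "(`) ((`) \<sigma>) S = (\<lambda>k. {\<sigma> k, \<sigma> (pairing_perm S k)}) ` intv n"
        by (subst pairing_eq_image[OF that(1)]) (simp add: image_image)
      also have "\<dots> = (\<lambda>k. {k, pairing_perm S1 k}) ` (\<sigma> ` intv n)"
        unfolding image_image using that(3) by (intro image_cong refl) simp
      also have "\<dots> = S1"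
        unfolding permutes_image[OF \<sigma>(1)] by (rule pairing_eq_image[OF that(2), symmetric])
      finally show ?thesis .
    qed
    have "card (partition_join (intv n) P1 Q1) = card ?R"
      using arg_cong[OF diag, of size] by (simp add: half_diagram_def)
    then show ?thesis
      using Wg_relabel[OF \<sigma>(1) PQ, where 'd = 'd] relabel[OF PQ'(1) PQ1(1) \<sigma>(2)] relabel[OF PQ'(2) PQ1(2) \<sigma>(3)]
      by (simp add: wg_def)
  qed
  show ?thesis
    unfolding wg_diagram_def young_pair_premap[OF PQ'] Let_def size
  proof (rule the_equality)
    show "\<exists>P1\<in>pairings n. \<exists>Q1\<in>pairings n. half_diagram (partition_join (intv n) P1 Q1) = half_diagram ?R \<and>
        wg CARD('d) n P Q = wg CARD('d) n P1 Q1"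
      using PQ by blast
  qed (use uniq pairings_eq in blast)
qed

section \<open>Averaging over the random matrices\<close>

lemma indep_rv_distr_pair:
  assumes M: "prob_space M" and indep: "indep_rv M S U T V"
  shows "distr M S U \<Otimes>\<^sub>M distr M T V = distr M (S \<Otimes>\<^sub>M T) (\<lambda>\<omega>. (U \<omega>, V \<omega>))"
proof -
  interpret prob_space M by fact
  have [measurable]: "U \<in> measurable M S" "V \<in> measurable M T"
    and ind: "indep_set (sets (vimage_algebra (space M) U S)) (sets (vimage_algebra (space M) V T))"
    using indep by (auto simp: indep_rv_def)
  interpret U: prob_space "distr M S U" by (rule prob_space_distr) measurable
  interpret V: prob_space "distr M T V" by (rule prob_space_distr) measurable
  show ?thesis
  proof (rule pair_measure_eqI)
    fix A B assume "A \<in> sets (distr M S U)" "B \<in> sets (distr M T V)"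
    then have [measurable]: "A \<in> sets S" "B \<in> sets T" by auto
    have "(\<lambda>\<omega>. (U \<omega>, V \<omega>)) -` (A \<times> B) \<inter> space M = (U -` A \<inter> space M) \<inter> (V -` B \<inter> space M)" by auto
    then have "emeasure (distr M (S \<Otimes>\<^sub>M T) (\<lambda>\<omega>. (U \<omega>, V \<omega>))) (A \<times> B) = prob ((U -` A \<inter> space M) \<inter> (V -` B \<inter> space M))"
      by (subst emeasure_distr) (simp_all add: emeasure_eq_measure)
    also have "prob ((U -` A \<inter> space M) \<inter> (V -` B \<inter> space M)) = prob (U -` A \<inter> space M) * prob (V -` B \<inter> space M)"
      by (intro indep_setD[OF ind] in_vimage_algebra) measurable
    finally show "emeasure (distr M S U) A * emeasure (distr M T V) B
        = emeasure (distr M (S \<Otimes>\<^sub>M T) (\<lambda>\<omega>. (U \<omega>, V \<omega>))) (A \<times> B)"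
      by (simp add: emeasure_distr emeasure_eq_measure ennreal_mult)
  next
    show "sets (distr M S U \<Otimes>\<^sub>M distr M T V) = sets (distr M (S \<Otimes>\<^sub>M T) (\<lambda>\<omega>. (U \<omega>, V \<omega>)))"
      unfolding sets_distr by (rule sets_pair_measure_cong) (rule sets_distr)+
  qed (rule U.sigma_finite_measure_axioms V.sigma_finite_measure_axioms)+
qed

text \<open>Fubini for the joint law, which is a product by independence. Integrability is asked of
  the integrand as a whole, so that its separate factors may fail it.\<close>

lemma indep_rv_integral:
  fixes F :: "'a \<Rightarrow> 'b \<Rightarrow> complex"
  assumes M: "prob_space M" and indep: "indep_rv M S U T V"
    and F[measurable]: "case_prod F \<in> borel_measurable (S \<Otimes>\<^sub>M T)"
    and int: "integrable M (\<lambda>\<omega>. F (U \<omega>) (V \<omega>))"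
  shows "(\<integral>\<omega>. F (U \<omega>) (V \<omega>) \<partial>M) = (\<integral>\<omega>. (\<integral>a. F a (V \<omega>) \<partial>distr M S U) \<partial>M)"
proof -
  interpret prob_space M by fact
  have [measurable]: "U \<in> measurable M S" "V \<in> measurable M T"
    using indep by (auto simp: indep_rv_def)
  interpret U: prob_space "distr M S U" by (rule prob_space_distr) measurable
  interpret V: prob_space "distr M T V" by (rule prob_space_distr) measurable
  interpret UV: pair_sigma_finite "distr M S U" "distr M T V" ..
  note joint = indep_rv_distr_pair[OF M indep]
  have int': "integrable (distr M S U \<Otimes>\<^sub>M distr M T V) (case_prod F)"
    unfolding joint using int by (subst integrable_distr_eq) auto
  have "(\<integral>\<omega>. F (U \<omega>) (V \<omega>) \<partial>M) = integral\<^sup>L (distr M S U \<Otimes>\<^sub>M distr M T V) (case_prod F)"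
    unfolding joint by (subst integral_distr) auto
  also have "\<dots> = (\<integral>b. (\<integral>a. F a b \<partial>distr M S U) \<partial>distr M T V)"
    by (rule UV.integral_snd[OF int', symmetric])
  also have "\<dots> = (\<integral>\<omega>. (\<integral>a. F a (V \<omega>) \<partial>distr M S U) \<partial>M)"
  proof (rule integral_distr)
    have "(\<lambda>(b, a). F a b) \<in> borel_measurable (T \<Otimes>\<^sub>M distr M S U)" by measurable
    then show "(\<lambda>b. \<integral>a. F a b \<partial>distr M S U) \<in> borel_measurable T"
      by (rule U.borel_measurable_lebesgue_integral)
  qed measurable
  finally show ?thesis .
qed

section \<open>Averaging the formula for fixed matrices\<close>

context signs
begin

lemma tr_perm_orth_formula:
  fixes A :: "real^'d::finite^'d" and X :: "int \<Rightarrow> complex^'d^'d"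
  assumes \<phi>: "\<phi> permutes intv n"
  shows "tr_perm (intv n) \<phi> (\<lambda>k. orth_power A (\<epsilon> k) ** X k)
    = (\<Sum>z\<in>indices D. of_real (\<Prod>k\<in>intv n. A $ (z (s k)) $ (z (- s k))) * (\<Prod>k\<in>intv n. X k $ z (- k) $ z (\<phi> k)))
      / of_nat CARD('d) ^ num_cycles (intv n) \<phi>"
  unfolding tr_perm_orth_expand[OF \<phi>, symmetric] by simp

text \<open>Values in the product space \<open>PiM\<close> must be extensional, hence the
  restriction; the expanded trace uses only the matrices indexed by [n].\<close>

lemma tr_perm_orth_restrict:
  fixes A :: "real^'d::finite^'d" and X :: "int \<Rightarrow> complex^'d^'d"
  assumes \<phi>: "\<phi> permutes intv n"
  shows "tr_perm (intv n) \<phi> (\<lambda>k. orth_power A (\<epsilon> k) ** (\<lambda>k\<in>intv n. X k) k)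
    = tr_perm (intv n) \<phi> (\<lambda>k. orth_power A (\<epsilon> k) ** X k)"
  unfolding tr_perm_orth_formula[OF \<phi>]
  by (intro arg_cong2[of _ _ _ _ "(/)"] sum.cong arg_cong2[of _ _ _ _ "(*)"] prod.cong refl) simp

text \<open>After expansion the trace is a polynomial in the entries of the matrices.\<close>

lemma tr_perm_orth_measurable:
  assumes \<phi>: "\<phi> permutes intv n"
  shows "(\<lambda>(A, x). tr_perm (intv n) \<phi> (\<lambda>k. orth_power A (\<epsilon> k) ** x k))
    \<in> borel_measurable (borel \<Otimes>\<^sub>M PiM (intv n) (\<lambda>_. borel :: (complex^'d::finite^'d) measure))"
  unfolding tr_perm_orth_formula[OF \<phi>] by measurable

theorem expectation_tr_perm:
  fixes Orth :: "'w \<Rightarrow> real^'d::finite^'d" and X :: "int \<Rightarrow> 'w \<Rightarrow> complex^'d^'d"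
  assumes M: "prob_space M" and haar: "haar_orthogonal_measure (distr M borel Orth)"
    and \<phi>: "\<phi> permutes intv n"
    and indep: "indep_rv M borel Orth (PiM (intv n) (\<lambda>_. borel)) (\<lambda>\<omega>. \<lambda>k\<in>intv n. X k \<omega>)"
    and int: "integrable M (\<lambda>\<omega>. tr_perm (intv n) \<phi> (\<lambda>k. orth_power (Orth \<omega>) (\<epsilon> k) ** X k \<omega>))"
    and int_half: "\<And>P Q. P \<in> pairings n \<Longrightarrow> Q \<in> pairings n \<Longrightarrow> integrable M (\<lambda>\<omega>. tr_half (intv n)
             (inv_K \<phi> P Q) (\<lambda>k. X k \<omega>))"
  shows "(\<integral>\<omega>. tr_perm (intv n) \<phi> (\<lambda>k. orth_power (Orth \<omega>) (\<epsilon> k) ** X k \<omega>) \<partial>M)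
       = (\<Sum>(P, Q) \<in> pairings n \<times> pairings n.
            of_real (genus_weight CARD('d) \<phi> P Q)
            * (\<integral>\<omega>. tr_half (intv n)
                 (inv_K \<phi> P Q) (\<lambda>k. X k \<omega>) \<partial>M))"
proof -
  define F where "F A x = tr_perm (intv n) \<phi> (\<lambda>k. orth_power A (\<epsilon> k) ** x k)"
    for A :: "real^'d^'d" and x :: "int \<Rightarrow> complex^'d^'d"
  define V where "V \<omega> = (\<lambda>k\<in>intv n. X k \<omega>)" for \<omega>
  have FV: "F A (V \<omega>) = F A (\<lambda>k. X k \<omega>)" for A \<omega>
    unfolding F_def V_def by (rule tr_perm_orth_restrict[OF \<phi>])
  have "(\<integral>\<omega>. F (Orth \<omega>) (\<lambda>k. X k \<omega>) \<partial>M) = (\<integral>\<omega>. F (Orth \<omega>) (V \<omega>) \<partial>M)"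
    by (simp only: FV)
  also have "\<dots> = (\<integral>\<omega>. (\<integral>A. F A (V \<omega>) \<partial>distr M borel Orth) \<partial>M)"
  proof (rule indep_rv_integral[where F = F and U = Orth and V = V and S = borel
        and T = "PiM (intv n) (\<lambda>_. borel)", OF M])
    show "indep_rv M borel Orth (PiM (intv n) (\<lambda>_. borel)) V"
      using indep by (simp add: V_def[abs_def])
    show "case_prod F \<in> borel_measurable (borel \<Otimes>\<^sub>M PiM (intv n) (\<lambda>_. borel))"
      unfolding F_def using tr_perm_orth_measurable[OF \<phi>] .
    show "integrable M (\<lambda>\<omega>. F (Orth \<omega>) (V \<omega>))"
      unfolding FV using int by (simp add: F_def)
  qed
  also have "\<dots> = (\<integral>\<omega>. (\<Sum>p \<in> pairings n \<times> pairings n. case p of (P, Q) \<Rightarrow>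
            of_real (genus_weight CARD('d) \<phi> P Q)
            * tr_half (intv n) (inv_K \<phi> P Q) (\<lambda>k. X k \<omega>)) \<partial>M)"
    unfolding FV unfolding F_def haar_expectation_tr_perm[OF haar \<phi>] ..
  also have "\<dots> = (\<Sum>(P, Q) \<in> pairings n \<times> pairings n.
            of_real (genus_weight CARD('d) \<phi> P Q)
            * (\<integral>\<omega>. tr_half (intv n) (inv_K \<phi> P Q) (\<lambda>k. X k \<omega>) \<partial>M))"
    using int_half
    by (subst Bochner_Integration.integral_sum) (auto intro!: sum.cong integrable_mult_right simp del: of_real_mult)
  finally show ?thesis by (simp only: F_def)
qed

end

theorem proposition3p4:
  fixes M :: "'w measure"
    and Orth :: "'w \<Rightarrow> real^'d^'d"
    and X :: "int \<Rightarrow> 'w \<Rightarrow> complex^'d^'d"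
    and n :: nat and \<phi> :: "int \<Rightarrow> int" and \<epsilon> :: "int \<Rightarrow> int"
  defines "N \<equiv> CARD('d)"
  assumes "prob_space M"
    and "Orth \<in> borel_measurable M"
    and "haar_orthogonal_measure (distr M borel Orth)"
    and "\<phi> permutes intv n"
    and "\<And>k. k \<in> intv n \<Longrightarrow> \<epsilon> k \<in> {1, -1}"
    and "\<And>k. k \<in> intv n \<Longrightarrow> X k \<in> borel_measurable M"
    and "indep_rv M borel Orth
           (PiM (intv n) (\<lambda>_. borel)) (\<lambda>\<omega>. \<lambda>k\<in>intv n. X k \<omega>)"
    and "integrable M (\<lambda>\<omega>. tr_perm (intv n) \<phi> (\<lambda>k. orth_power (Orth \<omega>) (\<epsilon> k) ** X k \<omega>))"
    and "\<And>\<pi>\<^sub>p \<pi>\<^sub>m. \<pi>\<^sub>p \<in> pairings n \<Longrightarrow> \<pi>\<^sub>m \<in> pairings n \<Longrightarrow>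
           integrable M (\<lambda>\<omega>. tr_half (intv n)
             (inv (K_map (intv n) \<phi> (twist n \<epsilon> (pair_premap n \<pi>\<^sub>p \<pi>\<^sub>m)))) (\<lambda>k. X k \<omega>))"
    and "\<And>\<alpha>. \<alpha> \<in> alt_premaps (intv n) \<Longrightarrow>
           integrable M (\<lambda>\<omega>. tr_half (intv n)
             (inv (K_map (intv n) \<phi> (twist n \<epsilon> \<alpha>))) (\<lambda>k. X k \<omega>))"
  shows
    "(\<integral>\<omega>. tr_perm (intv n) \<phi> (\<lambda>k. orth_power (Orth \<omega>) (\<epsilon> k) ** X k \<omega>) \<partial>M)
       = (\<Sum>(\<pi>\<^sub>p, \<pi>\<^sub>m) \<in> pairings n \<times> pairings n.
            of_real (real N powr (chi (intv n) \<phi> (twist n \<epsilon> (pair_premap n \<pi>\<^sub>p \<pi>\<^sub>m))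
                                   - 2 * real (num_cycles (intv n) \<phi>))
                     * wg N n \<pi>\<^sub>p \<pi>\<^sub>m)
            * (\<integral>\<omega>. tr_half (intv n)
                 (inv (K_map (intv n) \<phi> (twist n \<epsilon> (pair_premap n \<pi>\<^sub>p \<pi>\<^sub>m)))) (\<lambda>k. X k \<omega>) \<partial>M))
     \<and> (\<Sum>(\<pi>\<^sub>p, \<pi>\<^sub>m) \<in> pairings n \<times> pairings n.
            of_real (real N powr (chi (intv n) \<phi> (twist n \<epsilon> (pair_premap n \<pi>\<^sub>p \<pi>\<^sub>m))
                                   - 2 * real (num_cycles (intv n) \<phi>))
                     * wg N n \<pi>\<^sub>p \<pi>\<^sub>m)
            * (\<integral>\<omega>. tr_half (intv n)
                 (inv (K_map (intv n) \<phi> (twist n \<epsilon> (pair_premap n \<pi>\<^sub>p \<pi>\<^sub>m)))) (\<lambda>k. X k \<omega>) \<partial>M))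
       = (\<Sum>\<alpha>\<in>alt_premaps (intv n).
            of_real (real N powr (chi (intv n) \<phi> (twist n \<epsilon> \<alpha>)
                                   - 2 * real (num_cycles (intv n) \<phi>))
                     * wg_diagram N (young (intv n) \<alpha>))
            * (\<integral>\<omega>. tr_half (intv n)
                 (inv (K_map (intv n) \<phi> (twist n \<epsilon> \<alpha>))) (\<lambda>k. X k \<omega>) \<partial>M))"
proof -
  interpret signs n \<epsilon> by unfold_locales fact
  have reindex: "sum f (alt_premaps (intv n)) = (\<Sum>(P, Q)\<in>pairings n \<times> pairings n. f (pair_premap n P Q))"
    for f :: "(int \<Rightarrow> int) \<Rightarrow> complex"
    unfolding sum.reindex_bij_betw[OF bij_betw_pair_premap, symmetric] by (simp add: case_prod_unfold)
  show ?thesis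
    unfolding N_def reindex
  proof (intro conjI expectation_tr_perm sum.cong refl, goal_cases)
    \<comment> \<open>Goals 1 to 6 are the hypotheses of \<open>expectation_tr_perm\<close>; goal 7
      compares the summands of the two sums after reindexing.\<close>
    case (7 p)
    then show ?case by (auto simp: wg_diagram_young)
  qed (use assms in \<open>simp_all only:\<close>)
qed

end
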